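(* Let $r\ge 2$, let $a>1$ be arbitrary, let $d$ be a visual metric on $\partial F_r$ with visual parameter $a$ and let $\hat d$ be the corresponding product metric on $\partial F_r\times\partial F_r$. Let $L$ be a subexponentially growing algebraic lamination on $F_r$. Then: (1) for the metric space $(\partial F_r,d)$ we have $\dim_H(\mathcal E_L)=\dim_p(\mathcal E_L)=0$; (2) for the metric space $(\partial F_r\times\partial F_r,\hat d)$ we have $\dim_H(L)=\dim_p(L)=0$.
   Context: **Boundary and laminations.** $F_r$ is the free group of rank $r\ge2$, $\partial F_r$ its hyperbolic boundary, $\partial^2F_r=\{(p,q)\in\partial F_r\times\partial F_r:p\ne q\}$. An (abstract) algebraic lamination on $F_r$ is a subset $L\subseteq\partial^2F_r$ closed in $\partial^2F_r$, invariant under the diagonal $F_r$-action and under $(p,q)\mapsto(q,p)$; $\mathcal E_L=\{p\in\partial F_r:(p,q)\in L\text{ for some }q\}$. **Outer space.** $\mathrm{cv}_r$ is the set of $\mathbb R$-trees $T$ with a minimal nontrivial free discrete isometric $F_r$-action (up to $F_r$-equivariant isometry). For $T\in\mathrm{cv}_r$, $\Gamma=T/F_r$ is a finite connected graph, all vertices of degree $\ge3$, with an identification (marking) $\pi_1(\Gamma)=F_r$ and an induced metric structure $\mathfrak J$ giving every edge $e$ a length $\mathfrak J(e)>0$; $\partial T$ is identified with $\partial F_r$. $E\Gamma$ is the set of oriented edges. For an edge-path $\gamma$, $|\gamma|$ is the number of edges and $\mathfrak J(\gamma)$ the sum of edge lengths. **Laminary language and growth.** $L_\Gamma\subseteq(E\Gamma)^*$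 is the set of all finite edge-paths $\gamma$ in $\Gamma$ with $|\gamma|>0$ having a lift to $T$ that is a subpath of the bi-infinite geodesic in $T$ from $p$ to $q$ for some $(p,q)\in L$. For $n\ge1$, $\beta_{L_\Gamma,\mathfrak J}(n)=\#\{\gamma\in L_\Gamma:\mathfrak J(\gamma)\le n\}$ (and value $0$ at $n=0$). A monotone nondecreasing $f:\mathbb N\to\mathbb N$ is subexponential if $\lim_{n\to\infty}f(n)/b^n=0$ for every real $b>1$. $L$ is subexponentially growing if for some (equivalently, every) $T\in\mathrm{cv}_r$ the function $\beta_{L_\Gamma,\mathfrak J}$ is subexponential. **Visual metrics.** Let $F_r$ act properly discontinuously, cocompactly and isometrically on a proper Gromov-hyperbolic geodesic space $X$, so that $\partial F_r=\partial X$. For $x_0\in X$, $a>1$, a metric $d$ on $\partial F_r=\partial X$ is a visual metric with visual parameter $a$ if for some $C\ge1$, $\frac1Ca^{-(p,q)_{x_0}}\le d(p,q)\le Ca^{-(p,q)_{x_0}}$ for all $p,q$, with $(p,q)_{x_0}$ the Gromov product on $\partial X$. $\hat d((p,q),(p',q'))=\max\{d(p,p'),d(q,q')\}$. **Dimensions.** $\dim_H$ is the Hausdorff dimension. For $s\ge0$ let $P_{0,s}(S)=\lim_{\delta\to0+}\sup\sum_i\mathrm{diam}(B_i)^s$ over countable families of pairwise disjoint closed balls $B_i$ of diameter $\le\delta$ with centers in $S$; $P_s(S)=\inf\{\sum_jP_{0,s}(S_j):S\subseteq\bigcup_jS_j\text{ countable}\}$; the packing dimension is $\dim_p(S)=\inf\{s\ge0:P_s(S)=0\}$.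 *)

theory Defs
  imports "HOL-Analysis.Analysis" "HOL-Algebra.Group_Action" "Graph_Theory.Arc_Walk"
begin

section \<open>Free groups\<close>

text \<open>The free group of rank \<open>r\<close> consists of the reduced words in the letters \<open>(i, b)\<close> with
  \<open>i < r\<close>, where \<open>(i, True)\<close> is the \<open>i\<close>-th basis element and \<open>(i, False)\<close> its inverse.\<close>

type_synonym word = "(nat \<times> bool) list"

definition inv_letter :: "nat \<times> bool \<Rightarrow> nat \<times> bool" where
  "inv_letter x = (fst x, \<not> snd x)"

definition reduced :: "word \<Rightarrow> bool" where
  "reduced w \<longleftrightarrow> successively (\<lambda>x y. y \<noteq> inv_letter x) w"

definition cancel_Cons :: "nat \<times> bool \<Rightarrow> word \<Rightarrow> word" where
  "cancel_Cons x w = (if w \<noteq> [] \<and> hd w = inv_letter x then tl w else x # w)"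

definition free_group :: "nat \<Rightarrow> word monoid" where
  "free_group r = \<lparr>carrier = {w. reduced w \<and> fst ` set w \<subseteq> {..<r}},
     mult = foldr cancel_Cons, one = []\<rparr>"

lemma inv_letter_inv_letter [simp]: "inv_letter (inv_letter x) = x"
  by (simp add: inv_letter_def)

lemma fst_inv_letter [simp]: "fst (inv_letter x) = fst x"
  by (simp add: inv_letter_def)

lemma reduced_cancel_Cons: "reduced w \<Longrightarrow> reduced (cancel_Cons x w)"
  by (cases w) (auto simp: reduced_def cancel_Cons_def successively_Cons)

lemma reduced_foldr: "reduced w \<Longrightarrow> reduced (foldr cancel_Cons u w)"
  by (induction u) (auto intro: reduced_cancel_Cons)

lemma set_foldr_cancel_Cons: "set (foldr cancel_Cons u w) \<subseteq> set u \<union> set w"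
proof (induction u)
  case (Cons x u)
  have "set (cancel_Cons x v) \<subseteq> insert x (set v)" for v
    by (cases v) (auto simp: cancel_Cons_def)
  with Cons show ?case by fastforce
qed simp

lemma cancel_Cons_inv: "reduced w \<Longrightarrow> cancel_Cons (inv_letter x) (cancel_Cons x w) = w"
  by (cases w) (auto simp: cancel_Cons_def reduced_def successively_Cons)

lemma foldr_cancel_Cons:
  assumes "reduced w"
  shows "foldr cancel_Cons (cancel_Cons x v) w = cancel_Cons x (foldr cancel_Cons v w)"
proof (cases "v \<noteq> [] \<and> hd v = inv_letter x")
  case True
  then obtain v' where v: "v = inv_letter x # v'" by (cases v) auto
  have "cancel_Cons x (cancel_Cons (inv_letter x) (foldr cancel_Cons v' w)) = foldr cancel_Cons v' w"
    using cancel_Cons_inv[OF reduced_foldr[OF assms], of "inv_letter x"] by simp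
  then show ?thesis by (simp add: v cancel_Cons_def [of x "inv_letter x # v'"])
next
  case False
  then have "cancel_Cons x v = x # v" unfolding cancel_Cons_def by (simp only: if_False)
  then show ?thesis by simp
qed

lemma foldr_cancel_Cons_assoc:
  "reduced w \<Longrightarrow> foldr cancel_Cons (foldr cancel_Cons u v) w
     = foldr cancel_Cons u (foldr cancel_Cons v w)"
  by (induction u) (auto simp: foldr_cancel_Cons)

lemma foldr_cancel_Cons_Nil: "reduced u \<Longrightarrow> foldr cancel_Cons u [] = u"
  by (induction u) (auto simp: reduced_def successively_Cons cancel_Cons_def)

lemma foldr_cancel_Cons_inverse:
  "reduced w \<Longrightarrow>
     foldr cancel_Cons (rev (map inv_letter u)) (foldr cancel_Cons u w) = w"
  by (induction u) (auto simp: cancel_Cons_inv reduced_foldr)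

lemma reduced_inverse: "reduced u \<Longrightarrow> reduced (rev (map inv_letter u))"
  by (auto simp: reduced_def successively_map elim!: successively_mono)

lemma group_free_group: "group (free_group r)"
proof (rule groupI)
  fix x y z
  assume "x \<in> carrier (free_group r)" "y \<in> carrier (free_group r)" "z \<in> carrier (free_group r)"
  then show "x \<otimes>\<^bsub>free_group r\<^esub> y \<otimes>\<^bsub>free_group r\<^esub> z = x \<otimes>\<^bsub>free_group r\<^esub> (y \<otimes>\<^bsub>free_group r\<^esub> z)"
    by (simp add: free_group_def foldr_cancel_Cons_assoc)
next
  fix x y
  assume "x \<in> carrier (free_group r)" "y \<in> carrier (free_group r)"
  then show "x \<otimes>\<^bsub>free_group r\<^esub> y \<in> carrier (free_group r)"
    using set_foldr_cancel_Cons[of x y] by (force simp: free_group_def reduced_foldr)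
next
  fix x
  assume x: "x \<in> carrier (free_group r)"
  let ?y = "rev (map inv_letter x)"
  have "?y \<in> carrier (free_group r)"
    using x by (auto simp: free_group_def reduced_inverse simp del: rev_map)
  moreover have "?y \<otimes>\<^bsub>free_group r\<^esub> x = \<one>\<^bsub>free_group r\<^esub>"
    using x foldr_cancel_Cons_inverse[of "[]" x]
    by (simp add: free_group_def foldr_cancel_Cons_Nil) (simp add: reduced_def)
  ultimately show "\<exists>y\<in>carrier (free_group r). y \<otimes>\<^bsub>free_group r\<^esub> x = \<one>\<^bsub>free_group r\<^esub>" by blast
qed (auto simp: free_group_def reduced_def)

definition word_dist :: "nat \<Rightarrow> word \<Rightarrow> word \<Rightarrow> real" where
  "word_dist r u v = real (length (inv\<^bsub>free_group r\<^esub> u \<otimes>\<^bsub>free_group r\<^esub> v))"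


section \<open>Gromov hyperbolicity and boundaries\<close>

definition gromov_product :: "('a \<Rightarrow> 'a \<Rightarrow> real) \<Rightarrow> 'a \<Rightarrow> 'a \<Rightarrow> 'a \<Rightarrow> real" where
  "gromov_product d w x y = (d w x + d w y - d x y) / 2"

definition delta_hyperbolic :: "'a set \<Rightarrow> ('a \<Rightarrow> 'a \<Rightarrow> real) \<Rightarrow> real \<Rightarrow> bool" where
  "delta_hyperbolic M d \<delta> \<longleftrightarrow> (\<forall>w\<in>M. \<forall>x\<in>M. \<forall>y\<in>M. \<forall>z\<in>M.
     gromov_product d w x z \<ge> min (gromov_product d w x y) (gromov_product d w y z) - \<delta>)"

definition gromov_hyperbolic :: "'a set \<Rightarrow> ('a \<Rightarrow> 'a \<Rightarrow> real) \<Rightarrow> bool" where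
  "gromov_hyperbolic M d \<longleftrightarrow> (\<exists>\<delta>\<ge>0. delta_hyperbolic M d \<delta>)"

definition geodesic_space :: "'a set \<Rightarrow> ('a \<Rightarrow> 'a \<Rightarrow> real) \<Rightarrow> bool" where
  "geodesic_space M d \<longleftrightarrow> (\<forall>x\<in>M. \<forall>y\<in>M. \<exists>c. c ` {0..d x y} \<subseteq> M \<and> c 0 = x \<and> c (d x y) = y
     \<and> (\<forall>s\<in>{0..d x y}. \<forall>t\<in>{0..d x y}. d (c s) (c t) = \<bar>s - t\<bar>))"

definition proper_space :: "'a set \<Rightarrow> ('a \<Rightarrow> 'a \<Rightarrow> real) \<Rightarrow> bool" where
  "proper_space M d \<longleftrightarrow>
     (\<forall>x\<in>M. \<forall>\<rho>. compactin (Metric_space.mtopology M d) (Metric_space.mcball M d x \<rho>))"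

text \<open>Two sequences that converge to infinity are equivalent if their mutual Gromov products
  diverge; the Gromov boundary is the set of equivalence classes.\<close>

definition products_diverge ::
    "'a set \<Rightarrow> ('a \<Rightarrow> 'a \<Rightarrow> real) \<Rightarrow> (nat \<Rightarrow> 'a) \<Rightarrow> (nat \<Rightarrow> 'a) \<Rightarrow> bool" where
  "products_diverge M d x y \<longleftrightarrow>
     (\<forall>w\<in>M. filterlim (\<lambda>(i, j). gromov_product d w (x i) (y j)) at_top
        (sequentially \<times>\<^sub>F sequentially))"

definition converges_to_infinity ::
    "'a set \<Rightarrow> ('a \<Rightarrow> 'a \<Rightarrow> real) \<Rightarrow> (nat \<Rightarrow> 'a) \<Rightarrow> bool" where
  "converges_to_infinity M d x \<longleftrightarrow> range x \<subseteq> M \<and> products_diverge M d x x"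

definition gromov_rel ::
    "'a set \<Rightarrow> ('a \<Rightarrow> 'a \<Rightarrow> real) \<Rightarrow> ((nat \<Rightarrow> 'a) \<times> (nat \<Rightarrow> 'a)) set" where
  "gromov_rel M d = {(x, y). converges_to_infinity M d x \<and> converges_to_infinity M d y
     \<and> products_diverge M d x y}"

definition gromov_boundary :: "'a set \<Rightarrow> ('a \<Rightarrow> 'a \<Rightarrow> real) \<Rightarrow> (nat \<Rightarrow> 'a) set set" where
  "gromov_boundary M d = {x. converges_to_infinity M d x} // gromov_rel M d"

definition boundary_product ::
    "('a \<Rightarrow> 'a \<Rightarrow> real) \<Rightarrow> 'a \<Rightarrow> (nat \<Rightarrow> 'a) set \<Rightarrow> (nat \<Rightarrow> 'a) set \<Rightarrow> ereal" where
  "boundary_product d w p q = (SUP (x, y)\<in>p \<times> q.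
     Liminf (sequentially \<times>\<^sub>F sequentially) (\<lambda>(i, j). ereal (gromov_product d w (x i) (y j))))"

text \<open>The sets of all \<open>q\<close> with \<open>boundary_product d w p q > R\<close> form a neighbourhood base at \<open>p\<close>;
  for a hyperbolic space the topology does not depend on \<open>w\<close>.\<close>

definition boundary_topology ::
    "'a set \<Rightarrow> ('a \<Rightarrow> 'a \<Rightarrow> real) \<Rightarrow> 'a \<Rightarrow> (nat \<Rightarrow> 'a) set topology" where
  "boundary_topology M d w = topology (\<lambda>U. U \<subseteq> gromov_boundary M d \<and>
     (\<forall>p\<in>U. \<exists>R::real. \<forall>q\<in>gromov_boundary M d. boundary_product d w p q > ereal R \<longrightarrow> q \<in> U))"

lemma openin_boundary_topology:
  "openin (boundary_topology M d w) U \<longleftrightarrow> U \<subseteq> gromov_boundary M d \<and>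
     (\<forall>p\<in>U. \<exists>R::real. \<forall>q\<in>gromov_boundary M d. boundary_product d w p q > ereal R \<longrightarrow> q \<in> U)"
proof -
  let ?P = "\<lambda>U. U \<subseteq> gromov_boundary M d \<and>
     (\<forall>p\<in>U. \<exists>R::real. \<forall>q\<in>gromov_boundary M d. boundary_product d w p q > ereal R \<longrightarrow> q \<in> U)"
  have "?P (S \<inter> T)" if S: "?P S" and T: "?P T" for S T
  proof (intro conjI ballI)
    show "S \<inter> T \<subseteq> gromov_boundary M d" using S by blast
    fix p assume p: "p \<in> S \<inter> T"
    obtain R1 R2 :: real where
      "\<forall>q\<in>gromov_boundary M d. boundary_product d w p q > ereal R1 \<longrightarrow> q \<in> S"
      "\<forall>q\<in>gromov_boundary M d. boundary_product d w p q > ereal R2 \<longrightarrow> q \<in> T"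
      using S T p by blast
    moreover have "ereal R1 \<le> ereal (max R1 R2)" "ereal R2 \<le> ereal (max R1 R2)" by auto
    ultimately have "\<forall>q\<in>gromov_boundary M d. boundary_product d w p q > ereal (max R1 R2) \<longrightarrow> q \<in> S \<inter> T"
      by (blast intro: le_less_trans)
    then show "\<exists>R::real. \<forall>q\<in>gromov_boundary M d. boundary_product d w p q > ereal R \<longrightarrow> q \<in> S \<inter> T"
      by blast
  qed
  moreover have "?P (\<Union>\<K>)" if "\<forall>K\<in>\<K>. ?P K" for \<K>
    using that by (smt (verit) Union_iff Union_least)
  ultimately have "istopology ?P"
    unfolding istopology_def by blast
  then show ?thesis
    by (simp add: boundary_topology_def topology_inverse')
qed


section \<open>Isometric actions\<close>

definition isometric_action ::
    "('g, 'm) monoid_scheme \<Rightarrow> 'a set \<Rightarrow> ('a \<Rightarrow> 'a \<Rightarrow> real) \<Rightarrow> ('g \<Rightarrow> 'a \<Rightarrow> 'a) \<Rightarrow> bool" where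
  "isometric_action G M d \<phi> \<longleftrightarrow> Metric_space M d \<and> group_action G M \<phi>
     \<and> (\<forall>g\<in>carrier G. \<forall>x\<in>M. \<forall>y\<in>M. d (\<phi> g x) (\<phi> g y) = d x y)"

definition properly_discontinuous_action ::
    "('g, 'm) monoid_scheme \<Rightarrow> 'a set \<Rightarrow> ('a \<Rightarrow> 'a \<Rightarrow> real) \<Rightarrow> ('g \<Rightarrow> 'a \<Rightarrow> 'a) \<Rightarrow> bool" where
  "properly_discontinuous_action G M d \<phi> \<longleftrightarrow>
     (\<forall>K. compactin (Metric_space.mtopology M d) K \<longrightarrow> finite {g \<in> carrier G. \<phi> g ` K \<inter> K \<noteq> {}})"

definition cocompact_action ::
    "('g, 'm) monoid_scheme \<Rightarrow> 'a set \<Rightarrow> ('a \<Rightarrow> 'a \<Rightarrow> real) \<Rightarrow> ('g \<Rightarrow> 'a \<Rightarrow> 'a) \<Rightarrow> bool" where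
  "cocompact_action G M d \<phi> \<longleftrightarrow>
     (\<exists>K. compactin (Metric_space.mtopology M d) K \<and> M = (\<Union>g\<in>carrier G. \<phi> g ` K))"

definition geometric_action ::
    "('g, 'm) monoid_scheme \<Rightarrow> 'a set \<Rightarrow> ('a \<Rightarrow> 'a \<Rightarrow> real) \<Rightarrow> ('g \<Rightarrow> 'a \<Rightarrow> 'a) \<Rightarrow> bool" where
  "geometric_action G M d \<phi> \<longleftrightarrow> isometric_action G M d \<phi>
     \<and> properly_discontinuous_action G M d \<phi> \<and> cocompact_action G M d \<phi>"


section \<open>The boundary of the free group and laminations\<close>

type_synonym bdry = "(nat \<Rightarrow> word) set"

definition free_boundary :: "nat \<Rightarrow> bdry set" where
  "free_boundary r = gromov_boundary (carrier (free_group r)) (word_dist r)"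

definition free_boundary_topology :: "nat \<Rightarrow> bdry topology" where
  "free_boundary_topology r =
     boundary_topology (carrier (free_group r)) (word_dist r) \<one>\<^bsub>free_group r\<^esub>"

definition boundary_act :: "nat \<Rightarrow> word \<Rightarrow> bdry \<Rightarrow> bdry" where
  "boundary_act r g p = (\<lambda>x n. g \<otimes>\<^bsub>free_group r\<^esub> x n) ` p"

definition free_boundary2 :: "nat \<Rightarrow> (bdry \<times> bdry) set" where
  "free_boundary2 r = {(p, q). p \<in> free_boundary r \<and> q \<in> free_boundary r \<and> p \<noteq> q}"

definition algebraic_lamination :: "nat \<Rightarrow> (bdry \<times> bdry) set \<Rightarrow> bool" where
  "algebraic_lamination r L \<longleftrightarrow>
     closedin (subtopology (prod_topology (free_boundary_topology r) (free_boundary_topology r))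
       (free_boundary2 r)) L
     \<and> (\<forall>g\<in>carrier (free_group r). \<forall>(p, q)\<in>L. (boundary_act r g p, boundary_act r g q) \<in> L)
     \<and> (\<forall>(p, q)\<in>L. (q, p) \<in> L)"

text \<open>The identification of the boundary of the free group with the boundary of a hyperbolic
  space on which it acts: the class of \<open>g\<^sub>n\<close> corresponds to the class of \<open>g\<^sub>n x\<close>,
  for any point \<open>x\<close>.\<close>

definition boundary_ident ::
    "'a set \<Rightarrow> ('a \<Rightarrow> 'a \<Rightarrow> real) \<Rightarrow> (word \<Rightarrow> 'a \<Rightarrow> 'a) \<Rightarrow> bdry \<Rightarrow> (nat \<Rightarrow> 'a) set" where
  "boundary_ident M d \<phi> p = gromov_rel M d `` {(\<lambda>n. \<phi> (g n) x) | g x. g \<in> p \<and> x \<in> M}"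

text \<open>\<open>neg_power a t\<close> is \<open>a\<close> to the power \<open>- t\<close>, with value \<open>0\<close> at \<open>t = \<infinity>\<close>.\<close>

definition neg_power :: "real \<Rightarrow> ereal \<Rightarrow> real" where
  "neg_power a t = (if t = \<infinity> then 0 else a powr (- real_of_ereal t))"

definition visual_metric ::
    "nat \<Rightarrow> 'x set \<Rightarrow> ('x \<Rightarrow> 'x \<Rightarrow> real) \<Rightarrow> (word \<Rightarrow> 'x \<Rightarrow> 'x) \<Rightarrow> 'x \<Rightarrow> real
      \<Rightarrow> (bdry \<Rightarrow> bdry \<Rightarrow> real) \<Rightarrow> bool" where
  "visual_metric r X dX \<phi> x0 a d \<longleftrightarrow> Metric_space (free_boundary r) d \<and>
     (\<exists>C\<ge>1. \<forall>p\<in>free_boundary r. \<forall>q\<in>free_boundary r.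
        (let t = boundary_product dX x0 (boundary_ident X dX \<phi> p) (boundary_ident X dX \<phi> q)
         in 1 / C * neg_power a t \<le> d p q \<and> d p q \<le> C * neg_power a t))"


section \<open>Outer space\<close>

text \<open>A real tree is a geodesic metric space that is 0-hyperbolic.\<close>

definition real_tree :: "'t set \<Rightarrow> ('t \<Rightarrow> 't \<Rightarrow> real) \<Rightarrow> bool" where
  "real_tree T d \<longleftrightarrow> Metric_space T d \<and> geodesic_space T d \<and> delta_hyperbolic T d 0"

text \<open>The last four conditions say that the action is minimal (a subtree is a subset that is a real
  tree in the restricted metric), nontrivial (no global fixed point), free, and discrete (every orbit
  is a discrete set).\<close>

definition cv :: "nat \<Rightarrow> 't set \<Rightarrow> ('t \<Rightarrow> 't \<Rightarrow> real) \<Rightarrow> (word \<Rightarrow> 't \<Rightarrow> 't) \<Rightarrow> bool" where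
  "cv r T d \<phi> \<longleftrightarrow> real_tree T d \<and> T \<noteq> {} \<and> isometric_action (free_group r) T d \<phi>
     \<and> (\<forall>S\<subseteq>T. S \<noteq> {} \<and> real_tree S d \<and> (\<forall>g\<in>carrier (free_group r). \<phi> g ` S \<subseteq> S) \<longrightarrow> S = T)
     \<and> \<not> (\<exists>x\<in>T. \<forall>g\<in>carrier (free_group r). \<phi> g x = x)
     \<and> (\<forall>g\<in>carrier (free_group r). \<forall>x\<in>T. \<phi> g x = x \<longrightarrow> g = \<one>\<^bsub>free_group r\<^esub>)
     \<and> (\<forall>x\<in>T. \<exists>\<epsilon>>0. \<forall>g\<in>carrier (free_group r). d x (\<phi> g x) < \<epsilon> \<longrightarrow> \<phi> g x = x)"

definition between :: "('t \<Rightarrow> 't \<Rightarrow> real) \<Rightarrow> 't \<Rightarrow> 't \<Rightarrow> 't \<Rightarrow> bool" where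
  "between d x y z \<longleftrightarrow> d x z = d x y + d y z"

text \<open>The points of degree at least 3, i.e. those from which three nondegenerate segments issue
  that pairwise meet in their origin only. They are the preimages in \<open>T\<close> of the vertices of the
  quotient graph.\<close>

definition branch_points :: "'t set \<Rightarrow> ('t \<Rightarrow> 't \<Rightarrow> real) \<Rightarrow> 't set" where
  "branch_points T d = {x\<in>T. \<exists>y1\<in>T - {x}. \<exists>y2\<in>T - {x}. \<exists>y3\<in>T - {x}.
     between d y1 x y2 \<and> between d y2 x y3 \<and> between d y1 x y3}"

definition tree_edges :: "'t set \<Rightarrow> ('t \<Rightarrow> 't \<Rightarrow> real) \<Rightarrow> ('t \<times> 't) set" where
  "tree_edges T d = {(u, v). u \<in> branch_points T d \<and> v \<in> branch_points T d \<and> u \<noteq> v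
     \<and> (\<forall>w\<in>branch_points T d. between d u w v \<longrightarrow> w = u \<or> w = v)}"

text \<open>Every geometric edge of the graphs below is represented by its two oriented edges.\<close>

definition tree_graph :: "'t set \<Rightarrow> ('t \<Rightarrow> 't \<Rightarrow> real) \<Rightarrow> ('t, 't \<times> 't) pre_digraph" where
  "tree_graph T d = \<lparr>verts = branch_points T d, arcs = tree_edges T d, tail = fst, head = snd\<rparr>"

definition edge_orbit :: "nat \<Rightarrow> (word \<Rightarrow> 't \<Rightarrow> 't) \<Rightarrow> 't \<times> 't \<Rightarrow> ('t \<times> 't) set" where
  "edge_orbit r \<phi> = orbit (free_group r) (\<lambda>g. map_prod (\<phi> g) (\<phi> g))"

definition quotient_graph ::
    "nat \<Rightarrow> 't set \<Rightarrow> ('t \<Rightarrow> 't \<Rightarrow> real) \<Rightarrow> (word \<Rightarrow> 't \<Rightarrow> 't) \<Rightarrow> ('t set, ('t \<times> 't) set) pre_digraph" where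
  "quotient_graph r T d \<phi> = \<lparr>verts = orbit (free_group r) \<phi> ` branch_points T d,
     arcs = edge_orbit r \<phi> ` tree_edges T d, tail = (\<lambda>e. fst ` e), head = (\<lambda>e. snd ` e)\<rparr>"

definition edge_length :: "('t \<Rightarrow> 't \<Rightarrow> real) \<Rightarrow> ('t \<times> 't) set \<Rightarrow> real" where
  "edge_length d e = the_elem ((\<lambda>(u, v). d u v) ` e)"

definition path_length :: "('t \<Rightarrow> 't \<Rightarrow> real) \<Rightarrow> ('t \<times> 't) set list \<Rightarrow> real" where
  "path_length d \<gamma> = (\<Sum>e\<leftarrow>\<gamma>. edge_length d e)"

definition geodesic_from_to ::
    "'t set \<Rightarrow> ('t \<Rightarrow> 't \<Rightarrow> real) \<Rightarrow> (word \<Rightarrow> 't \<Rightarrow> 't) \<Rightarrow> bdry \<Rightarrow> bdry \<Rightarrow> (real \<Rightarrow> 't) \<Rightarrow> bool" where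
  "geodesic_from_to T d \<phi> p q c \<longleftrightarrow> range c \<subseteq> T \<and> (\<forall>s t. d (c s) (c t) = \<bar>s - t\<bar>)
     \<and> (\<lambda>n. c (- real n)) \<in> boundary_ident T d \<phi> p \<and> (\<lambda>n. c (real n)) \<in> boundary_ident T d \<phi> q"

text \<open>An edge-path in \<open>T\<close> is a subpath of the geodesic \<open>c\<close> if \<open>c\<close> runs through its vertices in
  the order in which the path visits them.\<close>

definition laminary_language ::
    "nat \<Rightarrow> 't set \<Rightarrow> ('t \<Rightarrow> 't \<Rightarrow> real) \<Rightarrow> (word \<Rightarrow> 't \<Rightarrow> 't) \<Rightarrow> (bdry \<times> bdry) set
      \<Rightarrow> ('t \<times> 't) set list set" where
  "laminary_language r T d \<phi> L = {\<gamma>. \<gamma> \<noteq> []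
     \<and> (\<exists>x y. pre_digraph.awalk (quotient_graph r T d \<phi>) x \<gamma> y)
     \<and> (\<exists>\<eta> u v c ts. pre_digraph.awalk (tree_graph T d) u \<eta> v \<and> map (edge_orbit r \<phi>) \<eta> = \<gamma>
          \<and> (\<exists>(p, q)\<in>L. geodesic_from_to T d \<phi> p q c)
          \<and> sorted_wrt (<) ts \<and> pre_digraph.awalk_verts (tree_graph T d) u \<eta> = map c ts)}"

definition lamination_growth ::
    "nat \<Rightarrow> 't set \<Rightarrow> ('t \<Rightarrow> 't \<Rightarrow> real) \<Rightarrow> (word \<Rightarrow> 't \<Rightarrow> 't) \<Rightarrow> (bdry \<times> bdry) set \<Rightarrow> nat \<Rightarrow> nat" where
  "lamination_growth r T d \<phi> L n =
     (if n = 0 then 0 else card {\<gamma> \<in> laminary_language r T d \<phi> L. path_length d \<gamma> \<le> real n})"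

definition subexponential :: "(nat \<Rightarrow> nat) \<Rightarrow> bool" where
  "subexponential f \<longleftrightarrow> mono f \<and> (\<forall>b>1. (\<lambda>n. real (f n) / b ^ n) \<longlonglongrightarrow> (0::real))"

text \<open>The type argument is the type of the points of the tree. A formula cannot quantify over
  types; a theorem that assumes \<open>subexponentially_growing TYPE('t) r L\<close> for a type variable
  \<open>'t\<close> covers trees on any type whatsoever.\<close>

definition subexponentially_growing :: "'t itself \<Rightarrow> nat \<Rightarrow> (bdry \<times> bdry) set \<Rightarrow> bool" where
  "subexponentially_growing _ r L \<longleftrightarrow> (\<exists>(T :: 't set) d \<phi>. cv r T d \<phi>
     \<and> subexponential (lamination_growth r T d \<phi> L))"


section \<open>Hausdorff and packing dimension\<close>

definition ediam :: "('a \<Rightarrow> 'a \<Rightarrow> real) \<Rightarrow> 'a set \<Rightarrow> ennreal" where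
  "ediam d U = (SUP (x, y)\<in>U \<times> U. ennreal (d x y))"

text \<open>The \<open>s\<close>-th power of the diameter, with \<open>0\<^sup>0 = 1\<close> (note that \<open>0 powr 0 = 0\<close>) except that the
  empty set always contributes \<open>0\<close>.\<close>

definition diam_power :: "('a \<Rightarrow> 'a \<Rightarrow> real) \<Rightarrow> real \<Rightarrow> 'a set \<Rightarrow> ennreal" where
  "diam_power d s U = (if U = {} then 0 else if s = 0 then 1
     else if ediam d U = \<infinity> then \<infinity> else ennreal (enn2real (ediam d U) powr s))"

definition hausdorff_premeasure ::
    "'a set \<Rightarrow> ('a \<Rightarrow> 'a \<Rightarrow> real) \<Rightarrow> real \<Rightarrow> real \<Rightarrow> 'a set \<Rightarrow> ennreal" where
  "hausdorff_premeasure M d s \<delta> S =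
     (INF \<U>\<in>{\<U>. countable \<U> \<and> S \<subseteq> \<Union>\<U> \<and> (\<forall>U\<in>\<U>. U \<subseteq> M \<and> ediam d U \<le> ennreal \<delta>)}.
        \<Sum>\<^sub>\<infinity>U\<in>\<U>. diam_power d s U)"

definition hausdorff_measure ::
    "'a set \<Rightarrow> ('a \<Rightarrow> 'a \<Rightarrow> real) \<Rightarrow> real \<Rightarrow> 'a set \<Rightarrow> ennreal" where
  "hausdorff_measure M d s S = (SUP \<delta>\<in>{0<..}. hausdorff_premeasure M d s \<delta> S)"

definition hausdorff_dim :: "'a set \<Rightarrow> ('a \<Rightarrow> 'a \<Rightarrow> real) \<Rightarrow> 'a set \<Rightarrow> ennreal" where
  "hausdorff_dim M d S = Inf (ennreal ` {s. 0 \<le> s \<and> hausdorff_measure M d s S = 0})"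

definition packings ::
    "'a set \<Rightarrow> ('a \<Rightarrow> 'a \<Rightarrow> real) \<Rightarrow> real \<Rightarrow> 'a set \<Rightarrow> 'a set set set" where
  "packings M d \<delta> S = {\<B>. countable \<B> \<and> disjoint \<B>
     \<and> (\<forall>B\<in>\<B>. ediam d B \<le> ennreal \<delta> \<and> (\<exists>x\<in>S. \<exists>\<rho>>0. B = Metric_space.mcball M d x \<rho>))}"

definition packing_premeasure ::
    "'a set \<Rightarrow> ('a \<Rightarrow> 'a \<Rightarrow> real) \<Rightarrow> real \<Rightarrow> 'a set \<Rightarrow> ennreal" where
  "packing_premeasure M d s S =
     Lim (at_right 0) (\<lambda>\<delta>. SUP \<B>\<in>packings M d \<delta> S. \<Sum>\<^sub>\<infinity>B\<in>\<B>. diam_power d s B)"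

definition packing_measure ::
    "'a set \<Rightarrow> ('a \<Rightarrow> 'a \<Rightarrow> real) \<Rightarrow> real \<Rightarrow> 'a set \<Rightarrow> ennreal" where
  "packing_measure M d s S =
     (INF \<S>\<in>{\<S>. countable \<S> \<and> S \<subseteq> \<Union>\<S> \<and> \<Union>\<S> \<subseteq> M}. \<Sum>\<^sub>\<infinity>S'\<in>\<S>. packing_premeasure M d s S')"

definition packing_dim :: "'a set \<Rightarrow> ('a \<Rightarrow> 'a \<Rightarrow> real) \<Rightarrow> 'a set \<Rightarrow> ennreal" where
  "packing_dim M d S = Inf (ennreal ` {s. 0 \<le> s \<and> packing_measure M d s S = 0})"

definition max_dist :: "('a \<Rightarrow> 'a \<Rightarrow> real) \<Rightarrow> 'a \<times> 'a \<Rightarrow> 'a \<times> 'a \<Rightarrow> real" where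
  "max_dist d = (\<lambda>(p, q) (p', q'). max (d p p') (d q q'))"

end

theory Submission
  imports Defs
begin

text \<open>Let \<open>T\<close> be a tree in outer space for which the lamination grows subexponentially. By minimality
  \<open>T\<close> is the union of the translates of finitely many segments, so the orbit map from the free
  group to \<open>T\<close> is a quasi-isometry, and there are finitely many orbits of branch points and edges.
  Consequently every leaf is realised by a geodesic line in \<open>T\<close>, which passes through branch points
  at bounded gaps. There are countably many branch points \<open>b\<close>, so by countable stability of both
  dimensions it is enough to treat the leaves through a fixed \<open>b\<close>. Such a leaf determines two
  edge-paths of length about \<open>n\<close> in the quotient graph that start at \<open>b\<close>. As the action is free, two
  leaves with the same edge-paths agree in \<open>T\<close> up to distance about \<open>n\<close> from \<open>b\<close> in both
  directions. An inequality between Gromov products in \<open>T\<close> and in \<open>X\<close> turns this into closeness of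
  order \<open>\<rho>\<^sup>n\<close>, with \<open>\<rho> < 1\<close>, of the end points in the visual metric. So these leaves are covered by
  subexponentially many sets of exponentially small diameter, and both dimensions vanish.\<close>


section \<open>Gromov products\<close>

text \<open>Comparing Gromov products under a quasi-isometry usually rests on the stability of
  quasi-geodesics. Only lower bounds are needed here, and they come from a more elementary source:
  if consecutive points of a chain are a bounded distance apart and recede from the base point at
  linear speed, then the product of its ends is controlled by the start of the chain
  (\<open>gromov_product_chain\<close>). This compares \<open>T\<close> with \<open>X\<close>, and
  \<open>T\<close> with the word metric in both directions. The linear speed is supplied by
  \<open>norm_le_displacement\<close>, stated for an arbitrary subadditive \<open>N\<close> because
  it is needed twice: with word length for the action on \<open>T\<close>, and with displacement in
  \<open>T\<close> for the action on \<open>X\<close>. Leaves are sorted by a branch point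
  \<open>b\<close> for two reasons. A word in the quotient graph determines a path in
  \<open>T\<close> only after its first vertex is fixed. Moreover, the ratio \<rho> is the same for
  all \<open>b\<close>, but the constant in front of \<open>\<rho> ^ n\<close> grows exponentially
  with the distance from \<open>b\<close> to the base point, so that no uniform cover of all leaves
  is obtained.\<close>

context Metric_space
begin

lemma gromov_product_commute:
  "x \<in> M \<Longrightarrow> y \<in> M \<Longrightarrow> gromov_product d w x y = gromov_product d w y x"
  by (simp add: gromov_product_def commute)

lemma gromov_product_self: "w \<in> M \<Longrightarrow> x \<in> M \<Longrightarrow> gromov_product d w x x = d w x"
  by (simp add: gromov_product_def)

lemma gromov_product_le1:
  assumes "w \<in> M" "x \<in> M" "y \<in> M"
  shows "gromov_product d w x y \<le> d w x"
  using triangle[of w x y] assms by (simp add: gromov_product_def commute)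

lemma gromov_product_le2:
  assumes "w \<in> M" "x \<in> M" "y \<in> M"
  shows "gromov_product d w x y \<le> d w y"
  using triangle[of w y x] assms by (simp add: gromov_product_def commute)

lemma gromov_product_nonneg:
  assumes "w \<in> M" "x \<in> M" "y \<in> M"
  shows "gromov_product d w x y \<ge> 0"
  using triangle[of x w y] assms by (simp add: gromov_product_def commute)

lemma gromov_product_ge_dist:
  assumes "w \<in> M" "x \<in> M" "y \<in> M"
  shows "gromov_product d w x y \<ge> d w x - d x y"
  using triangle[of w y x] assms by (simp add: gromov_product_def commute field_simps)

lemma gromov_product_base:
  assumes "w \<in> M" "w' \<in> M" "x \<in> M" "y \<in> M"
  shows "gromov_product d w x y \<le> gromov_product d w' x y + d w w'"
  using triangle[of w w' x] triangle[of w w' y] assms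
  by (simp add: gromov_product_def commute field_simps)

lemma gromov_product_point1:
  assumes "w \<in> M" "x \<in> M" "x' \<in> M" "y \<in> M"
  shows "gromov_product d w x y \<le> gromov_product d w x' y + d x x'"
  using triangle[of w x' x] triangle[of x' x y] assms
  by (simp add: gromov_product_def commute field_simps)

text \<open>Changing the base point changes a product by at most the distance of the two base
  points, so one base point decides divergence.\<close>

lemma products_diverge_iff:
  assumes w: "w \<in> M" and x: "range x \<subseteq> M" and y: "range y \<subseteq> M"
  shows "products_diverge M d x y
    \<longleftrightarrow> (\<forall>R. \<exists>N. \<forall>i\<ge>N. \<forall>j\<ge>N. R \<le> gromov_product d w (x i) (y j))"
proof -
  have *: "filterlim (\<lambda>(i, j). gromov_product d w' (x i) (y j)) at_top
        (sequentially \<times>\<^sub>F sequentially) \<longleftrightarrow>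
      (\<forall>R. \<exists>N. \<forall>i\<ge>N. \<forall>j\<ge>N. R \<le> gromov_product d w' (x i) (y j))" for w'
    unfolding filterlim_at_top eventually_prod_sequentially split_conv by metis
  have "(\<forall>R. \<exists>N. \<forall>i\<ge>N. \<forall>j\<ge>N. R \<le> gromov_product d w' (x i) (y j))"
    if *: "\<forall>R. \<exists>N. \<forall>i\<ge>N. \<forall>j\<ge>N. R \<le> gromov_product d w (x i) (y j)" and w': "w' \<in> M" for w'
  proof
    fix R
    obtain N where N: "\<forall>i\<ge>N. \<forall>j\<ge>N. R + d w w' \<le> gromov_product d w (x i) (y j)"
      using * by blast
    have "R \<le> gromov_product d w' (x i) (y j)" if "i \<ge> N" "j \<ge> N" for i j
    proof -
      have "x i \<in> M" "y j \<in> M" using x y by auto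
      then show ?thesis
        using N that gromov_product_base[OF w w', of "x i" "y j"] by force
    qed
    then show "\<exists>N. \<forall>i\<ge>N. \<forall>j\<ge>N. R \<le> gromov_product d w' (x i) (y j)" by blast
  qed
  then show ?thesis
    unfolding products_diverge_def * using w by blast
qed

lemma products_diverge_sym:
  assumes "range x \<subseteq> M" "range y \<subseteq> M" "products_diverge M d x y"
  shows "products_diverge M d y x"
proof (cases "M = {}")
  case False
  then obtain w where w: "w \<in> M" by blast
  have "gromov_product d w (x i) (y j) = gromov_product d w (y j) (x i)" for i j
    using assms w by (intro gromov_product_commute) auto
  then show ?thesis
    using assms unfolding products_diverge_iff[OF w assms(1,2)] products_diverge_iff[OF w assms(2,1)]
    by metis
qed (use assms in auto)

text \<open>Lets an orbit sequence of any point be replaced by the one of the base point.\<close>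

lemma bounded_perturbation_diverge:
  assumes x: "range x \<subseteq> M" and x': "range x' \<subseteq> M" and y: "range y \<subseteq> M"
    and b: "\<And>n. d (x n) (x' n) \<le> B" and div: "products_diverge M d x y"
  shows "products_diverge M d x' y"
proof (cases "M = {}")
  case False
  then obtain w where w: "w \<in> M" by blast
  show ?thesis
    unfolding products_diverge_iff[OF w x' y]
  proof
    fix R
    obtain N where N: "\<forall>i\<ge>N. \<forall>j\<ge>N. R + B \<le> gromov_product d w (x i) (y j)"
      using div unfolding products_diverge_iff[OF w x y] by blast
    have "R \<le> gromov_product d w (x' i) (y j)" if "i \<ge> N" "j \<ge> N" for i j
    proof -
      have "x i \<in> M" "x' i \<in> M" "y j \<in> M" using x x' y by auto
      then show ?thesis
        using N that gromov_product_point1[OF w, of "x i" "x' i" "y j"] b[of i] by force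
    qed
    then show "\<exists>N. \<forall>i\<ge>N. \<forall>j\<ge>N. R \<le> gromov_product d w (x' i) (y j)" by blast
  qed
qed (use assms in auto)

end

locale gromov_space = Metric_space M d for M :: "'a set" and d +
  fixes \<delta> :: real
  assumes delta_hyp: "delta_hyperbolic M d \<delta>"
begin

lemma gromov_product_min:
  assumes "w \<in> M" "x \<in> M" "y \<in> M" "z \<in> M"
  shows "min (gromov_product d w x y) (gromov_product d w y z) - \<delta> \<le> gromov_product d w x z"
  using delta_hyp assms by (auto simp: delta_hyperbolic_def)

lemma delta_nonneg: assumes "M \<noteq> {}" shows "\<delta> \<ge> 0"
proof -
  obtain w where "w \<in> M" using assms by blast
  then show ?thesis using gromov_product_min[of w w w w] by simp
qed

lemma products_diverge_trans:
  assumes x: "range x \<subseteq> M" and y: "range y \<subseteq> M" and z: "range z \<subseteq> M"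
    and xy: "products_diverge M d x y" and yz: "products_diverge M d y z"
  shows "products_diverge M d x z"
proof -
  obtain w where w: "w \<in> M" using x by blast
  show ?thesis
    unfolding products_diverge_iff[OF w x z]
  proof
    fix R
    obtain N1 where N1: "\<forall>i\<ge>N1. \<forall>j\<ge>N1. R + \<delta> \<le> gromov_product d w (x i) (y j)"
      using xy unfolding products_diverge_iff[OF w x y] by blast
    obtain N2 where N2: "\<forall>i\<ge>N2. \<forall>j\<ge>N2. R + \<delta> \<le> gromov_product d w (y i) (z j)"
      using yz unfolding products_diverge_iff[OF w y z] by blast
    have "R \<le> gromov_product d w (x i) (z j)" if "i \<ge> max N1 N2" "j \<ge> max N1 N2" for i j
    proof -
      have "x i \<in> M" "y (max N1 N2) \<in> M" "z j \<in> M" using x y z by auto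
      moreover have "R + \<delta> \<le> gromov_product d w (x i) (y (max N1 N2))"
        "R + \<delta> \<le> gromov_product d w (y (max N1 N2)) (z j)"
        using N1 N2 that by auto
      ultimately show ?thesis
        using gromov_product_min[OF w, of "x i" "y (max N1 N2)" "z j"] by linarith
    qed
    then show "\<exists>N. \<forall>i\<ge>N. \<forall>j\<ge>N. R \<le> gromov_product d w (x i) (z j)" by blast
  qed
qed

lemma equiv_gromov_rel: "equiv {x. converges_to_infinity M d x} (gromov_rel M d)"
proof (rule equivI)
  show "gromov_rel M d \<subseteq> {x. converges_to_infinity M d x} \<times> {x. converges_to_infinity M d x}"
    by (auto simp: gromov_rel_def)
  show "refl_on {x. converges_to_infinity M d x} (gromov_rel M d)"
    by (auto simp: refl_on_def gromov_rel_def converges_to_infinity_def)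
  show "sym (gromov_rel M d)"
    by (auto simp: sym_def gromov_rel_def converges_to_infinity_def intro!: products_diverge_sym)
  show "trans (gromov_rel M d)"
    by (auto simp: trans_def gromov_rel_def converges_to_infinity_def intro: products_diverge_trans)
qed

text \<open>Combining the points of the chain pairwise loses a multiple of \<open>\<delta>\<close> that grows with the
  length; since the distances to \<open>w\<close> grow linearly, strides of \<open>\<delta> / c\<close> points are long
  enough to make up for the loss.\<close>

lemma gromov_product_chain:
  assumes w: "w \<in> M" and c: "c > 0"
  shows "\<exists>C'. \<forall>N y m. (\<forall>i\<le>N. y i \<in> M) \<longrightarrow> (\<forall>i<N. d (y i) (y (Suc i)) \<le> B)
    \<longrightarrow> (\<forall>i\<le>N. c * (m + real i) - C \<le> d w (y i)) \<longrightarrow> c * m - C' \<le> gromov_product d w (y 0) (y N)"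
proof -
  define K where "K = Suc (nat \<lceil>\<delta> / c\<rceil>)"
  have \<delta>: "\<delta> \<ge> 0" using w by (intro delta_nonneg) blast
  have K: "c * real K \<ge> \<delta>"
  proof -
    have "\<delta> / c \<le> real K" unfolding K_def by linarith
    then show ?thesis using c by (simp add: field_simps)
  qed
  \<comment> \<open>For \<open>N = 0\<close> there is no step, so nothing forces \<open>B\<close> to
    be nonnegative.\<close>
  define B' where "B' = max B 0"
  have "c * m - (C + B' + (K + 2) * \<delta>) \<le> gromov_product d w (y 0) (y N)"
    if y: "\<forall>i\<le>N. y i \<in> M" and step: "\<forall>i<N. d (y i) (y (Suc i)) \<le> B"
      and far: "\<forall>i\<le>N. c * (m + real i) - C \<le> d w (y i)" for N y m
  proof -
    have short: "c * (m + real i) - C - B' - real n * \<delta> \<le> gromov_product d w (y i) (y (i + n))"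
      if "i + n \<le> N" for i n
      using that
    proof (induction n arbitrary: i)
      case 0
      then show ?case using far y w by (auto simp: gromov_product_self B'_def intro: order_trans)
    next
      case (Suc n)
      have M: "y i \<in> M" "y (Suc i) \<in> M" "y (i + Suc n) \<in> M" using y Suc.prems by auto
      have "c * (m + real (Suc i)) - C - B' - real n * \<delta>
          \<le> gromov_product d w (y (Suc i)) (y (i + Suc n))"
        using Suc.IH[of "Suc i"] Suc.prems by simp
      moreover have "c * (m + real i) - C - B' \<le> gromov_product d w (y i) (y (Suc i))"
      proof -
        have "d (y i) (y (Suc i)) \<le> B'" using step Suc.prems by (simp add: B'_def le_max_iff_disj)
        moreover have "c * (m + real i) - C \<le> d w (y i)" using far Suc.prems by simp
        ultimately show ?thesis using gromov_product_ge_dist[OF w M(1,2)] by linarith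
      qed
      moreover have "c * real i \<le> c * real (Suc i)" using c by simp
      moreover have "0 \<le> real n * \<delta>" using \<delta> by simp
      moreover note gromov_product_min[OF w M(1,2,3)]
      ultimately show ?case by (simp add: algebra_simps min_def split: if_splits)
    qed
    \<comment> \<open>Induction in strides of \<open>K\<close> points: the remaining chain starts at
      \<open>i + K\<close>, where its bound is better by \<open>c * K\<close>, and this pays for the
      \<delta> lost in joining it to the first stride.\<close>
    have long: "c * (m + real i) - C - B' - (K + 1) * \<delta> \<le> gromov_product d w (y i) (y (i + n))"
      if "i + n \<le> N" for i n
      using that
    proof (induction n arbitrary: i rule: less_induct)
      case (less n)
      show ?case
      proof (cases "n \<le> K")
        case True
        then have "real n * \<delta> \<le> (K + 1) * \<delta>" using \<delta> by (intro mult_right_mono) auto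
        then show ?thesis using short[of i n] less.prems by simp
      next
        case False
        have M: "y i \<in> M" "y (i + K) \<in> M" "y (i + n) \<in> M" using y less.prems False by auto
        have "c * (m + real (i + K)) - C - B' - (K + 1) * \<delta>
            \<le> gromov_product d w (y (i + K)) (y (i + K + (n - K)))"
          using False less.prems by (intro less.IH) (auto simp: K_def)
        moreover have "i + K + (n - K) = i + n" using False by simp
        moreover have "c * (m + real i) - C - B' - real K * \<delta> \<le> gromov_product d w (y i) (y (i + K))"
          using short[of i K] False less.prems by simp
        ultimately show ?thesis
          using gromov_product_min[OF w M] K by (simp add: algebra_simps min_def split: if_splits)
      qed
    qed
    show ?thesis using long[of 0 N] \<delta> by (simp add: algebra_simps)
  qed
  then show ?thesis by blast
qed

end


section \<open>Real trees\<close>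

locale real_tree_space =
  fixes T :: "'t set" and d :: "'t \<Rightarrow> 't \<Rightarrow> real"
  assumes rt: "real_tree T d"

sublocale real_tree_space \<subseteq> gromov_space T d 0
  using rt by (simp add: real_tree_def gromov_space_def gromov_space_axioms_def)

context real_tree_space
begin

text \<open>0-hyperbolicity cleared of its base point. The betweenness lemmas below are largely
  linear arithmetic with it.\<close>

lemma four_point:
  assumes "w \<in> T" "x \<in> T" "y \<in> T" "z \<in> T"
  shows "d w y + d x z \<le> max (d w x + d y z) (d w z + d x y)"
  using gromov_product_min[of w x y z] assms
  by (auto simp: gromov_product_def min_def max_def split: if_splits)

lemma between_sym: "x \<in> T \<Longrightarrow> y \<in> T \<Longrightarrow> z \<in> T \<Longrightarrow> between d x y z \<longleftrightarrow> between d z y x"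
  by (auto simp: between_def commute)

lemma point_on_segment:
  assumes "x \<in> T" "y \<in> T" "0 \<le> t" "t \<le> d x y"
  obtains z where "z \<in> T" "between d x z y" "d x z = t"
proof -
  have "geodesic_space T d" using rt by (simp add: real_tree_def)
  then obtain c where c: "c ` {0..d x y} \<subseteq> T" "c 0 = x" "c (d x y) = y"
    "\<forall>s\<in>{0..d x y}. \<forall>t\<in>{0..d x y}. d (c s) (c t) = \<bar>s - t\<bar>"
    using assms unfolding geodesic_space_def by blast
  have "0 \<in> {0..d x y}" "d x y \<in> {0..d x y}" "t \<in> {0..d x y}" using assms by auto
  then have "d x (c t) = t" "d (c t) y = d x y - t" "c t \<in> T"
    using c assms by (metis abs_minus abs_of_nonneg diff_0 , metis abs_minus_commute abs_of_nonneg diff_ge_0_iff_ge, blast)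
  then show thesis using that[of "c t"] by (simp add: between_def)
qed

lemma between_unique:
  assumes "x \<in> T" "y \<in> T" "y' \<in> T" "z \<in> T" "between d x y z" "between d x y' z" "d x y = d x y'"
  shows "y = y'"
proof -
  have "d y y' \<le> 0"
    using four_point[of x y z y'] assms by (auto simp: between_def commute)
  then show ?thesis using assms nonneg[of y y'] zero[of y y'] by simp
qed

lemma between_dist:
  assumes "x \<in> T" "y \<in> T" "y' \<in> T" "z \<in> T" "between d x y z" "between d x y' z"
  shows "d y y' = \<bar>d x y - d x y'\<bar>"
  using four_point[of x y z y'] triangle[of x y y'] triangle[of x y' y] assms
  by (auto simp: between_def commute abs_if)

text \<open>In the tripod spanned by \<open>w\<close>, \<open>x\<close>, \<open>z\<close>, the two
  sides that issue from \<open>w\<close> cover the third side.\<close>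

lemma between_split:
  assumes "x \<in> T" "y \<in> T" "z \<in> T" "w \<in> T" "between d x y z"
  shows "between d w y x \<or> between d w y z"
  using four_point[of x y z w] triangle[of x y w] triangle[of w y z] assms
  by (auto simp: between_def commute max_def split: if_splits)

text \<open>The centre of the tripod is the point on the segment from \<open>x\<close> to
  \<open>y\<close> whose distance from \<open>x\<close> is the Gromov product of \<open>y\<close>
  and \<open>z\<close> at \<open>x\<close>.\<close>

lemma median:
  assumes "x \<in> T" "y \<in> T" "z \<in> T"
  obtains m where "m \<in> T" "between d x m y" "between d y m z" "between d x m z"
proof -
  have "0 \<le> gromov_product d x y z" "gromov_product d x y z \<le> d x y"
    using assms by (auto intro: gromov_product_nonneg gromov_product_le1)
  then obtain m where m: "m \<in> T" "between d x m y" "d x m = gromov_product d x y z"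
    using point_on_segment[of x y] assms by blast
  have "between d x m z"
    using four_point[of x m y z] triangle[of x m z] assms m
    by (auto simp: between_def commute gromov_product_def field_simps max_def split: if_splits)
  moreover from this have "between d y m z"
    using assms m by (auto simp: between_def commute gromov_product_def field_simps)
  ultimately show thesis using that m by blast
qed

lemma between_trans:
  assumes "x \<in> T" "y \<in> T" "z \<in> T" "w \<in> T" "between d x y z" "between d x z w"
  shows "between d x y w" "between d y z w"
  using assms triangle[of y z w] triangle[of x y w] by (auto simp: between_def)

lemma gromov_product_between:
  assumes "w \<in> T" "x \<in> T" "y \<in> T" "between d w x y"
  shows "gromov_product d w x y = d w x"
  using assms by (auto simp: between_def gromov_product_def)

lemma median_branch_point:
  assumes "m \<in> T" "x \<in> T" "y \<in> T" "z \<in> T" "between d x m y" "between d y m z" "between d x m z"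
    "m \<noteq> x" "m \<noteq> y" "m \<noteq> z"
  shows "m \<in> branch_points T d"
  using assms unfolding branch_points_def by blast

end

text \<open>The geodesics from the median of \<open>v\<close>, \<open>e g\<close> and \<open>e h\<close> to \<open>e g\<close> and to \<open>e h\<close> recede from \<open>v\<close>
  at unit speed, so the points of \<open>Y\<close> that correspond to them form chains that recede from \<open>y0\<close>
  at linear speed.\<close>

lemma (in real_tree_space) gromov_product_lower_bound:
  fixes e :: "'g \<Rightarrow> 't" and f :: "'g \<Rightarrow> 'y"
  assumes Y: "gromov_space Y dY \<delta>"
    and v: "v \<in> T" and y0: "y0 \<in> Y" and e: "e ` G \<subseteq> T" and f: "f ` G \<subseteq> Y"
    and dense: "\<And>x. x \<in> T \<Longrightarrow> \<exists>g\<in>G. d x (e g) \<le> D"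
    and lip: "\<And>g h. g \<in> G \<Longrightarrow> h \<in> G \<Longrightarrow> d (e g) (e h) \<le> 2 * D + 1 \<Longrightarrow> dY (f g) (f h) \<le> B"
    and \<Lambda>: "\<Lambda> > 0"
    and lower: "\<And>g. g \<in> G \<Longrightarrow> d v (e g) \<le> \<Lambda> * (dY y0 (f g) + 1)"
  shows "\<exists>\<kappa>>0. \<exists>C. \<forall>g\<in>G. \<forall>h\<in>G.
    \<kappa> * gromov_product d v (e g) (e h) - C \<le> gromov_product dY y0 (f g) (f h)"
proof -
  interpret Y: gromov_space Y dY \<delta> by fact
  define c where "c = 1 / \<Lambda>"
  have c: "c > 0" using \<Lambda> by (simp add: c_def)
  have D: "D \<ge> 0" using dense[OF v] e v nonneg by (meson image_subset_iff order_trans)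
  \<comment> \<open>\<open>D\<close> is the distance to the nearest orbit point, the
    \<open>1\<close> next to it the possible shortfall at the last index, whose point is
    \<open>e g\<close>, and the outer \<open>1\<close> comes from \<open>lower\<close>.\<close>
  define C1 where "C1 = c * (D + 1) + 1"
  obtain C' where C': "\<And>N y m. (\<forall>i\<le>N. y i \<in> Y) \<Longrightarrow> (\<forall>i<N. dY (y i) (y (Suc i)) \<le> B)
    \<Longrightarrow> (\<forall>i\<le>N. c * (m + real i) - C1 \<le> dY y0 (y i)) \<Longrightarrow> c * m - C' \<le> gromov_product dY y0 (y 0) (y N)"
    using Y.gromov_product_chain[OF y0 c, of B C1] by blast
  have lower': "c * d v (e g) - 1 \<le> dY y0 (f g)" if "g \<in> G" for g
    using lower[OF that] \<Lambda> by (simp add: c_def field_simps)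
  have half: "c * d v m - C' \<le> gromov_product dY y0 (f k) (f g)"
    if g: "g \<in> G" and k: "k \<in> G" "d m (e k) \<le> D" and m: "m \<in> T" "between d v m (e g)" for g k m
  proof -
    have eg: "e g \<in> T" using e g by blast
    define N where "N = Suc (nat \<lfloor>d m (e g)\<rfloor>)"
    have N: "real N - 1 \<le> d m (e g)" "d m (e g) < real N"
      unfolding N_def using nonneg[of m "e g"] by linarith+
    have "\<exists>z\<in>T. between d m z (e g) \<and> d m z = real i" if "i < N" for i
    proof -
      have "real i \<le> d m (e g)" using N that by linarith
      then obtain z where "z \<in> T" "between d m z (e g)" "d m z = real i"
        using point_on_segment[OF m(1) eg, of "real i"] by auto
      then show ?thesis by blast
    qed
    then obtain z where z: "\<And>i. i < N \<Longrightarrow> z i \<in> T" "\<And>i. i < N \<Longrightarrow> between d m (z i) (e g)"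
      "\<And>i. i < N \<Longrightarrow> d m (z i) = real i" by metis
    have "\<exists>h. i < N \<longrightarrow> h \<in> G \<and> d (z i) (e h) \<le> D" for i
      using dense z(1) by blast
    then obtain h where h: "\<And>i. i < N \<Longrightarrow> h i \<in> G" "\<And>i. i < N \<Longrightarrow> d (z i) (e (h i)) \<le> D"
      by metis
    have z0: "z 0 = m" using z(1)[of 0] z(3)[of 0] m by (simp add: N_def)
    \<comment> \<open>The ends are prescribed, so that the chain joins \<open>f k\<close> to
      \<open>f g\<close>; as \<open>N\<close> is positive, the two prescriptions do not
      collide.\<close>
    define h' where "h' i = (if i = 0 then k else if i < N then h i else g)" for i
    have h'G: "h' i \<in> G" for i using h g k by (simp add: h'_def)
    define z' where "z' i = (if i < N then z i else e g)" for i
    have z': "z' i \<in> T" for i using z(1) eg by (simp add: z'_def)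
    have eh': "e (h' i) \<in> T" for i using h'G e by blast
    have close: "d (z' i) (e (h' i)) \<le> D" if "i \<le> N" for i
      using h(2) k(2) that D eg z0 by (auto simp: z'_def h'_def N_def)
    have zz: "d (z' i) (z' (Suc i)) \<le> 1" if "i < N" for i
    proof (cases "Suc i < N")
      case True
      have "d (z i) (z (Suc i)) \<le> 1"
        using z[OF that] z[OF True] m eg four_point[of m "z i" "e g" "z (Suc i)"]
        by (auto simp: between_def commute)
      then show ?thesis using True that by (simp add: z'_def)
    next
      case False
      then have "real i = real N - 1" using that by linarith
      then show ?thesis using z[OF that] N that False by (simp add: z'_def between_def)
    qed
    have "c * d v m - C' \<le> gromov_product dY y0 (f (h' 0)) (f (h' N))"
    proof (rule C'; intro allI impI)
      show "f (h' i) \<in> Y" for i using h'G f by blast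
      fix i assume i: "i < N"
      have "d (e (h' i)) (e (h' (Suc i))) \<le> 2 * D + 1"
        using triangle[of "e (h' i)" "z' i" "e (h' (Suc i))"]
          triangle[of "z' i" "z' (Suc i)" "e (h' (Suc i))"]
          close[of i] close[of "Suc i"] zz[OF i] i eh' z' by (simp add: commute)
      then show "dY (f (h' i)) (f (h' (Suc i))) \<le> B" using lip h'G by blast
    next
      fix i assume i: "i \<le> N"
      have "d v m + real i - 1 \<le> d v (z' i)"
      proof (cases "i < N")
        case True
        then show ?thesis
          using z[OF True] m v eg triangle[of v "z i" "e g"] by (auto simp: between_def z'_def)
      next
        case False
        then show ?thesis using N i m by (auto simp: z'_def between_def)
      qed
      then have "d v m + real i - 1 - D \<le> d v (e (h' i))"
        using close[OF i] triangle[of v "e (h' i)" "z' i"] z' eh' v by (simp add: commute)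
      then have "c * (d v m + real i - 1 - D) \<le> c * d v (e (h' i))" using c by simp
      then show "c * (d v m + real i) - C1 \<le> dY y0 (f (h' i))"
        using lower'[OF h'G, of i] by (simp add: C1_def algebra_simps)
    qed
    then show ?thesis by (simp add: h'_def N_def)
  qed
  have "c * gromov_product d v (e g) (e h) - (C' + \<delta>) \<le> gromov_product dY y0 (f g) (f h)"
    if g: "g \<in> G" and h: "h \<in> G" for g h
  proof -
    have eg: "e g \<in> T" "e h \<in> T" using e g h by auto
    obtain m where m: "m \<in> T" "between d v m (e g)" "between d v m (e h)" "between d (e g) m (e h)"
      using median[OF v eg] by metis
    then have dm: "d v m = gromov_product d v (e g) (e h)"
      using v eg by (simp add: between_def gromov_product_def commute)
    obtain k where k: "k \<in> G" "d m (e k) \<le> D" using dense m by blast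
    have Y: "f g \<in> Y" "f h \<in> Y" "f k \<in> Y" using g h k f by auto
    \<comment> \<open>Both halves start at the same \<open>k\<close> near the median; joining them
      costs one more \<delta>.\<close>
    show ?thesis
      using half[OF g k m(1,2)] half[OF h k m(1,3)] Y.gromov_product_min[OF y0 Y(1,3,2)]
        Y.gromov_product_commute[OF Y(1,3)] dm by (auto simp: min_def split: if_splits)
  qed
  then show ?thesis using c by blast
qed


section \<open>The word metric\<close>

lemma carrier_free_group: "carrier (free_group r) = {w. reduced w \<and> fst ` set w \<subseteq> {..<r}}"
  by (simp add: free_group_def)

lemma mult_free_group: "u \<otimes>\<^bsub>free_group r\<^esub> v = foldr cancel_Cons u v"
  by (simp add: free_group_def)

lemma one_free_group: "\<one>\<^bsub>free_group r\<^esub> = []"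
  by (simp add: free_group_def)

interpretation free_group: group "free_group r" for r
  by (rule group_free_group)

lemma inv_free_group:
  assumes "u \<in> carrier (free_group r)"
  shows "inv\<^bsub>free_group r\<^esub> u = rev (map inv_letter u)"
proof -
  have "rev (map inv_letter u) \<in> carrier (free_group r)"
    using assms by (auto simp: carrier_free_group reduced_inverse simp del: rev_map)
  moreover have "rev (map inv_letter u) \<otimes>\<^bsub>free_group r\<^esub> u = \<one>\<^bsub>free_group r\<^esub>"
    using assms foldr_cancel_Cons_inverse[of "[]" u]
    by (simp add: carrier_free_group mult_free_group one_free_group foldr_cancel_Cons_Nil)
      (simp add: reduced_def)
  ultimately show ?thesis using assms by (metis free_group.inv_equality)
qed

fun common_prefix :: "'a list \<Rightarrow> 'a list \<Rightarrow> nat" where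
  "common_prefix (x # u) (y # v) = (if x = y then Suc (common_prefix u v) else 0)"
| "common_prefix _ _ = 0"

lemma common_prefix_ge_iff:
  "n \<le> common_prefix u v \<longleftrightarrow> n \<le> length u \<and> n \<le> length v \<and> take n u = take n v"
proof (induction u v arbitrary: n rule: common_prefix.induct)
  case (1 x u y v)
  then show ?case by (cases n) auto
qed (auto simp: le_Suc_eq)

lemma reduced_append_foldr: "reduced (u @ v) \<Longrightarrow> foldr cancel_Cons u v = u @ v"
proof (induction u)
  case (Cons x u)
  have "reduced (u @ v)" using Cons.prems by (cases "u @ v") (auto simp: reduced_def)
  then have "foldr cancel_Cons (x # u) v = cancel_Cons x (u @ v)" using Cons.IH by simp
  also have "\<dots> = x # u @ v"
    using Cons.prems by (cases "u @ v") (auto simp: reduced_def cancel_Cons_def)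
  finally show ?case by simp
qed simp

lemma reduced_inverse_append:
  assumes "reduced (x # u)" "reduced (y # v)" "x \<noteq> y"
  shows "reduced (rev (map inv_letter (x # u)) @ y # v)"
proof -
  have "reduced (rev (map inv_letter (x # u)))" by (rule reduced_inverse[OF assms(1)])
  then show ?thesis
    using assms by (auto simp: reduced_def successively_append_iff)
qed

text \<open>Cancellation between the inverse of \<open>u\<close> and \<open>v\<close> removes
  exactly the common prefix, and each of its letters disappears from both words.\<close>

lemma length_inv_mult:
  assumes "reduced u" "reduced v"
  shows "length (foldr cancel_Cons (rev (map inv_letter u)) v) + 2 * common_prefix u v
    = length u + length v"
  using assms
proof (induction u v rule: common_prefix.induct)
  case (1 x u y v)
  show ?case
  proof (cases "x = y")
    case True
    have "reduced u" "reduced v" using 1 by (auto simp: reduced_def successively_Cons)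
    moreover have "cancel_Cons (inv_letter y) (y # v) = v" by (simp add: cancel_Cons_def)
    ultimately show ?thesis using 1 True by simp
  next
    case False
    then show ?thesis
      using reduced_append_foldr[OF reduced_inverse_append[OF 1(2,3)]] by simp
  qed
next
  case ("2_2" u)
  then show ?case using foldr_cancel_Cons_Nil[OF reduced_inverse[of u]] by simp
next
  case ("2_1" v)
  then show ?case by simp
qed

text \<open>The word metric without reference to the group: being defined on all lists, it is a
  metric and 0-hyperbolic with no side conditions, and its Gromov product at the empty word is the
  length of the common prefix.\<close>

definition prefix_dist :: "'a list \<Rightarrow> 'a list \<Rightarrow> real" where
  "prefix_dist u v = real (length u) + real (length v) - 2 * real (common_prefix u v)"

lemma word_dist_eq:
  assumes "u \<in> carrier (free_group r)" "v \<in> carrier (free_group r)"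
  shows "word_dist r u v = prefix_dist u v"
proof -
  have "length (foldr cancel_Cons (rev (map inv_letter u)) v) + 2 * common_prefix u v
    = length u + length v"
    using length_inv_mult[of u v] assms by (simp add: carrier_free_group)
  then show ?thesis
    using assms by (simp add: word_dist_def prefix_dist_def inv_free_group mult_free_group)
qed

lemma common_prefix_le: "common_prefix u v \<le> length u" "common_prefix u v \<le> length v"
  using common_prefix_ge_iff[of "common_prefix u v" u v] by auto

lemma common_prefix_commute: "common_prefix u v = common_prefix v u"
  by (induction u v rule: common_prefix.induct) auto

lemma common_prefix_min: "min (common_prefix u v) (common_prefix v w) \<le> common_prefix u w"
proof -
  let ?n = "min (common_prefix u v) (common_prefix v w)"
  have "?n \<le> common_prefix u v" "?n \<le> common_prefix v w" by auto
  then show ?thesis unfolding common_prefix_ge_iff[of ?n] by auto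
qed

lemma gromov_product_prefix_dist: "gromov_product prefix_dist [] u v = real (common_prefix u v)"
  by (simp add: gromov_product_def prefix_dist_def)

lemma gromov_space_prefix_dist: "gromov_space M prefix_dist 0"
proof
  fix x y z :: "'a list"
  show "0 \<le> prefix_dist x y"
    using common_prefix_le[of x y] by (simp add: prefix_dist_def)
  show "prefix_dist x y = prefix_dist y x"
    by (simp add: prefix_dist_def common_prefix_commute)
  have "x = y" if "length x + length y = 2 * common_prefix x y"
    using that common_prefix_le[of x y] common_prefix_ge_iff[of "common_prefix x y" x y] by auto
  moreover have "common_prefix x x = length x" by (induction x) auto
  ultimately show "prefix_dist x y = 0 \<longleftrightarrow> x = y"
    by (auto simp: prefix_dist_def)
  show "prefix_dist x z \<le> prefix_dist x y + prefix_dist y z"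
    using common_prefix_min[of x y z] common_prefix_le[of x y] common_prefix_le[of y z]
    by (auto simp: prefix_dist_def min_def split: if_splits)
next
  have "min (gromov_product prefix_dist w x y) (gromov_product prefix_dist w y z)
      \<le> gromov_product prefix_dist w x z" for w x y z :: "'a list"
  proof -
    let ?c = "\<lambda>a b. real (common_prefix a b)"
    \<comment> \<open>0-hyperbolicity at an arbitrary \<open>w\<close> amounts to an inequality
      between the three ways of pairing off four words. It follows from four instances of the
      ultrametric inequality for common prefixes.\<close>
    have aux: "min (q + p) (v + u) \<le> t + s"
      if "min p u \<le> t" "min v q \<le> t" "min p v \<le> s" "min u q \<le> s" for p q s t u v :: nat
      using that by linarith
    have "min (common_prefix y z + common_prefix x w) (common_prefix x y + common_prefix w z)
        \<le> common_prefix x z + common_prefix w y"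
      using common_prefix_min[of x w z] common_prefix_min[of x y z] common_prefix_min[of w x y]
        common_prefix_min[of w z y] common_prefix_commute[of x w] common_prefix_commute[of y z]
      by (intro aux) simp_all
    then have "min (?c y z + ?c w x) (?c x y + ?c w z) \<le> ?c x z + ?c w y"
      using common_prefix_commute[of x w] by linarith
    then show ?thesis
      by (simp add: gromov_product_def prefix_dist_def min_def split: if_splits)
  qed
  then show "delta_hyperbolic M prefix_dist 0"
    by (simp add: delta_hyperbolic_def)
qed

text \<open>Needed because \<open>word_dist\<close> and \<open>prefix_dist\<close> are identified on
  the carrier only.\<close>

lemma gromov_rel_cong:
  assumes "\<And>x y. x \<in> M \<Longrightarrow> y \<in> M \<Longrightarrow> d x y = d' x y"
  shows "gromov_rel M d = gromov_rel M d'"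
    "converges_to_infinity M d = converges_to_infinity M d'"
proof -
  have *: "products_diverge M d x y = products_diverge M d' x y"
    if xy: "range x \<subseteq> M" "range y \<subseteq> M" for x y
  proof -
    have M: "x i \<in> M" "y i \<in> M" for i using xy by auto
    have "gromov_product d w (x i) (y j) = gromov_product d' w (x i) (y j)" if "w \<in> M" for w i j
      using that M by (simp add: gromov_product_def assms)
    then show ?thesis unfolding products_diverge_def by simp
  qed
  show **: "converges_to_infinity M d = converges_to_infinity M d'"
  proof
    fix x show "converges_to_infinity M d x = converges_to_infinity M d' x"
      using *[of x x] unfolding converges_to_infinity_def by argo
  qed
  have "converges_to_infinity M d' x \<and> converges_to_infinity M d' y \<and> products_diverge M d x y
      \<longleftrightarrow> converges_to_infinity M d' x \<and> converges_to_infinity M d' y \<and> products_diverge M d' x y" for x y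
    using *[of x y] unfolding converges_to_infinity_def by argo
  then show "gromov_rel M d = gromov_rel M d'"
    unfolding gromov_rel_def ** by simp
qed

lemma free_boundary_eq: "free_boundary r = gromov_boundary (carrier (free_group r)) prefix_dist"
  unfolding free_boundary_def gromov_boundary_def
  by (simp add: gromov_rel_cong[of "carrier (free_group r)" "word_dist r" prefix_dist] word_dist_eq)

lemma length_foldr_cancel_Cons: "length (foldr cancel_Cons u v) \<le> length u + length v"
proof (induction u)
  case (Cons x u)
  have "length (cancel_Cons x w) \<le> Suc (length w)" for w
    by (auto simp: cancel_Cons_def)
  then show ?case using Cons by (auto intro: order_trans)
qed simp

lemma finite_bounded_words: "finite {w \<in> carrier (free_group r). length w \<le> n}"
proof -
  have "finite {w :: word. set w \<subseteq> {..<r} \<times> UNIV \<and> length w \<le> n}"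
    by (intro finite_lists_length_le) simp
  moreover have "{w \<in> carrier (free_group r). length w \<le> n}
      \<subseteq> {w. set w \<subseteq> {..<r} \<times> UNIV \<and> length w \<le> n}"
    by (auto simp: carrier_free_group)
  ultimately show ?thesis by (rule finite_subset[rotated])
qed

lemma take_in_free_group:
  assumes "w \<in> carrier (free_group r)"
  shows "take n w \<in> carrier (free_group r)"
proof -
  have "reduced (take n w @ drop n w)" using assms by (simp add: carrier_free_group)
  then have "reduced (take n w)" unfolding reduced_def successively_append_iff by blast
  moreover have "fst ` set (take n w) \<subseteq> {..<r}"
    using assms set_take_subset[of n w] by (auto simp: carrier_free_group)
  ultimately show ?thesis by (simp add: carrier_free_group)
qed

lemma Cons_in_free_group:
  assumes "s # w \<in> carrier (free_group r)"
  shows "[s] \<in> carrier (free_group r)" "w \<in> carrier (free_group r)"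
    "s # w = [s] \<otimes>\<^bsub>free_group r\<^esub> w"
proof -
  show "[s] \<in> carrier (free_group r)" "w \<in> carrier (free_group r)"
    using assms by (auto simp: carrier_free_group reduced_def successively_Cons)
  show "s # w = [s] \<otimes>\<^bsub>free_group r\<^esub> w"
    using reduced_append_foldr[of "[s]" w] assms by (simp add: mult_free_group carrier_free_group)
qed

lemma finite_letters: "finite {s. [s] \<in> carrier (free_group r)}"
proof (rule finite_subset)
  show "{s. [s] \<in> carrier (free_group r)} \<subseteq> {..<r} \<times> UNIV"
    by (auto simp: carrier_free_group)
qed simp


section \<open>Displacement estimates\<close>

text \<open>A geodesic from \<open>x\<close> to \<open>\<phi> g x\<close> is followed in steps of length \<open>\<epsilon>\<close>, each of which leads
  from one translate of \<open>K\<close> to another one at distance at most \<open>\<epsilon>\<close>.\<close>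

lemma norm_le_displacement:
  assumes act: "isometric_action G M d \<phi>" and geod: "geodesic_space M d"
    and K: "K \<subseteq> M" "M \<subseteq> (\<Union>g\<in>carrier G. \<phi> g ` K)" and x: "x \<in> K" and \<epsilon>: "\<epsilon> > 0" and B: "B \<ge> 0"
    and sub: "\<And>g h. g \<in> carrier G \<Longrightarrow> h \<in> carrier G \<Longrightarrow> N (g \<otimes>\<^bsub>G\<^esub> h) \<le> N g + N h"
    and near: "\<And>g k k'. g \<in> carrier G \<Longrightarrow> k \<in> K \<Longrightarrow> k' \<in> K \<Longrightarrow> d k (\<phi> g k') \<le> \<epsilon> \<Longrightarrow> N g \<le> (B :: real)"
    and g: "g \<in> carrier G"
  shows "N g \<le> B * (d x (\<phi> g x) / \<epsilon> + 2)"
proof -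
  interpret group_action G M \<phi> using act by (simp add: isometric_action_def)
  interpret G: group G by (metis group_hom group_hom.axioms(1))
  interpret Metric_space M d using act by (simp add: isometric_action_def)
  have iso: "d (\<phi> h y) (\<phi> h z) = d y z" if "h \<in> carrier G" "y \<in> M" "z \<in> M" for h y z
    using act that by (simp add: isometric_action_def)
  have xM: "x \<in> M" "\<phi> g x \<in> M" using x K g element_image by auto
  define l where "l = d x (\<phi> g x)"
  have l: "l \<ge> 0" by (simp add: l_def)
  obtain c where c: "c ` {0..l} \<subseteq> M" "c 0 = x" "c l = \<phi> g x"
    "\<forall>s\<in>{0..l}. \<forall>t\<in>{0..l}. d (c s) (c t) = \<bar>s - t\<bar>"
    using geod xM unfolding geodesic_space_def l_def by meson
  \<comment> \<open>Capping at \<open>l\<close> makes the last step shorter and lets the sequence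
    end exactly at \<open>\<phi> g x\<close>.\<close>
  define p where "p i = c (min (real i * \<epsilon>) l)" for i
  have arg: "min (real i * \<epsilon>) l \<in> {0..l}" for i using l \<epsilon> by simp
  have pM: "p i \<in> M" for i using c(1) arg by (auto simp: p_def)
  have step: "d (p i) (p (Suc i)) \<le> \<epsilon>" for i
    using c(4) arg[of i] arg[of "Suc i"] \<epsilon> by (simp add: p_def min_def algebra_simps abs_if)
  have *: "N h \<le> B * (real i + 1)" if "h \<in> carrier G" "p i \<in> \<phi> h ` K" for h i
    using that
  proof (induction i arbitrary: h)
    case 0
    then obtain k where "k \<in> K" "x = \<phi> h k" using c(2) l by (auto simp: p_def min_def)
    then show ?case using near[OF 0(1) x, of k] \<epsilon> xM by simp
  next
    case (Suc i)
    obtain h' where h': "h' \<in> carrier G" "p i \<in> \<phi> h' ` K" using K(2) pM by blast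
    obtain k k' where k: "k \<in> K" "k' \<in> K" "p i = \<phi> h' k" "p (Suc i) = \<phi> h k'"
      using h' Suc.prems by blast
    let ?z = "inv\<^bsub>G\<^esub> h' \<otimes>\<^bsub>G\<^esub> h"
    have z: "?z \<in> carrier G" using h' Suc.prems by simp
    have kM: "k \<in> M" "k' \<in> M" using k K by auto
    have h_eq: "h = h' \<otimes>\<^bsub>G\<^esub> ?z"
      using h' Suc.prems by (simp add: G.m_assoc[symmetric])
    have "\<phi> h k' = \<phi> h' (\<phi> ?z k')" using composition_rule[OF kM(2) h'(1) z] h_eq by metis
    then have "d k (\<phi> ?z k') = d (p i) (p (Suc i))"
      using k iso[OF h'(1) kM(1), of "\<phi> ?z k'"] element_image[OF z kM(2)] by simp
    then have "N ?z \<le> B" using near[OF z k(1,2)] step[of i] by simp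
    moreover have "N h \<le> N h' + N ?z" using sub[OF h'(1) z] h_eq by metis
    moreover have "N h' \<le> B * (real i + 1)" using Suc.IH h' by blast
    ultimately show ?case by (simp add: algebra_simps)
  qed
  \<comment> \<open>Rounding up costs one step and the start of the induction one more; hence the
    \<open>2\<close> in the claim.\<close>
  define n where "n = nat \<lceil>l / \<epsilon>\<rceil>"
  have n: "l / \<epsilon> \<le> real n" "real n \<le> l / \<epsilon> + 1"
    using l \<epsilon> divide_nonneg_pos[of l \<epsilon>] unfolding n_def by linarith+
  have "p n = \<phi> g x" using n(1) \<epsilon> c(3) by (simp add: p_def min_def field_simps)
  then have "p n \<in> \<phi> g ` K" using x by blast
  then have "N g \<le> B * (real n + 1)" using * g by blast
  also have "\<dots> \<le> B * (l / \<epsilon> + 2)" using n B by (intro mult_left_mono) auto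
  finally show ?thesis by (simp add: l_def)
qed


section \<open>Trees in outer space\<close>

locale outer_space_tree =
  fixes r :: nat and T :: "'t set" and d :: "'t \<Rightarrow> 't \<Rightarrow> real" and \<phi> :: "word \<Rightarrow> 't \<Rightarrow> 't" and v :: 't
  assumes rank: "r \<ge> 2" and cv: "cv r T d \<phi>" and base: "v \<in> T"

sublocale outer_space_tree \<subseteq> real_tree_space T d
  using cv by (simp add: cv_def real_tree_space_def)

context outer_space_tree
begin

abbreviation F where "F \<equiv> carrier (free_group r)"
abbreviation mult_F (infixl "\<cdot>" 70) where "g \<cdot> h \<equiv> g \<otimes>\<^bsub>free_group r\<^esub> h"
abbreviation inv_F where "inv_F g \<equiv> inv\<^bsub>free_group r\<^esub> g"
abbreviation one_F where "one_F \<equiv> \<one>\<^bsub>free_group r\<^esub>"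

lemma act: "isometric_action (free_group r) T d \<phi>"
  using cv by (simp add: cv_def)

lemma gact: "group_action (free_group r) T \<phi>"
  using act by (simp add: isometric_action_def)

lemma act_closed: "g \<in> F \<Longrightarrow> x \<in> T \<Longrightarrow> \<phi> g x \<in> T"
  by (rule group_action.element_image[OF gact]) auto

lemma act_mult: "g \<in> F \<Longrightarrow> h \<in> F \<Longrightarrow> x \<in> T \<Longrightarrow> \<phi> (g \<cdot> h) x = \<phi> g (\<phi> h x)"
  by (rule group_action.composition_rule[OF gact])

lemma act_one: "x \<in> T \<Longrightarrow> \<phi> one_F x = x"
  using group_action.id_eq_one[OF gact] by (metis restrict_apply')

lemma act_dist: "g \<in> F \<Longrightarrow> x \<in> T \<Longrightarrow> y \<in> T \<Longrightarrow> d (\<phi> g x) (\<phi> g y) = d x y"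
  using act by (simp add: isometric_action_def)

lemma act_inv_left: "g \<in> F \<Longrightarrow> x \<in> T \<Longrightarrow> \<phi> (inv_F g) (\<phi> g x) = x"
  using act_mult[of "inv_F g" g x] by (simp add: act_one)

lemma act_inv_right: "g \<in> F \<Longrightarrow> x \<in> T \<Longrightarrow> \<phi> g (\<phi> (inv_F g) x) = x"
  using act_mult[of g "inv_F g" x] by (simp add: act_one)

lemma act_inj: "g \<in> F \<Longrightarrow> x \<in> T \<Longrightarrow> y \<in> T \<Longrightarrow> \<phi> g x = \<phi> g y \<Longrightarrow> x = y"
  by (metis act_inv_left)

lemma act_free: "g \<in> F \<Longrightarrow> x \<in> T \<Longrightarrow> \<phi> g x = x \<Longrightarrow> g = one_F"
  using cv unfolding cv_def by metis

lemma act_dist_inv: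
  assumes "g \<in> F" "h \<in> F" "x \<in> T" "y \<in> T"
  shows "d (\<phi> g x) (\<phi> h y) = d x (\<phi> (inv_F g \<cdot> h) y)"
proof -
  have "d (\<phi> g x) (\<phi> h y) = d (\<phi> (inv_F g) (\<phi> g x)) (\<phi> (inv_F g) (\<phi> h y))"
    using assms by (simp add: act_dist act_closed)
  then show ?thesis using assms by (simp add: act_mult act_inv_left)
qed

lemma act_between:
  "g \<in> F \<Longrightarrow> x \<in> T \<Longrightarrow> y \<in> T \<Longrightarrow> z \<in> T \<Longrightarrow> between d (\<phi> g x) (\<phi> g y) (\<phi> g z) \<longleftrightarrow> between d x y z"
  by (simp add: between_def act_dist)

lemma minimal:
  assumes "S \<subseteq> T" "S \<noteq> {}" "\<And>g. g \<in> F \<Longrightarrow> \<phi> g ` S \<subseteq> S" "real_tree S d"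
  shows "S = T"
proof -
  have "\<forall>S\<subseteq>T. S \<noteq> {} \<and> real_tree S d \<and> (\<forall>g\<in>F. \<phi> g ` S \<subseteq> S) \<longrightarrow> S = T"
    using cv by (simp add: cv_def)
  then show ?thesis using assms by simp
qed

lemma letter_in: "[(0, True)] \<in> F"
  using rank by (simp add: carrier_free_group reduced_def)

text \<open>By minimality: the union of these segments is an invariant subtree.\<close>

lemma orbit_segments:
  assumes "x \<in> T"
  shows "\<exists>g\<in>F. \<exists>s. [s] \<in> F \<and> between d (\<phi> g v) x (\<phi> (g \<cdot> [s]) v)"
proof -
  define S where "S = {x \<in> T. \<exists>g\<in>F. \<exists>s. [s] \<in> F \<and> between d (\<phi> g v) x (\<phi> (g \<cdot> [s]) v)}"
  \<comment> \<open>A segment from \<open>g v\<close> to \<open>g w v\<close> is covered by the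
    segments between the translates of \<open>v\<close> under consecutive prefixes of
    \<open>w\<close>; \<open>between_split\<close> peels off one letter at a time.\<close>
  have word: "z \<in> S" if "w \<in> F" "g \<in> F" "z \<in> T" "between d (\<phi> g v) z (\<phi> (g \<cdot> w) v)" for w g z
    using that
  proof (induction w arbitrary: g)
    case Nil
    have g1: "g \<cdot> [] = g" using free_group.r_one[OF Nil(2)] one_free_group by metis
    have "between d (\<phi> g v) z (\<phi> g v)" using Nil(4) by (simp only: g1)
    then have "d (\<phi> g v) z = 0"
      using Nil(2) by (simp add: between_def commute act_closed base)
    then have "z = \<phi> g v" using Nil by (simp add: act_closed base)
    then have "between d (\<phi> g v) z (\<phi> (g \<cdot> [(0, True)]) v)"
      using Nil by (simp add: between_def act_closed base)
    then show ?case using Nil letter_in unfolding S_def by blast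
  next
    case (Cons s w)
    note sw = Cons_in_free_group[OF Cons.prems(1)]
    let ?h = "g \<cdot> [s]"
    have h: "?h \<in> F" using Cons.prems sw by simp
    have hw: "g \<cdot> (s # w) = ?h \<cdot> w"
      using Cons.prems sw free_group.m_assoc by metis
    have hwT: "\<phi> (?h \<cdot> w) v \<in> T" "\<phi> g v \<in> T" "\<phi> ?h v \<in> T"
      using h sw(2) Cons.prems(2) base by (auto intro!: act_closed)
    have "between d (\<phi> g v) z (\<phi> (?h \<cdot> w) v)" using Cons.prems(4) by (simp only: hw)
    then have "between d (\<phi> ?h v) z (\<phi> g v) \<or> between d (\<phi> ?h v) z (\<phi> (?h \<cdot> w) v)"
      using Cons.prems hwT by (intro between_split)
    then show ?case
    proof
      assume "between d (\<phi> ?h v) z (\<phi> g v)"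
      then have "between d (\<phi> g v) z (\<phi> ?h v)"
        using Cons.prems h by (subst between_sym) (auto simp: act_closed base)
      then show ?case using Cons.prems sw(1) unfolding S_def by blast
    next
      assume "between d (\<phi> ?h v) z (\<phi> (?h \<cdot> w) v)"
      then show ?case using Cons.IH[OF sw(2) h] Cons.prems by blast
    qed
  qed
  have orbit: "z \<in> S" if "g \<in> F" "h \<in> F" "z \<in> T" "between d (\<phi> g v) z (\<phi> h v)" for g h z
  proof -
    have "g \<cdot> (inv_F g \<cdot> h) = h"
      using that by (simp add: free_group.m_assoc[symmetric])
    then show ?thesis using word[of "inv_F g \<cdot> h" g z] that by simp
  qed
  have cone: "z \<in> S" if x: "x \<in> S" and g: "g \<in> F" and z: "z \<in> T" "between d (\<phi> g v) z x" for x z g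
  proof -
    obtain h s where h: "h \<in> F" "[s] \<in> F" "x \<in> T" "between d (\<phi> h v) x (\<phi> (h \<cdot> [s]) v)"
      using x unfolding S_def by blast
    have gv: "\<phi> g v \<in> T" "\<phi> h v \<in> T" "\<phi> (h \<cdot> [s]) v \<in> T" using g h base by (auto simp: act_closed)
    have "between d (\<phi> h v) z (\<phi> g v) \<or> between d (\<phi> h v) z x"
      using gv z h by (intro between_split) auto
    then show ?thesis
    proof
      assume "between d (\<phi> h v) z x"
      then have "between d (\<phi> h v) z (\<phi> (h \<cdot> [s]) v)"
        using between_trans(1)[OF gv(2) z(1) h(3) gv(3) _ h(4)] by blast
      then show ?thesis unfolding S_def using h z by blast
    qed (use orbit h g z in blast)
  qed
  \<comment> \<open>By \<open>cone\<close> the set is star-shaped about every orbit point. A segment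
    between two of its points is covered by the two segments that join them to
    \<open>v\<close>.\<close>
  have convex: "z \<in> S" if x: "x \<in> S" "y \<in> S" and z: "z \<in> T" "between d x z y" for x y z
  proof -
    have one: "one_F \<in> F" by simp
    have xy: "x \<in> T" "y \<in> T" using x by (auto simp: S_def)
    then have "between d (\<phi> one_F v) z x \<or> between d (\<phi> one_F v) z y"
      using z act_closed[OF one base] by (intro between_split) auto
    then show ?thesis using cone[OF _ one z(1)] x by blast
  qed
  have "S \<subseteq> T" by (auto simp: S_def)
  moreover have "S \<noteq> {}"
  proof -
    have "between d (\<phi> one_F v) v (\<phi> one_F v)" by (simp add: act_one base between_def)
    then have "v \<in> S" by (intro orbit[of "one_F" "one_F"]) (auto simp: base)
    then show ?thesis by blast
  qed
  moreover have "\<phi> g ` S \<subseteq> S" if g: "g \<in> F" for g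
  proof
    fix y assume "y \<in> \<phi> g ` S"
    then obtain x where x: "x \<in> S" "y = \<phi> g x" by blast
    then obtain h s where h: "h \<in> F" "[s] \<in> F" "x \<in> T" "between d (\<phi> h v) x (\<phi> (h \<cdot> [s]) v)"
      unfolding S_def by blast
    have "between d (\<phi> (g \<cdot> h) v) y (\<phi> (g \<cdot> h \<cdot> [s]) v)"
      using h g x by (simp add: act_mult act_between act_closed base free_group.m_assoc)
    moreover have "g \<cdot> h \<in> F" using g h by simp
    ultimately show "y \<in> S" unfolding S_def using h g x act_closed by blast
  qed
  moreover have "real_tree S d"
  proof -
    have "geodesic_space S d"
      unfolding geodesic_space_def
    proof (intro ballI)
      fix x y assume xy: "x \<in> S" "y \<in> S"
      then have xyT: "x \<in> T" "y \<in> T" using \<open>S \<subseteq> T\<close> by auto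
      have "geodesic_space T d" using rt by (simp add: real_tree_def)
      then obtain c where c: "c ` {0..d x y} \<subseteq> T" "c 0 = x" "c (d x y) = y"
        "\<forall>s\<in>{0..d x y}. \<forall>t\<in>{0..d x y}. d (c s) (c t) = \<bar>s - t\<bar>"
        using xyT unfolding geodesic_space_def by meson
      have "c t \<in> S" if t: "t \<in> {0..d x y}" for t
      proof (rule convex[OF xy])
        show "c t \<in> T" using c t by blast
        have e: "0 \<in> {0..d x y}" "d x y \<in> {0..d x y}" by auto
        have "d (c 0) (c t) = \<bar>0 - t\<bar>" "d (c t) (c (d x y)) = \<bar>t - d x y\<bar>"
          using c(4) e t by blast+
        then show "between d x (c t) y" using t c(2,3) by (simp add: between_def)
      qed
      then show "\<exists>c. c ` {0..d x y} \<subseteq> S \<and> c 0 = x \<and> c (d x y) = y \<and>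
          (\<forall>s\<in>{0..d x y}. \<forall>t\<in>{0..d x y}. d (c s) (c t) = \<bar>s - t\<bar>)"
        using c by blast
    qed
    moreover have "Metric_space S d" using subspace[OF \<open>S \<subseteq> T\<close>] .
    moreover have "delta_hyperbolic S d 0"
      using delta_hyp \<open>S \<subseteq> T\<close> unfolding delta_hyperbolic_def by (meson subsetD)
    ultimately show ?thesis by (simp add: real_tree_def)
  qed
  ultimately have "S = T" by (intro minimal)
  then show ?thesis using assms unfolding S_def by blast
qed

definition D where "D = Max ((\<lambda>s. d v (\<phi> [s] v)) ` {s. [s] \<in> F})"

lemma dist_letter_le: "[s] \<in> F \<Longrightarrow> d v (\<phi> [s] v) \<le> D"
  unfolding D_def using finite_letters by (intro Max_ge) auto

lemma D_nonneg: "D \<ge> 0"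
  using dist_letter_le[OF letter_in] nonneg[of v "\<phi> [(0, True)] v"] by linarith

text \<open>The point \<open>y\<close> lies on a segment of length at most \<open>D\<close> between
  two orbit points, and seen from \<open>b\<close> one of these lies behind \<open>y\<close>. Orbit
  points are thus found in prescribed directions, not merely nearby.\<close>

lemma orbit_beyond:
  assumes "b \<in> T" "y \<in> T"
  shows "\<exists>g\<in>F. between d b y (\<phi> g v) \<and> d y (\<phi> g v) \<le> D"
proof -
  obtain g s where g: "g \<in> F" "[s] \<in> F" "between d (\<phi> g v) y (\<phi> (g \<cdot> [s]) v)"
    using orbit_segments[OF assms(2)] by blast
  let ?h = "g \<cdot> [s]"
  have h: "?h \<in> F" using g by simp
  have T: "\<phi> g v \<in> T" "\<phi> ?h v \<in> T" using act_closed g h base by auto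
  have "d (\<phi> g v) (\<phi> ?h v) = d v (\<phi> [s] v)" using g by (simp add: act_mult act_dist act_closed base)
  then have "d (\<phi> g v) y + d y (\<phi> ?h v) \<le> D" using g dist_letter_le[OF g(2)] by (simp add: between_def)
  then have "d y (\<phi> g v) \<le> D" "d y (\<phi> ?h v) \<le> D"
    using nonneg[of y "\<phi> g v"] nonneg[of y "\<phi> ?h v"] commute[of y "\<phi> g v"] by linarith+
  moreover have "between d b y (\<phi> g v) \<or> between d b y (\<phi> ?h v)"
    using g T assms by (intro between_split) auto
  ultimately show ?thesis using g h by blast
qed

lemma orbit_dense: "x \<in> T \<Longrightarrow> \<exists>g\<in>F. d x (\<phi> g v) \<le> D"
  using orbit_beyond by blast

text \<open>Discreteness gives a positive bound at each point separately. Since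
  \<open>d z (\<phi> g z)\<close> is 2-Lipschitz in \<open>z\<close>, a third of the bound survives
  on a ball of a third of its size, and by compactness finitely many such balls cover the
  segment.\<close>

lemma segment_uniformly_discrete:
  assumes xy: "x \<in> T" "y \<in> T"
  shows "\<exists>\<epsilon>>0. \<forall>z\<in>T. between d x z y \<longrightarrow> (\<forall>g\<in>F. g \<noteq> one_F \<longrightarrow> \<epsilon> \<le> d z (\<phi> g z))"
proof -
  have "\<exists>\<epsilon>>0. \<forall>g\<in>F. g \<noteq> one_F \<longrightarrow> \<epsilon> \<le> d z (\<phi> g z)" if "z \<in> T" for z
  proof -
    obtain \<epsilon> where "\<epsilon> > 0" "\<forall>g\<in>F. d z (\<phi> g z) < \<epsilon> \<longrightarrow> \<phi> g z = z"
      using cv \<open>z \<in> T\<close> unfolding cv_def by metis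
    then show ?thesis using act_free[OF _ that] by (meson not_le)
  qed
  then obtain e where e: "\<And>z. z \<in> T \<Longrightarrow> e z > 0"
    "\<And>z g. z \<in> T \<Longrightarrow> g \<in> F \<Longrightarrow> g \<noteq> one_F \<Longrightarrow> e z \<le> d z (\<phi> g z)" by metis
  have "\<exists>z\<in>T. between d x z y \<and> d x z = t" if t: "t \<in> {0..d x y}" for t
    using point_on_segment[OF xy, of t] t by (metis atLeastAtMost_iff)
  then obtain p where p: "\<And>t. t \<in> {0..d x y} \<Longrightarrow> p t \<in> T"
    "\<And>t. t \<in> {0..d x y} \<Longrightarrow> between d x (p t) y" "\<And>t. t \<in> {0..d x y} \<Longrightarrow> d x (p t) = t"
    by metis
  let ?B = "\<lambda>t. ball t (e (p t) / 3)"
  obtain A where A: "A \<subseteq> {0..d x y}" "finite A" "{0..d x y} \<subseteq> (\<Union>t\<in>A. ?B t)"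
  proof (rule compactE_image[of "{0..d x y}" "{0..d x y}" ?B])
    show "{0..d x y} \<subseteq> (\<Union>t\<in>{0..d x y}. ?B t)"
    proof
      fix t assume "t \<in> {0..d x y}"
      then show "t \<in> (\<Union>t\<in>{0..d x y}. ?B t)" using e(1)[OF p(1)] by (intro UN_I[of t]) auto
    qed
  qed auto
  have "A \<noteq> {}" using A(3) nonneg[of x y] by auto
  define \<epsilon> where "\<epsilon> = Min ((\<lambda>t. e (p t) / 3) ` A)"
  have "\<epsilon> > 0" unfolding \<epsilon>_def using A e(1) p(1) \<open>A \<noteq> {}\<close> by (subst Min_gr_iff) auto
  moreover have "\<epsilon> \<le> d z (\<phi> g z)"
    if z: "z \<in> T" "between d x z y" and g: "g \<in> F" "g \<noteq> one_F" for z g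
  proof -
    have "d x z \<in> {0..d x y}" using z by (simp add: between_def)
    then have "d x z \<in> (\<Union>t\<in>A. ?B t)" using A(3) by blast
    then obtain t where t: "t \<in> A" "dist t (d x z) < e (p t) / 3" by auto
    then have t': "t \<in> {0..d x y}" using A by blast
    have "d (p t) z = \<bar>t - d x z\<bar>"
      using between_dist[OF xy(1) p(1)[OF t'] z(1) xy(2) p(2)[OF t'] z(2)] p(3)[OF t'] by simp
    then have pz: "d (p t) z < e (p t) / 3" using t by (simp add: dist_real_def)
    note T = p(1)[OF t'] act_closed[OF g(1) p(1)[OF t']] act_closed[OF g(1) z(1)] z(1)
    have "e (p t) \<le> d (p t) (\<phi> g (p t))" using e(2) T(1) g by blast
    also have "\<dots> \<le> d (p t) z + d z (\<phi> g z) + d (\<phi> g z) (\<phi> g (p t))"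
      using triangle[of "p t" z "\<phi> g (p t)"] triangle[of z "\<phi> g z" "\<phi> g (p t)"] T by simp
    also have "d (\<phi> g z) (\<phi> g (p t)) = d (p t) z" using g T by (simp add: act_dist commute)
    finally have "e (p t) / 3 \<le> d z (\<phi> g z)" using pz by simp
    moreover have "\<epsilon> \<le> e (p t) / 3" unfolding \<epsilon>_def using t A by (intro Min_le) auto
    ultimately show ?thesis by simp
  qed
  ultimately show ?thesis by blast
qed

text \<open>Conjugating \<open>g\<close> moves \<open>z\<close> onto one of the finitely many
  segments from \<open>v\<close> to its translate by a letter, without changing the
  displacement.\<close>

lemma uniformly_discrete:
  "\<exists>\<epsilon>>0. \<forall>z\<in>T. \<forall>g\<in>F. g \<noteq> one_F \<longrightarrow> \<epsilon> \<le> d z (\<phi> g z)"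
proof -
  have "\<exists>\<epsilon>>0. \<forall>z\<in>T. between d v z (\<phi> [s] v) \<longrightarrow> (\<forall>g\<in>F. g \<noteq> one_F \<longrightarrow> \<epsilon> \<le> d z (\<phi> g z))"
    if "[s] \<in> F" for s
    using that base by (intro segment_uniformly_discrete act_closed)
  then obtain e where e: "\<And>s. [s] \<in> F \<Longrightarrow> e s > 0"
    "\<And>s z g. [s] \<in> F \<Longrightarrow> z \<in> T \<Longrightarrow> between d v z (\<phi> [s] v) \<Longrightarrow> g \<in> F \<Longrightarrow> g \<noteq> one_F \<Longrightarrow> e s \<le> d z (\<phi> g z)"
    by metis
  define \<epsilon> where "\<epsilon> = Min (e ` {s. [s] \<in> F})"
  have "\<epsilon> > 0" unfolding \<epsilon>_def using finite_letters letter_in e(1) by (subst Min_gr_iff) auto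
  moreover have "\<epsilon> \<le> d z (\<phi> g z)" if z: "z \<in> T" and g: "g \<in> F" "g \<noteq> one_F" for z g
  proof -
    obtain h s where h: "h \<in> F" "[s] \<in> F" "between d (\<phi> h v) z (\<phi> (h \<cdot> [s]) v)"
      using orbit_segments[OF z] by blast
    let ?h' = "inv_F h"
    let ?z = "\<phi> ?h' z"
    let ?g = "?h' \<cdot> g \<cdot> h"
    have h': "?h' \<in> F" "?z \<in> T" using h z by (auto simp: act_closed)
    have z_eq: "\<phi> h ?z = z" using h z by (simp add: act_inv_right)
    have "between d (\<phi> h v) (\<phi> h ?z) (\<phi> h (\<phi> [s] v))"
      using h z base by (simp add: act_mult z_eq)
    then have "between d v ?z (\<phi> [s] v)"
      using h h' base by (subst (asm) act_between) (auto simp: act_closed)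
    moreover have "?g \<noteq> one_F"
    proof
      assume "?g = one_F"
      then have "h \<cdot> ?g \<cdot> ?h' = one_F" using h by simp
      moreover have "h \<cdot> ?g \<cdot> ?h' = g"
        using h g h' by (metis free_group.inv_closed free_group.inv_solve_left free_group.inv_solve_right' free_group.m_assoc free_group.m_closed)
      ultimately show False using g by simp
    qed
    ultimately have "e s \<le> d ?z (\<phi> ?g ?z)" using e(2) h h' g by simp
    also have "\<phi> ?g ?z = \<phi> ?h' (\<phi> g z)" using h h' g z by (simp add: act_mult act_closed z_eq)
    also have "d ?z \<dots> = d z (\<phi> g z)" using h' g z by (simp add: act_dist act_closed)
    finally have "e s \<le> d z (\<phi> g z)" .
    moreover have "\<epsilon> \<le> e s" unfolding \<epsilon>_def using h finite_letters by (intro Min_le) auto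
    ultimately show ?thesis by simp
  qed
  ultimately show ?thesis by blast
qed

lemma segment_net:
  assumes xy: "x \<in> T" "y \<in> T" and \<epsilon>: "\<epsilon> > 0"
  shows "\<exists>A. finite A \<and> A \<subseteq> T \<and> (\<forall>z\<in>T. between d x z y \<longrightarrow> (\<exists>a\<in>A. d z a \<le> \<epsilon>))"
proof -
  have "\<exists>z\<in>T. t \<in> {0..d x y} \<longrightarrow> between d x z y \<and> d x z = t" for t
    using point_on_segment[OF xy, of t] xy by (metis atLeastAtMost_iff)
  then obtain p where p: "\<And>t. p t \<in> T"
    "\<And>t. t \<in> {0..d x y} \<Longrightarrow> between d x (p t) y" "\<And>t. t \<in> {0..d x y} \<Longrightarrow> d x (p t) = t"
    by metis
  let ?A = "(\<lambda>i. p (real i * \<epsilon>)) ` {..nat \<lfloor>d x y / \<epsilon>\<rfloor>}"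
  have "\<exists>a\<in>?A. d z a \<le> \<epsilon>" if z: "z \<in> T" "between d x z y" for z
  proof -
    define i where "i = nat \<lfloor>d x z / \<epsilon>\<rfloor>"
    have "d x z / \<epsilon> \<ge> 0" using \<epsilon> by simp
    then have "real i \<le> d x z / \<epsilon>" "d x z / \<epsilon> < real i + 1" unfolding i_def by linarith+
    then have i: "real i * \<epsilon> \<le> d x z" "d x z < real i * \<epsilon> + \<epsilon>" using \<epsilon> by (auto simp: field_simps)
    have le: "d x z \<le> d x y" using z by (simp add: between_def)
    then have t: "real i * \<epsilon> \<in> {0..d x y}" using i \<epsilon> by auto
    have "i \<le> nat \<lfloor>d x y / \<epsilon>\<rfloor>" unfolding i_def using le \<epsilon>
      by (intro nat_mono floor_mono divide_right_mono) auto
    moreover have "d z (p (real i * \<epsilon>)) \<le> \<epsilon>"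
      using between_dist[OF xy(1) z(1) p(1) xy(2) z(2) p(2)[OF t]] p(3)[OF t] i by simp
    ultimately show ?thesis by blast
  qed
  then show ?thesis using p(1) by (intro exI[of _ ?A]) auto
qed

text \<open>Elements that move one point of \<open>K\<close> close to another are determined by nearby points of a
  finite net, since distinct elements of the group cannot move a point to nearly the same place.\<close>

lemma length_le_displacement:
  "\<exists>\<Lambda>>0. \<forall>g\<in>F. real (length g) \<le> \<Lambda> * (d v (\<phi> g v) + 1)"
proof -
  obtain \<epsilon>0 where \<epsilon>0: "\<epsilon>0 > 0" "\<And>z g. z \<in> T \<Longrightarrow> g \<in> F \<Longrightarrow> g \<noteq> one_F \<Longrightarrow> \<epsilon>0 \<le> d z (\<phi> g z)"
    using uniformly_discrete by blast
  \<comment> \<open>Two elements of the same \<open>W a b\<close> move \<open>b\<close> to points at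
    distance at most \<open>6 * \<epsilon>\<close>, which has to stay below \<epsilon>0.\<close>
  define \<epsilon> where "\<epsilon> = \<epsilon>0 / 7"
  have \<epsilon>: "\<epsilon> > 0" using \<epsilon>0 by (simp add: \<epsilon>_def)
  have "\<exists>A. finite A \<and> A \<subseteq> T \<and> (\<forall>z\<in>T. between d v z (\<phi> [s] v) \<longrightarrow> (\<exists>a\<in>A. d z a \<le> \<epsilon>))" if "[s] \<in> F" for s
    using that base \<epsilon> by (intro segment_net act_closed)
  then obtain A' where A': "\<And>s. [s] \<in> F \<Longrightarrow> finite (A' s)" "\<And>s. [s] \<in> F \<Longrightarrow> A' s \<subseteq> T"
    "\<And>s z. [s] \<in> F \<Longrightarrow> z \<in> T \<Longrightarrow> between d v z (\<phi> [s] v) \<Longrightarrow> \<exists>a\<in>A' s. d z a \<le> \<epsilon>" by metis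
  define K where "K = {z \<in> T. \<exists>s. [s] \<in> F \<and> between d v z (\<phi> [s] v)}"
  define A where "A = (\<Union>s\<in>{s. [s] \<in> F}. A' s)"
  have A: "finite A" "A \<subseteq> T" "\<And>z. z \<in> K \<Longrightarrow> \<exists>a\<in>A. d z a \<le> \<epsilon>"
  proof -
    show "finite A" unfolding A_def using finite_letters A'(1) by auto
    show "A \<subseteq> T" unfolding A_def using A'(2) by auto
    show "\<exists>a\<in>A. d z a \<le> \<epsilon>" if "z \<in> K" for z
      using that A'(3) unfolding A_def K_def by fast
  qed
  define W where "W a b = {g \<in> F. d a (\<phi> g b) \<le> 3 * \<epsilon>}" for a b
  have finW: "finite (W a b)" if "a \<in> T" "b \<in> T" for a b :: 't
  proof -
    have "g = h" if "g \<in> W a b" "h \<in> W a b" for g h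
    proof -
      have gh: "g \<in> F" "h \<in> F" "d a (\<phi> g b) \<le> 3 * \<epsilon>" "d a (\<phi> h b) \<le> 3 * \<epsilon>" using that by (auto simp: W_def)
      then have "d (\<phi> g b) (\<phi> h b) \<le> 6 * \<epsilon>"
        using triangle[of "\<phi> g b" a "\<phi> h b"] \<open>a \<in> T\<close> \<open>b \<in> T\<close> by (simp add: act_closed commute)
      then have "d b (\<phi> (inv_F g \<cdot> h) b) < \<epsilon>0"
        using gh \<open>b \<in> T\<close> \<epsilon>0(1) by (simp add: act_dist_inv[symmetric] \<epsilon>_def)
      then have "inv_F g \<cdot> h = one_F"
        using \<epsilon>0(2)[OF \<open>b \<in> T\<close>, of "inv_F g \<cdot> h"] gh by fastforce
      then show ?thesis using gh by (metis free_group.inv_closed free_group.inv_equality free_group.inv_inv)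
    qed
    then have uniq: "g = h" if "g \<in> W a b" "h \<in> W a b" for g h using that by blast
    show ?thesis
    proof (cases "W a b = {}")
      case False
      then obtain g where "g \<in> W a b" by blast
      then have "W a b \<subseteq> {g}" using uniq by blast
      then show ?thesis by (rule finite_subset) simp
    qed simp
  qed
  define Z where "Z = {g \<in> F. \<exists>k\<in>K. \<exists>k'\<in>K. d k (\<phi> g k') \<le> \<epsilon>}"
  have "Z \<subseteq> (\<Union>(a, b)\<in>A \<times> A. W a b)"
  proof
    fix g assume "g \<in> Z"
    then obtain k k' where k: "g \<in> F" "k \<in> K" "k' \<in> K" "d k (\<phi> g k') \<le> \<epsilon>" by (auto simp: Z_def)
    then obtain a b where ab: "a \<in> A" "b \<in> A" "d k a \<le> \<epsilon>" "d k' b \<le> \<epsilon>" using A(3) by meson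
    have T: "a \<in> T" "b \<in> T" "k \<in> T" "k' \<in> T" using ab k A by (auto simp: K_def)
    have "d a (\<phi> g b) \<le> d a k + d k (\<phi> g k') + d (\<phi> g k') (\<phi> g b)"
      using triangle[of a k "\<phi> g b"] triangle[of k "\<phi> g k'" "\<phi> g b"] T k(1) by (simp add: act_closed)
    also have "\<dots> \<le> 3 * \<epsilon>" using k ab T by (simp add: act_dist commute)
    finally show "g \<in> (\<Union>(a, b)\<in>A \<times> A. W a b)" using ab k by (auto simp: W_def)
  qed
  moreover have "finite (\<Union>(a, b)\<in>A \<times> A. W a b)" using A(1,2) finW by (intro finite_UN_I finite_cartesian_product) (auto dest: subsetD)
  ultimately have finZ: "finite Z" by (rule finite_subset)
  define B where "B = Max (insert 0 (length ` Z))"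
  have B: "length g \<le> B" if "g \<in> Z" for g unfolding B_def using finZ that by (intro Max_ge) auto
  have vK: "v \<in> K" using base letter_in by (auto simp: K_def between_def)
  have cover: "T \<subseteq> (\<Union>g\<in>F. \<phi> g ` K)"
  proof
    fix x assume x: "x \<in> T"
    obtain h s where h: "h \<in> F" "[s] \<in> F" "between d (\<phi> h v) x (\<phi> (h \<cdot> [s]) v)"
      using orbit_segments[OF x] by blast
    let ?z = "\<phi> (inv_F h) x"
    have z: "?z \<in> T" "\<phi> h ?z = x" using h x by (auto simp: act_closed act_inv_right)
    then have "between d (\<phi> h v) (\<phi> h ?z) (\<phi> h (\<phi> [s] v))" using h base by (simp add: act_mult)
    then have "between d v ?z (\<phi> [s] v)" using h z base by (subst (asm) act_between) (auto simp: act_closed)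
    then have "?z \<in> K" unfolding K_def using z h by blast
    then show "x \<in> (\<Union>g\<in>F. \<phi> g ` K)" using h z(2) by (metis UN_I imageI)
  qed
  have "real (length g) \<le> real B * (d v (\<phi> g v) / \<epsilon> + 2)" if "g \<in> F" for g
  proof (rule norm_le_displacement[where N = "\<lambda>g. real (length g)", OF act _ _ cover vK \<epsilon> _ _ _ that])
    show "geodesic_space T d" using rt by (simp add: real_tree_def)
    show "K \<subseteq> T" by (auto simp: K_def)
    show "real (length (g \<cdot> h)) \<le> real (length g) + real (length h)" for g h
      using length_foldr_cancel_Cons[of g h] by (simp add: mult_free_group)
    show "real (length g) \<le> real B" if "g \<in> F" "k \<in> K" "k' \<in> K" "d k (\<phi> g k') \<le> \<epsilon>" for g k k'
      using B[of g] that by (auto simp: Z_def)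
  qed simp
  moreover have "real B * (t / \<epsilon> + 2) \<le> (real B / \<epsilon> + 2 * real B + 1) * (t + 1)" if "t \<ge> 0" for t
  proof -
    have "0 \<le> real B / \<epsilon>" "0 \<le> real B * t" using that \<epsilon> by auto
    moreover have "real B * (t / \<epsilon> + 2) = real B / \<epsilon> * t + 2 * real B" by (simp add: algebra_simps)
    ultimately show ?thesis using that by (simp add: distrib_left distrib_right)
  qed
  ultimately have "\<forall>g\<in>F. real (length g) \<le> (real B / \<epsilon> + 2 * real B + 1) * (d v (\<phi> g v) + 1)"
    by (meson nonneg order_trans)
  moreover have "real B / \<epsilon> + 2 * real B + 1 > 0" using \<epsilon> by (simp add: add_nonneg_pos)
  ultimately show ?thesis by blast
qed

text \<open>Proper discontinuity in metric form: small displacement bounds the word length, and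
  there are only finitely many words of bounded length.\<close>

lemma finite_small_displacement:
  assumes "x \<in> T" "y \<in> T"
  shows "finite {g \<in> F. d x (\<phi> g y) \<le> R}"
proof -
  obtain \<Lambda> where \<Lambda>: "\<Lambda> > 0" "\<And>g. g \<in> F \<Longrightarrow> real (length g) \<le> \<Lambda> * (d v (\<phi> g v) + 1)"
    using length_le_displacement by blast
  define n where "n = nat \<lceil>\<Lambda> * (d v x + R + d y v + 1)\<rceil>"
  have "length g \<le> n" if g: "g \<in> F" "d x (\<phi> g y) \<le> R" for g
  proof -
    have "d v (\<phi> g v) \<le> d v x + d x (\<phi> g y) + d (\<phi> g y) (\<phi> g v)"
      using triangle[of v x "\<phi> g v"] triangle[of x "\<phi> g y" "\<phi> g v"] g assms base by (simp add: act_closed)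
    also have "\<dots> \<le> d v x + R + d y v" using g assms base by (simp add: act_dist)
    finally have "\<Lambda> * (d v (\<phi> g v) + 1) \<le> \<Lambda> * (d v x + R + d y v + 1)" using \<Lambda>(1) by simp
    then have "real (length g) \<le> \<Lambda> * (d v x + R + d y v + 1)" using \<Lambda>(2)[OF g(1)] by linarith
    then show ?thesis unfolding n_def by linarith
  qed
  then have "{g \<in> F. d x (\<phi> g y) \<le> R} \<subseteq> {w \<in> F. length w \<le> n}" by blast
  then show ?thesis using finite_bounded_words by (rule finite_subset)
qed

end


section \<open>Gromov products in the orbit versus common prefixes of words\<close>

context outer_space_tree
begin

lemma displacement_le_length: "g \<in> F \<Longrightarrow> d v (\<phi> g v) \<le> D * real (length g)"
proof (induction g)
  case Nil
  have "\<phi> [] v = v" using act_one[OF base] by (simp add: one_free_group)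
  then show ?case using base by simp
next
  case (Cons s g)
  note sg = Cons_in_free_group[OF Cons.prems]
  have T: "\<phi> g v \<in> T" "\<phi> [s] v \<in> T" using sg base act_closed by auto
  have "\<phi> (s # g) v = \<phi> [s] (\<phi> g v)" using act_mult[OF sg(1,2) base] sg(3) by simp
  then have "d v (\<phi> (s # g) v) \<le> d v (\<phi> [s] v) + d (\<phi> [s] v) (\<phi> [s] (\<phi> g v))"
    using triangle[of v "\<phi> [s] v" "\<phi> [s] (\<phi> g v)"] T base act_closed[OF sg(1) T(1)] by simp
  also have "\<dots> \<le> D + D * real (length g)"
    using dist_letter_le[OF sg(1)] Cons.IH[OF sg(2)] act_dist[OF sg(1) base T(1)] by simp
  finally show ?case by (simp add: algebra_simps)
qed

lemma finite_dist_translates: "finite {g \<in> F. d v (\<phi> g v) \<le> R}"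
  using finite_small_displacement[OF base base] .

text \<open>The value depends only on the quotient of \<open>g\<close> and \<open>h\<close>, which
  ranges over a finite set when the orbit points are close. This supplies hypothesis
  \<open>lip\<close> of \<open>gromov_product_lower_bound\<close>.\<close>

lemma bounded_on_close_pairs:
  fixes q :: "word \<Rightarrow> word \<Rightarrow> real"
  assumes "\<And>g h. g \<in> F \<Longrightarrow> h \<in> F \<Longrightarrow> q g h = N (inv_F g \<cdot> h)"
  shows "\<exists>B. \<forall>g\<in>F. \<forall>h\<in>F. d (\<phi> g v) (\<phi> h v) \<le> R \<longrightarrow> q g h \<le> B"
proof -
  define Z where "Z = {g \<in> F. d v (\<phi> g v) \<le> R}"
  have fin: "finite (N ` Z)" unfolding Z_def using finite_dist_translates by blast
  have "q g h \<le> Max (N ` Z)" if "g \<in> F" "h \<in> F" "d (\<phi> g v) (\<phi> h v) \<le> R" for g h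
  proof -
    have "inv_F g \<cdot> h \<in> Z"
      using that act_dist_inv[OF that(1,2) base base] by (simp add: Z_def)
    then show ?thesis using assms[OF that(1,2)] fin by (intro Max_ge) auto
  qed
  then show ?thesis by blast
qed

lemma prefix_dist_inv_mult:
  assumes "g \<in> F" "h \<in> F"
  shows "prefix_dist g h = real (length (inv_F g \<cdot> h))"
  using word_dist_eq[OF assms] by (simp add: word_dist_def)

text \<open>The group itself, based at the empty word, takes the place of the space
  \<open>Y\<close>. It is used contrapositively: bounded common prefixes force bounded products in
  the tree.\<close>

lemma common_prefix_lower_bound:
  "\<exists>\<kappa>>0. \<exists>C. \<forall>g\<in>F. \<forall>h\<in>F.
    \<kappa> * gromov_product d v (\<phi> g v) (\<phi> h v) - C \<le> real (common_prefix g h)"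
proof -
  obtain B where B: "\<forall>g\<in>F. \<forall>h\<in>F. d (\<phi> g v) (\<phi> h v) \<le> 2 * D + 1 \<longrightarrow> prefix_dist g h \<le> B"
    using bounded_on_close_pairs[of prefix_dist "\<lambda>g. real (length g)" "2 * D + 1"] prefix_dist_inv_mult by blast
  have "\<exists>\<kappa>>0. \<exists>C. \<forall>g\<in>F. \<forall>h\<in>F.
      \<kappa> * gromov_product d v (\<phi> g v) (\<phi> h v) - C \<le> gromov_product prefix_dist [] (id g) (id h)"
  proof (rule gromov_product_lower_bound[where D = D and B = B and \<Lambda> = "D + 1"])
    show "gromov_space F prefix_dist 0" by (rule gromov_space_prefix_dist)
    show "[] \<in> F" by (simp add: carrier_free_group reduced_def)
    show "(\<lambda>g. \<phi> g v) ` F \<subseteq> T" using act_closed base by blast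
    show "\<exists>g\<in>F. d x (\<phi> g v) \<le> D" if "x \<in> T" for x using orbit_dense[OF that] .
    show "prefix_dist (id g) (id h) \<le> B" if "g \<in> F" "h \<in> F" "d (\<phi> g v) (\<phi> h v) \<le> 2 * D + 1" for g h
      using B that by simp
    show "D + 1 > 0" using D_nonneg by simp
    show "d v (\<phi> g v) \<le> (D + 1) * (prefix_dist [] (id g) + 1)" if "g \<in> F" for g
    proof -
      have "prefix_dist [] g = real (length g)" by (simp add: prefix_dist_def)
      then show ?thesis using displacement_le_length[OF that] D_nonneg by (simp add: algebra_simps)
    qed
  qed (use base in auto)
  then show ?thesis by (simp add: gromov_product_prefix_dist)
qed

text \<open>The prefixes of \<open>g\<close> of length at least \<open>m\<close> give a chain in the
  orbit that recedes from \<open>v\<close> at linear speed by \<open>length_le_displacement\<close>.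
  Two words with common prefix of length \<open>m\<close> have chains with the same start, joined
  there by hyperbolicity.\<close>

lemma gromov_product_ge_common_prefix:
  "\<exists>\<kappa>>0. \<exists>C. \<forall>g\<in>F. \<forall>h\<in>F.
    \<kappa> * real (common_prefix g h) - C \<le> gromov_product d v (\<phi> g v) (\<phi> h v)"
proof -
  obtain \<Lambda> where \<Lambda>: "\<Lambda> > 0" "\<And>g. g \<in> F \<Longrightarrow> real (length g) \<le> \<Lambda> * (d v (\<phi> g v) + 1)"
    using length_le_displacement by blast
  define c where "c = 1 / \<Lambda>"
  have c: "c > 0" using \<Lambda> by (simp add: c_def)
  obtain C' where C': "\<And>N y m. (\<forall>i\<le>N. y i \<in> T) \<Longrightarrow> (\<forall>i<N. d (y i) (y (Suc i)) \<le> D)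
    \<Longrightarrow> (\<forall>i\<le>N. c * (m + real i) - 1 \<le> d v (y i)) \<Longrightarrow> c * m - C' \<le> gromov_product d v (y 0) (y N)"
    using gromov_product_chain[OF base c, of D 1] by blast
  have half: "c * real m - C' \<le> gromov_product d v (\<phi> (take m g) v) (\<phi> g v)"
    if g: "g \<in> F" "m \<le> length g" for g m
  proof -
    let ?y = "\<lambda>i. \<phi> (take (m + i) g) v"
    have t: "take k g \<in> F" for k using g by (intro take_in_free_group)
    have "c * real m - C' \<le> gromov_product d v (?y 0) (?y (length g - m))"
    proof (rule C'; intro allI impI)
      show "?y i \<in> T" for i using t base by (intro act_closed)
      fix i assume i: "i < length g - m"
      let ?k = "m + i"
      have k: "?k < length g" using i by simp
      have take: "take (Suc ?k) g = take ?k g @ [g ! ?k]" using k by (rule take_Suc_conv_app_nth)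
      have "[g ! ?k] \<in> F" using t[of "Suc ?k"] k
        by (auto simp: carrier_free_group reduced_def take)
      moreover have "take (Suc ?k) g = take ?k g \<cdot> [g ! ?k]"
        using reduced_append_foldr[of "take ?k g" "[g ! ?k]"] t[of "Suc ?k"]
        by (simp add: mult_free_group take carrier_free_group)
      ultimately have "?y (Suc i) = \<phi> (take ?k g) (\<phi> [g ! ?k] v)" "[g ! ?k] \<in> F"
        using act_mult[OF t _ base] by auto
      then show "d (?y i) (?y (Suc i)) \<le> D"
        using dist_letter_le act_dist[OF t base act_closed[OF _ base]] by simp
    next
      fix i assume i: "i \<le> length g - m"
      then have "real (length (take (m + i) g)) = real m + real i" using g by simp
      then have "real m + real i \<le> \<Lambda> * (d v (?y i) + 1)" using \<Lambda>(2)[OF t[of "m + i"]] by simp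
      then show "c * (real m + real i) - 1 \<le> d v (?y i)" using \<Lambda>(1) by (simp add: c_def field_simps)
    qed
    then show ?thesis using g by simp
  qed
  have "c * real (common_prefix g h) - C' \<le> gromov_product d v (\<phi> g v) (\<phi> h v)"
    if g: "g \<in> F" and h: "h \<in> F" for g h
  proof -
    let ?m = "common_prefix g h"
    have m: "?m \<le> length g" "?m \<le> length h" "take ?m g = take ?m h"
      using common_prefix_ge_iff[of ?m g h] by auto
    have T: "\<phi> g v \<in> T" "\<phi> h v \<in> T" "\<phi> (take ?m g) v \<in> T"
      using g h base take_in_free_group act_closed by auto
    have "c * real ?m - C' \<le> gromov_product d v (\<phi> (take ?m g) v) (\<phi> h v)"
      using half[OF h m(2)] m(3) by simp
    then show ?thesis
      using half[OF g m(1)] gromov_product_min[OF base T(1,3,2)] gromov_product_commute[OF T(1,3)]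
      by (auto simp: min_def split: if_splits)
  qed
  then show ?thesis using c by blast
qed

subsection \<open>Branch points\<close>

lemma replicate_in_free_group: "i < r \<Longrightarrow> replicate n (i, b) \<in> F"
  by (induction n) (auto simp: carrier_free_group reduced_def successively_Cons inv_letter_def)

text \<open>Three orbit points that are far away from \<open>v\<close> in different directions span a tripod.\<close>

lemma branch_point_exists: "branch_points T d \<noteq> {}"
proof -
  obtain \<kappa> C where \<kappa>: "\<kappa> > 0" "\<And>g h. g \<in> F \<Longrightarrow> h \<in> F \<Longrightarrow>
    \<kappa> * gromov_product d v (\<phi> g v) (\<phi> h v) - C \<le> real (common_prefix g h)"
    using common_prefix_lower_bound by blast
  obtain \<Lambda> where \<Lambda>: "\<Lambda> > 0" "\<And>g. g \<in> F \<Longrightarrow> real (length g) \<le> \<Lambda> * (d v (\<phi> g v) + 1)"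
    using length_le_displacement by blast
  \<comment> \<open>Chosen so that words of length \<open>n\<close> move \<open>v\<close> farther
    than \<open>C / \<kappa>\<close>, the bound on products of words without common first
    letter.\<close>
  define n where "n = Suc (nat \<lceil>\<Lambda> * (C / \<kappa> + 1)\<rceil>)"
  have n: "real n > \<Lambda> * (C / \<kappa> + 1)" unfolding n_def by linarith
  have far: "d v (\<phi> g v) > C / \<kappa>" if "g \<in> F" "length g = n" for g
  proof -
    have "\<Lambda> * (C / \<kappa> + 1) < \<Lambda> * (d v (\<phi> g v) + 1)" using \<Lambda>(2)[OF that(1)] that(2) n by simp
    then show ?thesis using \<Lambda>(1) by simp
  qed
  define A where "A = {replicate n (0 :: nat, True), replicate n (1 :: nat, True), replicate n (0 :: nat, False)}"
  have AF: "A \<subseteq> F" unfolding A_def using rank replicate_in_free_group by auto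
  have lenA: "length g = n" if "g \<in> A" for g using that by (auto simp: A_def)
  have close: "gromov_product d v (\<phi> g v) (\<phi> h v) \<le> C / \<kappa>" if "g \<in> A" "h \<in> A" "g \<noteq> h" for g h
  proof -
    have "common_prefix g h = 0" using that by (auto simp: A_def n_def)
    then have "\<kappa> * gromov_product d v (\<phi> g v) (\<phi> h v) \<le> C" using \<kappa>(2)[of g h] that AF by auto
    then show ?thesis using \<kappa>(1) by (simp add: field_simps)
  qed
  \<comment> \<open>If one of the three points lay between the other two, it would lie on the way
    from \<open>v\<close> to one of them, and their product at \<open>v\<close> would be its full
    distance from \<open>v\<close>.\<close>
  have not_between: "\<not> between d (\<phi> h v) (\<phi> g v) (\<phi> k v)"
    if "g \<in> A" "h \<in> A" "k \<in> A" "g \<noteq> h" "g \<noteq> k" for g h k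
  proof
    assume *: "between d (\<phi> h v) (\<phi> g v) (\<phi> k v)"
    have T: "\<phi> g v \<in> T" "\<phi> h v \<in> T" "\<phi> k v \<in> T" using that AF base act_closed by auto
    have "between d v (\<phi> g v) (\<phi> h v) \<or> between d v (\<phi> g v) (\<phi> k v)"
      using * T base by (intro between_split) auto
    then have "d v (\<phi> g v) \<le> C / \<kappa>"
      using close[OF that(1,2,4)] close[OF that(1,3,5)] gromov_product_between[OF base] T by fastforce
    then show False using far[of g] lenA that AF by force
  qed
  let ?a = "replicate n (0 :: nat, True)" and ?b = "replicate n (1 :: nat, True)" and ?c = "replicate n (0 :: nat, False)"
  have abc: "?a \<in> A" "?b \<in> A" "?c \<in> A" by (auto simp: A_def)
  have ne: "?a \<noteq> ?b" "?a \<noteq> ?c" "?b \<noteq> ?c" by (auto simp: n_def)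
  have T: "\<phi> ?a v \<in> T" "\<phi> ?b v \<in> T" "\<phi> ?c v \<in> T" using abc AF base act_closed by auto
  obtain m where m: "m \<in> T" "between d (\<phi> ?a v) m (\<phi> ?b v)" "between d (\<phi> ?b v) m (\<phi> ?c v)"
    "between d (\<phi> ?a v) m (\<phi> ?c v)" using median[OF T] .
  have "m \<noteq> \<phi> ?a v" using not_between[OF abc(1,2,3) ne(1,2)] m(3) by blast
  moreover have "m \<noteq> \<phi> ?b v" using not_between[OF abc(2,1,3) ne(1)[symmetric] ne(3)] m(4) by blast
  moreover have "m \<noteq> \<phi> ?c v"
    using not_between[OF abc(3,1,2) ne(2)[symmetric] ne(3)[symmetric]] m(2) by blast
  ultimately have "m \<in> branch_points T d"
    using median_branch_point[OF m(1) T m(2,3,4)] by blast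
  then show ?thesis by blast
qed

lemma branch_point_in: "b \<in> branch_points T d \<Longrightarrow> b \<in> T"
  by (simp add: branch_points_def)

lemma act_branch_point:
  assumes g: "g \<in> F" and b: "b \<in> branch_points T d"
  shows "\<phi> g b \<in> branch_points T d"
proof -
  obtain y1 y2 y3 where y: "y1 \<in> T - {b}" "y2 \<in> T - {b}" "y3 \<in> T - {b}" "b \<in> T"
    "between d y1 b y2" "between d y2 b y3" "between d y1 b y3"
    using b by (auto simp: branch_points_def)
  have "\<phi> g y \<in> T" "\<phi> g y \<noteq> \<phi> g b" if "y \<in> T - {b}" for y
    using that y g act_closed act_inj by blast+
  moreover have "between d (\<phi> g y1) (\<phi> g b) (\<phi> g y2)" "between d (\<phi> g y2) (\<phi> g b) (\<phi> g y3)"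
    "between d (\<phi> g y1) (\<phi> g b) (\<phi> g y3)"
    using y g by (auto simp: act_between)
  ultimately show ?thesis using y act_closed[OF g] unfolding branch_points_def by blast
qed

definition D_branch where "D_branch = (SOME R. \<forall>x\<in>T. \<exists>b\<in>branch_points T d. d x b \<le> R)"

text \<open>The translates of a single branch point are as dense as the orbit of \<open>v\<close>,
  up to a constant; so the choice in \<open>D_branch\<close> is meaningful.\<close>

lemma branch_points_dense: "x \<in> T \<Longrightarrow> \<exists>b\<in>branch_points T d. d x b \<le> D_branch"
proof -
  obtain b where b: "b \<in> branch_points T d" using branch_point_exists by blast
  have "\<exists>b'\<in>branch_points T d. d x b' \<le> D + d v b" if x: "x \<in> T" for x
  proof -
    obtain g where g: "g \<in> F" "d x (\<phi> g v) \<le> D" using orbit_dense[OF x] by blast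
    have "d x (\<phi> g b) \<le> d x (\<phi> g v) + d (\<phi> g v) (\<phi> g b)"
      using triangle[of x "\<phi> g v" "\<phi> g b"] x g base branch_point_in[OF b] act_closed by blast
    also have "\<dots> \<le> D + d v b" using g act_dist[OF g(1) base branch_point_in[OF b]] by simp
    finally show ?thesis using act_branch_point[OF g(1) b] by blast
  qed
  then have "\<exists>R. \<forall>x\<in>T. \<exists>b\<in>branch_points T d. d x b \<le> R" by blast
  then have "\<forall>x\<in>T. \<exists>b\<in>branch_points T d. d x b \<le> D_branch" unfolding D_branch_def by (rule someI_ex)
  then show "x \<in> T \<Longrightarrow> \<exists>b\<in>branch_points T d. d x b \<le> D_branch" by blast
qed

text \<open>The point \<open>z\<close>, at distance at most 1 from \<open>b\<close>, witnesses that
  \<open>y\<close> and the orbit point lie in the same direction at \<open>b\<close>. The bound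
  \<open>D + 1\<close> does not depend on how far or how near \<open>y\<close> is.\<close>

lemma direction_orbit_point:
  assumes "b \<in> T" "y \<in> T" "y \<noteq> b"
  shows "\<exists>g\<in>F. \<exists>z\<in>T. z \<noteq> b \<and> between d b z y \<and> between d b z (\<phi> g v) \<and> d b (\<phi> g v) \<le> D + 1"
proof -
  have pos: "d b y > 0" using assms nonneg[of b y] zero[of b y] by force
  obtain z where z: "z \<in> T" "between d b z y" "d b z = min 1 (d b y)"
    using point_on_segment[OF assms(1,2), of "min 1 (d b y)"] pos by auto
  obtain g where g: "g \<in> F" "between d b z (\<phi> g v)" "d z (\<phi> g v) \<le> D"
    using orbit_beyond[OF assms(1) z(1)] by blast
  have "z \<noteq> b" using z pos assms(1) by auto
  moreover have "d b (\<phi> g v) \<le> D + 1" using g z by (simp add: between_def)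
  ultimately show ?thesis using g z by blast
qed

text \<open>Whether \<open>b\<close> separates two points depends only on their directions at
  \<open>b\<close>; \<open>z\<close> shows that \<open>x\<close> and \<open>y\<close> have the same
  direction.\<close>

lemma between_mid:
  assumes "x \<in> T" "x' \<in> T" "b \<in> T" "y \<in> T" "y' \<in> T" "z \<in> T" "z \<noteq> b"
    "between d b z y" "between d b z x" "between d y b y'"
  shows "between d x b y'"
proof -
  have "between d z b y'" using assms triangle[of z b y'] triangle[of y z y']
    by (auto simp: between_def commute)
  moreover have pos: "d b z > 0" using assms(3,6,7) nonneg[of b z] zero[of b z] by fastforce
  moreover have "d b x + d z y' \<le> max (d b z + d x y') (d b y' + d z x)"
    using assms by (intro four_point)
  moreover have "d x y' \<le> d x b + d b y'" using assms by (intro triangle)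
  ultimately show ?thesis
    using assms(9) commute[of x b] commute[of z b] commute[of x z] unfolding between_def by linarith
qed

definition medians where "medians x y z = {m \<in> T. between d x m y \<and> between d y m z \<and> between d x m z}"

lemma finite_medians:
  assumes "x \<in> T" "y \<in> T" "z \<in> T"
  shows "finite (medians x y z)"
proof -
  have "m = m'" if "m \<in> medians x y z" "m' \<in> medians x y z" for m m'
  proof (rule between_unique[of x m m' y])
    show "d x m = d x m'" using that by (auto simp: medians_def between_def commute)
  qed (use that assms in \<open>auto simp: medians_def\<close>)
  then have uniq: "m = m'" if "m \<in> medians x y z" "m' \<in> medians x y z" for m m' using that by blast
  show ?thesis
  proof (cases "medians x y z = {}")
    case False
    then obtain m where "m \<in> medians x y z" by blast
    then have "medians x y z \<subseteq> {m}" using uniq by blast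
    then show ?thesis by (rule finite_subset) simp
  qed simp
qed

text \<open>Three directions at a branch point contain orbit points at distance at most
  \<open>D + 1\<close>, and the branch point is the median of these. Once the first one has been
  translated to \<open>v\<close>, only finitely many choices remain for the other two.\<close>

lemma finite_branch_orbits:
  "\<exists>B. finite B \<and> B \<subseteq> branch_points T d \<and> (\<forall>b\<in>branch_points T d. \<exists>g\<in>F. \<exists>b'\<in>B. b = \<phi> g b')"
proof -
  define Z where "Z = {g \<in> F. d v (\<phi> g v) \<le> 2 * (D + 1)}"
  define B where "B = (\<Union>(g, h)\<in>Z \<times> Z. medians v (\<phi> g v) (\<phi> h v)) \<inter> branch_points T d"
  have finZ: "finite Z" unfolding Z_def by (rule finite_dist_translates)
  have "finite (\<Union>(g, h)\<in>Z \<times> Z. medians v (\<phi> g v) (\<phi> h v))"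
  proof (rule finite_UN_I)
    show "finite (case p of (g, h) \<Rightarrow> medians v (\<phi> g v) (\<phi> h v))" if "p \<in> Z \<times> Z" for p
      using that base act_closed by (auto simp: Z_def intro!: finite_medians)
  qed (use finZ in simp)
  then have "finite B" unfolding B_def by blast
  moreover have "\<exists>g\<in>F. \<exists>b'\<in>B. b = \<phi> g b'" if b: "b \<in> branch_points T d" for b
  proof -
    obtain y1 y2 y3 where y: "y1 \<in> T" "y1 \<noteq> b" "y2 \<in> T" "y2 \<noteq> b" "y3 \<in> T" "y3 \<noteq> b" and bT: "b \<in> T"
      and btw: "between d y1 b y2" "between d y2 b y3" "between d y1 b y3"
      using b by (auto simp: branch_points_def)
    obtain g1 z1 where 1: "g1 \<in> F" "z1 \<in> T" "z1 \<noteq> b" "between d b z1 y1" "between d b z1 (\<phi> g1 v)" "d b (\<phi> g1 v) \<le> D + 1"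
      using direction_orbit_point[OF bT y(1,2)] by blast
    obtain g2 z2 where 2: "g2 \<in> F" "z2 \<in> T" "z2 \<noteq> b" "between d b z2 y2" "between d b z2 (\<phi> g2 v)" "d b (\<phi> g2 v) \<le> D + 1"
      using direction_orbit_point[OF bT y(3,4)] by blast
    obtain g3 z3 where 3: "g3 \<in> F" "z3 \<in> T" "z3 \<noteq> b" "between d b z3 y3" "between d b z3 (\<phi> g3 v)" "d b (\<phi> g3 v) \<le> D + 1"
      using direction_orbit_point[OF bT y(5,6)] by blast
    note x = act_closed[OF 1(1) base] act_closed[OF 2(1) base] act_closed[OF 3(1) base]
    have swap: "between d y b y' \<Longrightarrow> y \<in> T \<Longrightarrow> y' \<in> T \<Longrightarrow> between d y' b y" for y y'
      using between_sym bT by blast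
    have *: "between d (\<phi> g1 v) b (\<phi> g2 v)" "between d (\<phi> g2 v) b (\<phi> g3 v)" "between d (\<phi> g1 v) b (\<phi> g3 v)"
    proof -
      have "between d (\<phi> g1 v) b y2" using between_mid[OF x(1,1) bT y(1,3) 1(2,3,4,5) btw(1)] .
      then show "between d (\<phi> g1 v) b (\<phi> g2 v)"
        using between_mid[OF x(2,2) bT y(3) x(1) 2(2,3,4,5)] swap x y by blast
      have "between d (\<phi> g2 v) b y3" using between_mid[OF x(2,2) bT y(3,5) 2(2,3,4,5) btw(2)] .
      then show "between d (\<phi> g2 v) b (\<phi> g3 v)"
        using between_mid[OF x(3,3) bT y(5) x(2) 3(2,3,4,5)] swap x y by blast
      have "between d (\<phi> g1 v) b y3" using between_mid[OF x(1,1) bT y(1,5) 1(2,3,4,5) btw(3)] .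
      then show "between d (\<phi> g1 v) b (\<phi> g3 v)"
        using between_mid[OF x(3,3) bT y(5) x(1) 3(2,3,4,5)] swap x y by blast
    qed
    let ?i = "inv_F g1"
    let ?b = "\<phi> ?i b"
    have i: "?i \<in> F" using 1 by simp
    have Z: "?i \<cdot> g \<in> Z" if "g \<in> F" "d b (\<phi> g v) \<le> D + 1" for g
    proof -
      have "d (\<phi> g1 v) (\<phi> g v) \<le> 2 * (D + 1)"
        using triangle[of "\<phi> g1 v" b "\<phi> g v"] act_closed[OF that(1) base] x bT 1(6) that(2) by (simp add: commute)
      then show ?thesis using act_dist_inv[OF 1(1) that(1) base base] 1(1) that by (simp add: Z_def)
    qed
    have tr: "between d (\<phi> (?i \<cdot> g) v) ?b (\<phi> (?i \<cdot> h) v)"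
      if "g \<in> F" "h \<in> F" "between d (\<phi> g v) b (\<phi> h v)" for g h
      using that i bT base by (simp add: act_mult act_between act_closed)
    have "\<phi> (?i \<cdot> g1) v = v" using 1 base by (simp add: act_one)
    then have "?b \<in> medians v (\<phi> (?i \<cdot> g2) v) (\<phi> (?i \<cdot> g3) v)"
      using tr[OF 1(1) 2(1) *(1)] tr[OF 2(1) 3(1) *(2)] tr[OF 1(1) 3(1) *(3)] act_closed[OF i bT]
      by (simp add: medians_def)
    then have "?b \<in> B" unfolding B_def using Z[OF 2(1,6)] Z[OF 3(1,6)] act_branch_point[OF i b] by blast
    moreover have "b = \<phi> g1 ?b" using 1 bT by (simp add: act_inv_right)
    ultimately show ?thesis using 1(1) by blast
  qed
  moreover have "B \<subseteq> branch_points T d" by (simp add: B_def)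
  ultimately show ?thesis by blast
qed

lemma countable_branch_points: "countable (branch_points T d)"
proof -
  obtain B where B: "finite B" "\<forall>b\<in>branch_points T d. \<exists>g\<in>F. \<exists>b'\<in>B. b = \<phi> g b'"
    using finite_branch_orbits by blast
  have "branch_points T d \<subseteq> (\<lambda>(g, b). \<phi> g b) ` (F \<times> B)"
  proof
    fix b assume "b \<in> branch_points T d"
    then obtain g b' where "g \<in> F" "b' \<in> B" "b = \<phi> g b'" using B(2) by blast
    then show "b \<in> (\<lambda>(g, b). \<phi> g b) ` (F \<times> B)" by (intro image_eqI[of _ _ "(g, b')"]) auto
  qed
  moreover have "countable (F \<times> B)"
    using B(1) by (intro countable_SIGMA) (auto intro: countable_finite countableI_type)
  ultimately show ?thesis by (meson countable_image countable_subset)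
qed

lemma finite_near_branch_points:
  assumes "x \<in> T"
  shows "finite {b \<in> branch_points T d. d x b \<le> R}"
proof -
  obtain B where B: "finite B" "B \<subseteq> branch_points T d" "\<forall>b\<in>branch_points T d. \<exists>g\<in>F. \<exists>b'\<in>B. b = \<phi> g b'"
    using finite_branch_orbits by blast
  have "{b \<in> branch_points T d. d x b \<le> R} \<subseteq> (\<Union>b'\<in>B. (\<lambda>g. \<phi> g b') ` {g \<in> F. d x (\<phi> g b') \<le> R})"
  proof
    fix b assume b: "b \<in> {b \<in> branch_points T d. d x b \<le> R}"
    then obtain g b' where "g \<in> F" "b' \<in> B" "b = \<phi> g b'" using B(3) by blast
    then show "b \<in> (\<Union>b'\<in>B. (\<lambda>g. \<phi> g b') ` {g \<in> F. d x (\<phi> g b') \<le> R})" using b by blast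
  qed
  moreover have "finite (\<Union>b'\<in>B. (\<lambda>g. \<phi> g b') ` {g \<in> F. d x (\<phi> g b') \<le> R})"
    using B(1,2) assms branch_point_in
    by (intro finite_UN_I finite_imageI finite_small_displacement) auto
  ultimately show ?thesis by (rule finite_subset)
qed

text \<open>After a translation one of the points lies in a finite set, and only finitely many
  branch points are within distance 1 of that set.\<close>

lemma branch_points_separated:
  "\<exists>\<epsilon>>0. \<forall>b\<in>branch_points T d. \<forall>b'\<in>branch_points T d. b \<noteq> b' \<longrightarrow> \<epsilon> \<le> d b b'"
proof -
  obtain B where B: "finite B" "B \<subseteq> branch_points T d" "\<forall>b\<in>branch_points T d. \<exists>g\<in>F. \<exists>b'\<in>B. b = \<phi> g b'"
    using finite_branch_orbits by blast
  define Q where "Q = (\<Union>b\<in>B. d b ` ({b' \<in> branch_points T d. d b b' \<le> 1} - {b}))"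
  have "finite Q" unfolding Q_def
    using B(1,2) branch_point_in by (intro finite_UN_I finite_imageI finite_Diff finite_near_branch_points) auto
  define \<epsilon> where "\<epsilon> = Min (insert 1 Q)"
  have Qpos: "q > 0" if q: "q \<in> Q" for q
  proof -
    obtain b b' where b: "b \<in> B" "b' \<in> branch_points T d" "b' \<noteq> b" "q = d b b'"
      using q unfolding Q_def by blast
    then have "b \<in> T" "b' \<in> T" using B(2) branch_point_in by auto
    then show ?thesis using b nonneg[of b b'] zero[of b b'] by fastforce
  qed
  have "\<epsilon> > 0" unfolding \<epsilon>_def using \<open>finite Q\<close> Qpos by (subst Min_gr_iff) auto
  moreover have "\<epsilon> \<le> d b b'" if b: "b \<in> branch_points T d" "b' \<in> branch_points T d" "b \<noteq> b'" for b b'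
  proof -
    obtain g b0 where g: "g \<in> F" "b0 \<in> B" "b = \<phi> g b0" using B(3) b by blast
    let ?i = "inv_F g"
    have i: "?i \<in> F" using g by simp
    have b0: "\<phi> ?i b = b0" "b0 \<in> T" using g B(2) branch_point_in by (auto simp: act_inv_left)
    let ?b' = "\<phi> ?i b'"
    have b': "?b' \<in> branch_points T d" "d b0 ?b' = d b b'" "?b' \<noteq> b0"
      using act_branch_point[OF i b(2)] act_dist[OF i branch_point_in[OF b(1)] branch_point_in[OF b(2)]]
        act_inj[OF i branch_point_in[OF b(1)] branch_point_in[OF b(2)]] b(3) b0(1) by auto
    show ?thesis
    proof (cases "d b b' \<le> 1")
      case True
      have "d b0 ?b' \<in> Q"
        unfolding Q_def using b' g(2) True by (intro UN_I[of b0] imageI) auto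
      then have "d b b' \<in> Q" using b'(2) by simp
      then show ?thesis unfolding \<epsilon>_def using \<open>finite Q\<close> by (intro Min_le) auto
    next
      case False
      have "\<epsilon> \<le> 1" unfolding \<epsilon>_def using \<open>finite Q\<close> by (intro Min_le) auto
      then show ?thesis using False by simp
    qed
  qed
  ultimately show ?thesis by blast
qed

end


context outer_space_tree
begin

subsection \<open>Edges\<close>

lemma tree_edgeD:
  assumes "(u, w) \<in> tree_edges T d"
  shows "u \<in> branch_points T d" "w \<in> branch_points T d" "u \<noteq> w" "u \<in> T" "w \<in> T"
    "\<And>m. m \<in> branch_points T d \<Longrightarrow> between d u m w \<Longrightarrow> m = u \<or> m = w"
  using assms branch_point_in by (auto simp: tree_edges_def)

text \<open>Both edges start in the direction of \<open>x\<close>, so they share an initial piece.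
  The median of \<open>u\<close>, \<open>w\<close>, \<open>w'\<close> then differs from
  \<open>u\<close>; if it were neither \<open>w\<close> nor \<open>w'\<close>, it would be a branch
  point in the interior of an edge.\<close>

lemma edges_same_direction:
  assumes e: "(u, w) \<in> tree_edges T d" "(u, w') \<in> tree_edges T d"
    and x: "x \<in> T" and z: "z \<in> T" "z \<noteq> u" "between d u z w" "between d u z x"
    and z': "z' \<in> T" "z' \<noteq> u" "between d u z' w'" "between d u z' x"
  shows "w = w'"
proof -
  note w = tree_edgeD[OF e(1)] and w' = tree_edgeD[OF e(2)]
  have pos: "d u z > 0" "d u z' > 0"
    using z z' w(4) by (metis nonneg zero less_le)+
  obtain m where m: "m \<in> T" "between d u m w" "between d w m w'" "between d u m w'"
    using median[OF w(4,5) w'(5)] .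
  have "gromov_product d u z x = d u z" "gromov_product d u z' x = d u z'"
    "gromov_product d u z w = d u z" "gromov_product d u z' w' = d u z'"
    using gromov_product_between w(4,5) w'(5) x z z' by blast+
  then have "gromov_product d u w w' > 0"
    using gromov_product_min[OF w(4) z(1) x z'(1)] gromov_product_min[OF w(4,5) z(1) z'(1)]
      gromov_product_min[OF w(4,5) z'(1) w'(5)] pos
      gromov_product_commute[OF z(1) w(5), of u] gromov_product_commute[OF x z'(1), of u]
    by (auto simp: min_def split: if_splits)
  moreover have "gromov_product d u w w' = d u m"
    using m w(4,5) w'(5) by (simp add: gromov_product_def between_def commute)
  ultimately have "m \<noteq> u" using w(4) by auto
  show ?thesis
  proof (cases "m = w \<or> m = w'")
    case True
    then show ?thesis using m(2,4) w(2,3,6) w'(2,3,6) by blast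
  next
    case False
    then have "m \<in> branch_points T d"
      using median_branch_point[OF m(1) w(4,5) w'(5) m(2,3,4)] \<open>m \<noteq> u\<close> by blast
    then show ?thesis using w(6) m(2) \<open>m \<noteq> u\<close> False by blast
  qed
qed

text \<open>Different edges at \<open>u\<close> have different directions, each of which is
  represented by one of finitely many orbit points.\<close>

lemma finite_edges_at: "finite {w. (u, w) \<in> tree_edges T d}"
proof (cases "u \<in> T")
  case u: True
  define Z where "Z = {g \<in> F. d u (\<phi> g v) \<le> D + 1}"
  have "\<exists>g z. g \<in> F \<and> z \<in> T \<and> z \<noteq> u \<and> between d u z w \<and> between d u z (\<phi> g v) \<and> d u (\<phi> g v) \<le> D + 1"
    if "(u, w) \<in> tree_edges T d" for w
    using direction_orbit_point[OF u, of w] tree_edgeD[OF that] by metis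
  then obtain g z where gz: "\<And>w. (u, w) \<in> tree_edges T d \<Longrightarrow> g w \<in> F \<and> z w \<in> T \<and> z w \<noteq> u \<and>
    between d u (z w) w \<and> between d u (z w) (\<phi> (g w) v) \<and> d u (\<phi> (g w) v) \<le> D + 1" by metis
  have "inj_on g {w. (u, w) \<in> tree_edges T d}"
  proof (rule inj_onI)
    fix w w' assume w: "w \<in> {w. (u, w) \<in> tree_edges T d}" "w' \<in> {w. (u, w) \<in> tree_edges T d}" "g w = g w'"
    then show "w = w'"
      using edges_same_direction[of u w w' "\<phi> (g w) v" "z w" "z w'"] gz[of w] gz[of w'] act_closed base by auto
  qed
  moreover have "g ` {w. (u, w) \<in> tree_edges T d} \<subseteq> Z" using gz by (auto simp: Z_def)
  moreover have "finite Z" unfolding Z_def using finite_small_displacement[OF u base] .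
  ultimately show ?thesis by (metis inj_on_finite)
next
  case False
  then have "{w. (u, w) \<in> tree_edges T d} = {}" using tree_edgeD(4) by blast
  then show ?thesis by simp
qed

lemma act_tree_edge:
  assumes g: "g \<in> F" and e: "(u, w) \<in> tree_edges T d"
  shows "(\<phi> g u, \<phi> g w) \<in> tree_edges T d"
proof -
  note uw = tree_edgeD[OF e]
  let ?i = "inv_F g"
  have i: "?i \<in> F" using g by simp
  have "m = \<phi> g u \<or> m = \<phi> g w" if m: "m \<in> branch_points T d" "between d (\<phi> g u) m (\<phi> g w)" for m
  proof -
    have mT: "m \<in> T" by (rule branch_point_in[OF m(1)])
    have "between d (\<phi> ?i (\<phi> g u)) (\<phi> ?i m) (\<phi> ?i (\<phi> g w))"
      using m i mT g uw by (subst act_between) (auto intro: act_closed)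
    then have "between d u (\<phi> ?i m) w" using g uw by (simp add: act_inv_left)
    then have "\<phi> ?i m = u \<or> \<phi> ?i m = w" using uw(6) act_branch_point[OF i m(1)] by blast
    then show ?thesis using act_inv_right[OF g mT] by metis
  qed
  moreover have "\<phi> g u \<noteq> \<phi> g w" using act_inj[OF g uw(4,5)] uw(3) by blast
  ultimately show ?thesis
    unfolding tree_edges_def using act_branch_point[OF g uw(1)] act_branch_point[OF g uw(2)] by blast
qed

lemma edge_orbit_eq: "edge_orbit r \<phi> (u, w) = (\<lambda>g. (\<phi> g u, \<phi> g w)) ` F"
  by (auto simp: edge_orbit_def orbit_def)

lemma edge_orbit_act:
  assumes "g \<in> F" "u \<in> T" "w \<in> T"
  shows "edge_orbit r \<phi> (\<phi> g u, \<phi> g w) = edge_orbit r \<phi> (u, w)"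
proof -
  have "(\<phi> h (\<phi> g u), \<phi> h (\<phi> g w)) \<in> (\<lambda>g. (\<phi> g u, \<phi> g w)) ` F" if "h \<in> F" for h
    using assms that by (intro image_eqI[of _ _ "h \<cdot> g"]) (auto simp: act_mult)
  moreover have "(\<phi> h u, \<phi> h w) \<in> (\<lambda>h. (\<phi> h (\<phi> g u), \<phi> h (\<phi> g w))) ` F" if "h \<in> F" for h
    using assms that
    by (intro image_eqI[of _ _ "h \<cdot> inv_F g"])
      (auto simp: act_mult act_closed act_inv_left)
  ultimately show ?thesis unfolding edge_orbit_eq by blast
qed

text \<open>Unique lifting of edges: a group element that carries one lift at \<open>u\<close> to
  another fixes \<open>u\<close>, and the action is free.\<close>

lemma edge_orbit_determined:
  assumes "u \<in> T" "w \<in> T" "w' \<in> T" "edge_orbit r \<phi> (u, w) = edge_orbit r \<phi> (u, w')"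
  shows "w = w'"
proof -
  have "(u, w') \<in> edge_orbit r \<phi> (u, w')"
    unfolding edge_orbit_eq using assms by (intro image_eqI[of _ _ "one_F"]) (auto simp: act_one)
  then obtain g where g: "g \<in> F" "u = \<phi> g u" "w' = \<phi> g w"
    using assms(4) unfolding edge_orbit_eq by blast
  then have "g = one_F" using act_free[OF g(1) assms(1)] by simp
  then show ?thesis using g(3) assms(2) by (simp add: act_one)
qed

lemma edge_length_edge_orbit:
  assumes "u \<in> T" "w \<in> T"
  shows "edge_length d (edge_orbit r \<phi> (u, w)) = d u w"
proof -
  have "(\<lambda>(u, v). d u v) ` edge_orbit r \<phi> (u, w) = (\<lambda>g. d u w) ` F"
    unfolding edge_orbit_eq image_image using assms by (intro image_cong) (auto simp: act_dist)
  also have "\<dots> = {d u w}" using free_group.one_closed by blast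
  finally show ?thesis by (simp add: edge_length_def)
qed

lemma finite_edge_orbits: "finite (edge_orbit r \<phi> ` tree_edges T d)"
proof -
  obtain B where B: "finite B" "B \<subseteq> branch_points T d" "\<forall>b\<in>branch_points T d. \<exists>g\<in>F. \<exists>b'\<in>B. b = \<phi> g b'"
    using finite_branch_orbits by blast
  let ?E = "Sigma B (\<lambda>u. {w. (u, w) \<in> tree_edges T d})"
  have "edge_orbit r \<phi> ` tree_edges T d \<subseteq> edge_orbit r \<phi> ` ?E"
  proof
    fix x assume "x \<in> edge_orbit r \<phi> ` tree_edges T d"
    then obtain u w where e: "(u, w) \<in> tree_edges T d" "x = edge_orbit r \<phi> (u, w)" by auto
    note uw = tree_edgeD[OF e(1)]
    obtain g b where g: "g \<in> F" "b \<in> B" "u = \<phi> g b" using B(3) uw(1) by blast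
    let ?i = "inv_F g"
    have i: "?i \<in> F" using g by simp
    have b: "b = \<phi> ?i u" using g B(2) branch_point_in by (auto simp: act_inv_left)
    have "(b, \<phi> ?i w) \<in> ?E" using act_tree_edge[OF i e(1)] g(2) b by simp
    moreover have "x = edge_orbit r \<phi> (b, \<phi> ?i w)" using edge_orbit_act[OF i uw(4,5)] b e(2) by simp
    ultimately show "x \<in> edge_orbit r \<phi> ` ?E" by blast
  qed
  moreover have "finite ?E" using B(1) finite_edges_at by blast
  ultimately show ?thesis by (meson finite_imageI finite_subset)
qed

text \<open>Since \<open>card\<close> is 0 on infinite sets, the growth function is an honest count
  only because of this. Edge lengths are bounded below, and there are finitely many edges in the
  quotient.\<close>

lemma finite_short_language:
  "finite {\<gamma> \<in> laminary_language r T d \<phi> L. path_length d \<gamma> \<le> R}"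
proof -
  obtain \<epsilon> where \<epsilon>: "\<epsilon> > 0" "\<And>b b'. b \<in> branch_points T d \<Longrightarrow> b' \<in> branch_points T d \<Longrightarrow> b \<noteq> b' \<Longrightarrow> \<epsilon> \<le> d b b'"
    using branch_points_separated by blast
  let ?E = "edge_orbit r \<phi> ` tree_edges T d"
  let ?N = "nat \<lceil>R / \<epsilon>\<rceil>"
  have "set \<gamma> \<subseteq> ?E \<and> length \<gamma> \<le> ?N" if \<gamma>: "\<gamma> \<in> laminary_language r T d \<phi> L" "path_length d \<gamma> \<le> R" for \<gamma>
  proof -
    obtain \<eta> u w where \<eta>: "pre_digraph.awalk (tree_graph T d) u \<eta> w" "map (edge_orbit r \<phi>) \<eta> = \<gamma>"
      using \<gamma>(1) unfolding laminary_language_def by blast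
    have set: "set \<eta> \<subseteq> tree_edges T d" using \<eta>(1) by (simp add: pre_digraph.awalk_def tree_graph_def)
    have "\<epsilon> * real (length \<eta>) \<le> path_length d (map (edge_orbit r \<phi>) \<eta>)"
      using set
    proof (induction \<eta>)
      case (Cons e \<eta>)
      obtain u w where e: "e = (u, w)" by (cases e)
      then have "(u, w) \<in> tree_edges T d" using Cons.prems by simp
      note uw = tree_edgeD[OF this]
      show ?case using Cons \<epsilon>(2)[OF uw(1,2,3)] uw
        by (simp add: path_length_def e edge_length_edge_orbit algebra_simps)
    qed (simp add: path_length_def)
    then have "\<epsilon> * real (length \<gamma>) \<le> R" using \<eta>(2) \<gamma>(2) by auto
    then have "real (length \<gamma>) \<le> R / \<epsilon>" using \<epsilon>(1) by (simp add: field_simps)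
    then have "length \<gamma> \<le> ?N" by linarith
    moreover have "set \<gamma> \<subseteq> ?E" using set unfolding \<eta>(2)[symmetric] set_map by (rule image_mono)
    ultimately show ?thesis by simp
  qed
  then have "{\<gamma> \<in> laminary_language r T d \<phi> L. path_length d \<gamma> \<le> R} \<subseteq> {\<gamma>. set \<gamma> \<subseteq> ?E \<and> length \<gamma> \<le> ?N}"
    by blast
  then show ?thesis using finite_lists_length_le[OF finite_edge_orbits] by (rule finite_subset)
qed

subsection \<open>Lines\<close>

definition line where "line c \<longleftrightarrow> range c \<subseteq> T \<and> (\<forall>s t. d (c s) (c t) = \<bar>s - t :: real\<bar>)"

lemma lineD:
  assumes "line c"
  shows "c t \<in> T" "d (c s) (c t) = \<bar>s - t\<bar>"
  using assms by (auto simp: line_def)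

lemma line_inj: "line c \<Longrightarrow> c s = c t \<Longrightarrow> s = t"
  using lineD[of c] by (metis abs_eq_0 eq_iff_diff_eq_0 zero)

lemma line_between: "line c \<Longrightarrow> s \<le> t \<Longrightarrow> t \<le> u \<Longrightarrow> between d (c s) (c t) (c u)"
  by (simp add: between_def lineD)

lemma between_on_line:
  assumes c: "line c" and st: "s \<le> t" and z: "z \<in> T" "between d (c s) z (c t)"
  shows "\<exists>u. s \<le> u \<and> u \<le> t \<and> z = c u"
proof -
  let ?u = "s + d (c s) z"
  have "t - s = d (c s) z + d z (c t)" using z(2) lineD(2)[OF c, of s t] st by (simp add: between_def)
  then have u: "s \<le> ?u" "?u \<le> t" using nonneg[of z "c t"] nonneg[of "c s" z] by linarith+
  have "z = c ?u"
  proof (rule between_unique[OF lineD(1)[OF c] z(1) lineD(1)[OF c] lineD(1)[OF c] z(2)])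
    show "between d (c s) (c ?u) (c t)" using line_between[OF c u] .
    show "d (c s) z = d (c s) (c ?u)" using lineD[OF c] by simp
  qed
  then show ?thesis using u by blast
qed

text \<open>A nearby branch point is projected to the line. If the projection differs from it, the
  two directions of the line and the one towards the branch point make the projection itself a
  branch point.\<close>

lemma line_branch_dense:
  assumes c: "line c"
  shows "\<exists>t'. \<bar>t' - t\<bar> \<le> D_branch \<and> c t' \<in> branch_points T d"
proof -
  note cT = lineD(1)[OF c] and cd = lineD(2)[OF c]
  obtain b where b: "b \<in> branch_points T d" "d (c t) b \<le> D_branch"
    using branch_points_dense[OF cT] by blast
  have bT: "b \<in> T" by (rule branch_point_in[OF b(1)])
  have pos: "0 \<le> D_branch" using b(2) nonneg[of "c t" b] by linarith
  \<comment> \<open>The extra 1 keeps the projection away from both ends of the segment.\<close>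
  let ?p = "t - (D_branch + 1)" and ?q = "t + (D_branch + 1)"
  obtain m where m: "m \<in> T" "between d (c ?p) m (c ?q)" "between d (c ?q) m b" "between d (c ?p) m b"
    using median[OF cT cT bT] .
  obtain t' where t': "?p \<le> t'" "t' \<le> ?q" "m = c t'"
    using between_on_line[OF c _ m(1,2)] pos by auto
  have "\<bar>t' - t\<bar> + d m b \<le> d (c t) b"
  proof (cases "t \<le> t'")
    case True
    then show ?thesis using m(4) t' triangle[OF cT[of ?p] cT[of t] bT] cd pos
      by (simp add: between_def)
  next
    case False
    then show ?thesis using m(3) t' triangle[OF cT[of ?q] cT[of t] bT] cd pos
      by (simp add: between_def)
  qed
  then have tt: "\<bar>t' - t\<bar> \<le> D_branch" using b(2) nonneg[of m b] by linarith
  have "m \<in> branch_points T d"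
  proof (cases "m = b")
    case False
    have "m \<noteq> c ?p" "m \<noteq> c ?q" using tt t'(3) line_inj[OF c] by force+
    then show ?thesis using median_branch_point[OF m(1) cT cT bT m(2,3,4)] False by blast
  qed (use b in simp)
  then show ?thesis using tt t' by blast
qed

text \<open>By \<open>line_branch_dense\<close> there is a branch point within
  \<open>D_branch\<close> of parameter \<open>t + D_branch + 1\<close>; it lies strictly after
  \<open>t\<close> and no later than \<open>t + gap\<close>.\<close>

definition gap where "gap = 2 * D_branch + 1"

definition next_branch where
  "next_branch c t = (SOME t'. t < t' \<and> t' \<le> t + gap \<and> c t' \<in> branch_points T d \<and>
     (\<forall>s. t < s \<and> s < t' \<longrightarrow> c s \<notin> branch_points T d))"

lemma next_branch:
  assumes c: "line c"
  shows "t < next_branch c t" "next_branch c t \<le> t + gap" "c (next_branch c t) \<in> branch_points T d"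
    "\<And>s. t < s \<Longrightarrow> s < next_branch c t \<Longrightarrow> c s \<notin> branch_points T d"
proof -
  define S where "S = {s. t < s \<and> s \<le> t + gap \<and> c s \<in> branch_points T d}"
  have "c ` S \<subseteq> {b \<in> branch_points T d. d (c t) b \<le> gap}"
    using lineD[OF c] by (auto simp: S_def)
  then have "finite (c ` S)" using finite_near_branch_points[OF lineD(1)[OF c]] by (rule finite_subset)
  then have "finite S" by (rule finite_imageD) (auto intro!: inj_onI line_inj[OF c])
  have "S \<noteq> {}"
  proof -
    obtain t' where t': "\<bar>t' - (t + D_branch + 1)\<bar> \<le> D_branch" "c t' \<in> branch_points T d"
      using line_branch_dense[OF c] by blast
    then have "t' \<in> S" by (auto simp: S_def gap_def)
    then show ?thesis by blast
  qed
  have "Min S \<in> S" using \<open>finite S\<close> \<open>S \<noteq> {}\<close> by (rule Min_in)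
  moreover have "c s \<notin> branch_points T d" if "t < s" "s < Min S" for s
  proof
    assume "c s \<in> branch_points T d"
    then have "s \<in> S" using that \<open>Min S \<in> S\<close> by (auto simp: S_def)
    then show False using that \<open>finite S\<close> Min_le by fastforce
  qed
  ultimately have "t < Min S \<and> Min S \<le> t + gap \<and> c (Min S) \<in> branch_points T d \<and>
     (\<forall>s. t < s \<and> s < Min S \<longrightarrow> c s \<notin> branch_points T d)" by (auto simp: S_def)
  then have *: "t < next_branch c t \<and> next_branch c t \<le> t + gap \<and> c (next_branch c t) \<in> branch_points T d \<and>
     (\<forall>s. t < s \<and> s < next_branch c t \<longrightarrow> c s \<notin> branch_points T d)"
    unfolding next_branch_def by (rule someI)
  then show "t < next_branch c t" "next_branch c t \<le> t + gap" "c (next_branch c t) \<in> branch_points T d"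
    "\<And>s. t < s \<Longrightarrow> s < next_branch c t \<Longrightarrow> c s \<notin> branch_points T d" by blast+
qed

lemma next_branch_edge:
  assumes c: "line c" and t: "c t \<in> branch_points T d"
  shows "(c t, c (next_branch c t)) \<in> tree_edges T d"
proof -
  note n = next_branch[OF c, of t]
  have "w = c t \<or> w = c (next_branch c t)"
    if w: "w \<in> branch_points T d" "between d (c t) w (c (next_branch c t))" for w
  proof -
    obtain u where "t \<le> u" "u \<le> next_branch c t" "w = c u"
      using between_on_line[OF c _ branch_point_in[OF w(1)] w(2)] n(1) by auto
    then show ?thesis using n(4)[of u] w(1) by fastforce
  qed
  moreover have "c t \<noteq> c (next_branch c t)" using line_inj[OF c] n(1) by fastforce
  ultimately show ?thesis using n(3) t by (auto simp: tree_edges_def)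
qed

section \<open>Edge-paths read off along a line\<close>

definition stop where "stop c t k = (next_branch c ^^ k) t"

lemma stop_0 [simp]: "stop c t 0 = t" and stop_Suc: "stop c t (Suc k) = next_branch c (stop c t k)"
  by (simp_all add: stop_def)

lemma stop_branch:
  assumes "line c" "c t \<in> branch_points T d"
  shows "c (stop c t k) \<in> branch_points T d"
  by (induction k) (use assms next_branch in \<open>auto simp: stop_Suc\<close>)

lemma stop_mono:
  assumes "line c"
  shows "strict_mono (stop c t)"
  using next_branch(1)[OF assms] by (intro strict_monoI_Suc) (simp add: stop_Suc)

text \<open>Stops cannot accumulate, which makes the maximum in \<open>steps\<close> exist.\<close>

lemma stop_lower_bound:
  "\<exists>\<epsilon>>0. \<forall>c t k. line c \<longrightarrow> c t \<in> branch_points T d \<longrightarrow> t + \<epsilon> * real k \<le> stop c t k"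
proof -
  obtain \<epsilon> where \<epsilon>: "\<epsilon> > 0" "\<And>b b'. b \<in> branch_points T d \<Longrightarrow> b' \<in> branch_points T d \<Longrightarrow> b \<noteq> b' \<Longrightarrow> \<epsilon> \<le> d b b'"
    using branch_points_separated by blast
  have "t + \<epsilon> * real k \<le> stop c t k" if c: "line c" "c t \<in> branch_points T d" for c t k
  proof (induction k)
    case (Suc k)
    have "(c (stop c t k), c (stop c t (Suc k))) \<in> tree_edges T d"
      unfolding stop_Suc by (rule next_branch_edge[OF c(1) stop_branch[OF c]])
    note e = tree_edgeD[OF this]
    have "\<epsilon> \<le> stop c t (Suc k) - stop c t k"
      using \<epsilon>(2)[OF e(1,2,3)] lineD(2)[OF c(1)] next_branch(1)[OF c(1), of "stop c t k"] by (simp add: stop_Suc)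
    then show ?case using Suc by (simp add: algebra_simps)
  qed simp
  then show ?thesis using \<epsilon>(1) by blast
qed

definition steps where "steps c t n = (GREATEST k. stop c t k \<le> t + n)"

text \<open>The stop following the last one within \<open>n\<close> lies beyond
  \<open>t + n\<close>, and consecutive stops are at most \<open>gap\<close> apart.\<close>

lemma steps:
  assumes c: "line c" and t: "c t \<in> branch_points T d" and n: "n \<ge> 0"
  shows "stop c t (steps c t n) \<le> t + n" "stop c t (steps c t n) > t + n - gap"
proof -
  obtain \<epsilon> where \<epsilon>: "\<epsilon> > 0" "\<And>k. t + \<epsilon> * real k \<le> stop c t k"
    using stop_lower_bound c t by blast
  have bound: "k \<le> nat \<lceil>n / \<epsilon>\<rceil>" if "stop c t k \<le> t + n" for k
  proof -
    have "\<epsilon> * real k \<le> n" using \<epsilon>(2)[of k] that by linarith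
    then have "real k \<le> n / \<epsilon>" using \<epsilon>(1) by (simp add: field_simps)
    then show ?thesis by linarith
  qed
  have "stop c t 0 \<le> t + n" using n by simp
  then show 1: "stop c t (steps c t n) \<le> t + n"
    unfolding steps_def using bound by (rule GreatestI_nat)
  have "stop c t (Suc (steps c t n)) > t + n"
  proof (rule ccontr)
    assume "\<not> ?thesis"
    then have "Suc (steps c t n) \<le> steps c t n"
      unfolding steps_def using bound by (intro Greatest_le_nat) auto
    then show False by simp
  qed
  then show "stop c t (steps c t n) > t + n - gap"
    using next_branch(2)[OF c, of "stop c t (steps c t n)"] by (simp add: stop_Suc)
qed

definition tree_path where
  "tree_path c t k = map (\<lambda>j. (c (stop c t j), c (stop c t (Suc j)))) [0..<k]"

text \<open>The label in the quotient graph of the part of \<open>c\<close> that starts at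
  \<open>c t\<close> and ends at the last branch point within distance \<open>n\<close>. Cutting at
  a branch point turns it into an edge-path, at the price of losing less than \<open>gap\<close> of
  length.\<close>

definition code where
  "code c t n = map (edge_orbit r \<phi>) (tree_path c t (steps c t n))"

lemma cas_upt:
  assumes "\<And>e. tail G e = f (fst e)" "\<And>e. head G e = f (snd e)"
  shows "pre_digraph.cas G (f (V m)) (map (\<lambda>j. (V j, V (Suc j))) [m..<m + k]) (f (V (m + k)))"
proof (induction k arbitrary: m)
  case (Suc k)
  have "[m..<m + Suc k] = m # [Suc m..<Suc m + k]" by (simp add: upt_conv_Cons)
  then show ?case using Suc[of "Suc m"] by (simp add: pre_digraph.cas.simps assms)
qed (simp add: pre_digraph.cas.simps)

lemma tree_path_awalk:
  assumes c: "line c" and t: "c t \<in> branch_points T d"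
  shows "pre_digraph.awalk (tree_graph T d) (c t) (tree_path c t k) (c (stop c t k))"
    "pre_digraph.awalk_verts (tree_graph T d) (c t) (tree_path c t k) = map c (map (stop c t) [0..<Suc k])"
proof -
  have "set (tree_path c t k) \<subseteq> tree_edges T d"
    unfolding tree_path_def using next_branch_edge[OF c stop_branch[OF c t]] by (auto simp: stop_Suc)
  moreover have "pre_digraph.cas (tree_graph T d) (c t) (tree_path c t k) (c (stop c t k))"
    using cas_upt[of "tree_graph T d" id "\<lambda>j. c (stop c t j)" 0 k] by (simp add: tree_graph_def tree_path_def)
  ultimately show "pre_digraph.awalk (tree_graph T d) (c t) (tree_path c t k) (c (stop c t k))"
    using t by (simp add: pre_digraph.awalk_def tree_graph_def)
  show "pre_digraph.awalk_verts (tree_graph T d) (c t) (tree_path c t k) = map c (map (stop c t) [0..<Suc k])"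
    by (cases k) (simp_all add: pre_digraph.awalk_verts_conv tree_path_def tree_graph_def comp_def)
qed

lemma quotient_awalk:
  assumes "pre_digraph.awalk (tree_graph T d) u \<eta> w"
  shows "pre_digraph.awalk (quotient_graph r T d \<phi>) (orbit (free_group r) \<phi> u)
    (map (edge_orbit r \<phi>) \<eta>) (orbit (free_group r) \<phi> w)"
proof -
  have fst: "fst ` edge_orbit r \<phi> e = orbit (free_group r) \<phi> (fst e)"
    and snd: "snd ` edge_orbit r \<phi> e = orbit (free_group r) \<phi> (snd e)" for e
    by (cases e, auto simp: edge_orbit_eq orbit_def image_image)+
  have "pre_digraph.cas (quotient_graph r T d \<phi>) (orbit (free_group r) \<phi> u)
    (map (edge_orbit r \<phi>) \<eta>) (orbit (free_group r) \<phi> w)"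
    if "pre_digraph.cas (tree_graph T d) u \<eta> w"
    using that
    by (induction \<eta> arbitrary: u)
      (auto simp: pre_digraph.cas.simps quotient_graph_def tree_graph_def fst snd)
  then show ?thesis
    using assms by (auto simp: pre_digraph.awalk_def quotient_graph_def tree_graph_def)
qed

lemma path_length_code:
  assumes c: "line c"
  shows "path_length d (map (edge_orbit r \<phi>) (tree_path c t k)) = stop c t k - t"
proof (induction k)
  case (Suc k)
  have "d (c (stop c t k)) (c (stop c t (Suc k))) = stop c t (Suc k) - stop c t k"
    using lineD(2)[OF c] next_branch(1)[OF c, of "stop c t k"] by (simp add: stop_Suc)
  then show ?case using Suc lineD(1)[OF c]
    by (simp add: tree_path_def path_length_def edge_length_edge_orbit)
qed (simp add: tree_path_def path_length_def)

lemma code_in_language: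
  assumes c: "geodesic_from_to T d \<phi> p q c" and L: "(p, q) \<in> L"
    and t: "c t \<in> branch_points T d" and n: "n \<ge> gap" "n \<ge> 0"
  shows "code c t n \<in> {\<gamma> \<in> laminary_language r T d \<phi> L. path_length d \<gamma> \<le> n}"
proof -
  have line: "line c" using c by (simp add: geodesic_from_to_def line_def)
  note s = steps[OF line t n(2)]
  let ?k = "steps c t n"
  \<comment> \<open>The language contains no empty path; \<open>n \<ge> gap\<close> leaves room for
    at least one edge.\<close>
  have "?k \<noteq> 0"
  proof
    assume "?k = 0"
    then show False using s(2) n by simp
  qed
  then have ne: "code c t n \<noteq> []" by (simp add: code_def tree_path_def)
  note aw = tree_path_awalk[OF line t, of ?k]
  have "sorted_wrt (<) (map (stop c t) [0..<Suc ?k])"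
    using stop_mono[OF line, of t] by (simp add: sorted_wrt_map strict_mono_def sorted_wrt_upt sorted_wrt_mono_rel[OF _ sorted_wrt_upt] del: upt_Suc)
  then have "code c t n \<in> laminary_language r T d \<phi> L"
    unfolding laminary_language_def using ne aw quotient_awalk[OF aw(1)] c L unfolding code_def by blast
  moreover have "path_length d (code c t n) \<le> n"
    unfolding code_def path_length_code[OF line] using s(1) by simp
  ultimately show ?thesis by simp
qed

text \<open>By unique lifting the two lines visit the same branch points up to the last stop, whose
  distance from the start exceeds \<open>n - gap\<close>. The parametrisations may differ by a
  shift.\<close>

lemma code_eq:
  assumes c: "line c" "line c'" and t: "c t = c' t'" "c t \<in> branch_points T d"
    and n: "n \<ge> 0" and eq: "code c t n = code c' t' n"
  shows "\<exists>s. s > n - gap \<and> s \<ge> 0 \<and> c (t + s) = c' (t' + s)"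
proof -
  have t': "c' t' \<in> branch_points T d" using t by simp
  let ?k = "steps c t n"
  have k: "steps c' t' n = ?k"
    using arg_cong[OF eq, of length] by (simp add: code_def tree_path_def)
  have orb: "edge_orbit r \<phi> (c (stop c t j), c (stop c t (Suc j))) = edge_orbit r \<phi> (c' (stop c' t' j), c' (stop c' t' (Suc j)))"
    if "j < ?k" for j
    using arg_cong[OF eq, of "\<lambda>l. l ! j"] that k by (simp add: code_def tree_path_def)
  have "c (stop c t j) = c' (stop c' t' j)" if "j \<le> ?k" for j
    using that
  proof (induction j)
    case (Suc j)
    then have e: "c (stop c t j) = c' (stop c' t' j)" "j < ?k" by auto
    show ?case
      using edge_orbit_determined[OF lineD(1)[OF c(2)] lineD(1)[OF c(1)] lineD(1)[OF c(2)]] orb[OF e(2)] e(1) by metis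
  qed (use t in simp)
  then have z: "c (stop c t ?k) = c' (stop c' t' ?k)" by simp
  let ?s = "stop c t ?k - t"
  have mono: "t \<le> stop c t ?k" "t' \<le> stop c' t' ?k"
    using strict_mono_less_eq[OF stop_mono[OF c(1), of t], of 0 ?k]
      strict_mono_less_eq[OF stop_mono[OF c(2), of t'], of 0 ?k] by auto
  have "?s = d (c t) (c (stop c t ?k))" using lineD(2)[OF c(1)] mono by simp
  also have "\<dots> = stop c' t' ?k - t'" using lineD(2)[OF c(2)] mono z t(1) by simp
  finally have "t' + ?s = stop c' t' ?k" by simp
  then have "c (t + ?s) = c' (t' + ?s)" using z by simp
  moreover have "?s > n - gap" using steps(2)[OF c(1) t(2) n] by simp
  ultimately show ?thesis using mono by (intro exI[of _ ?s]) simp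
qed

lemma line_gromov_product:
  assumes c: "line c" "line c'" and t: "c t = c' t'" and s: "s \<ge> 0" "c (t + s) = c' (t' + s)"
    and xy: "x \<ge> t + s" "y \<ge> t' + s"
  shows "s \<le> gromov_product d (c t) (c x) (c' y)"
proof -
  have "gromov_product d (c t) (c (t + s)) (c x) = s"
    using lineD(2)[OF c(1)] s(1) xy by (simp add: gromov_product_def)
  moreover have "gromov_product d (c t) (c (t + s)) (c' y) = s"
    unfolding t s(2) using lineD(2)[OF c(2)] s(1) xy by (simp add: gromov_product_def)
  ultimately show ?thesis
    using gromov_product_min[OF lineD(1)[OF c(1), of t] lineD(1)[OF c(1), of x] lineD(1)[OF c(1), of "t + s"] lineD(1)[OF c(2), of y]]
      gromov_product_commute[OF lineD(1)[OF c(1), of x] lineD(1)[OF c(1), of "t + s"]] by simp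
qed

end


section \<open>Geodesics between boundary points\<close>

context real_tree_space
begin

lemma gromov_product_eq_between:
  assumes "w \<in> T" "x \<in> T" "y \<in> T" "d w x \<le> gromov_product d w x y"
  shows "between d w x y"
  using gromov_product_le1[OF assms(1-3)] assms(4) by (simp add: between_def gromov_product_def field_simps)

text \<open>Once the mutual products exceed \<open>t\<close>, the segments from \<open>v\<close> to
  the points \<open>A i\<close> all pass through the same point at distance \<open>t\<close>, so
  this point is well defined in the limit.\<close>

lemma ray_exists:
  assumes v: "v \<in> T" and A: "range A \<subseteq> T" "products_diverge T d A A"
  shows "\<exists>\<rho>. \<forall>t\<ge>0. \<rho> t \<in> T \<and> d v (\<rho> t) = t \<and> (\<exists>N. \<forall>i\<ge>N. between d v (\<rho> t) (A i))"
proof -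
  have AT: "A i \<in> T" for i using A(1) by blast
  have "\<exists>x. x \<in> T \<and> d v x = t \<and> (\<exists>N. \<forall>i\<ge>N. between d v x (A i))" if t: "t \<ge> 0" for t
  proof -
    obtain N where N: "\<forall>i\<ge>N. \<forall>j\<ge>N. t \<le> gromov_product d v (A i) (A j)"
      using A(2) unfolding products_diverge_iff[OF v A(1) A(1)] by blast
    have "t \<le> d v (A N)" using N gromov_product_le1[OF v AT AT] by (meson order.refl order_trans)
    then obtain x where x: "x \<in> T" "between d v x (A N)" "d v x = t"
      using point_on_segment[OF v AT t] by blast
    have "between d v x (A i)" if "i \<ge> N" for i
    proof (rule gromov_product_eq_between[OF v x(1) AT])
      have "t \<le> gromov_product d v (A N) (A i)" using N that by simp
      then show "d v x \<le> gromov_product d v x (A i)"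
        using gromov_product_min[OF v x(1) AT[of N] AT[of i]] gromov_product_between[OF v x(1) AT x(2)] x(3)
        by simp
    qed
    then show ?thesis using x by blast
  qed
  then show ?thesis by metis
qed

text \<open>The rays from \<open>v\<close> towards the two ends coincide for a length
  \<open>s\<close> and then separate. The line runs back along the first ray to the point at
  distance \<open>s\<close> and leaves along the second.\<close>

lemma line_exists:
  assumes v: "v \<in> T" and A: "range A \<subseteq> T" "products_diverge T d A A"
    and B: "range B \<subseteq> T" "products_diverge T d B B"
    and AB: "\<forall>i\<ge>N0. \<forall>j\<ge>N0. gromov_product d v (A i) (B j) \<le> R"
  shows "\<exists>c. range c \<subseteq> T \<and> (\<forall>s t. d (c s) (c t) = \<bar>s - t\<bar>)
    \<and> products_diverge T d A (\<lambda>n. c (- real n)) \<and> products_diverge T d B (\<lambda>n. c (real n))"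
proof -
  have AT: "A i \<in> T" and BT: "B i \<in> T" for i using A(1) B(1) by blast+
  obtain \<alpha> where \<alpha>: "\<And>t. t \<ge> 0 \<Longrightarrow> \<alpha> t \<in> T" "\<And>t. t \<ge> 0 \<Longrightarrow> d v (\<alpha> t) = t"
    "\<And>t. t \<ge> 0 \<Longrightarrow> \<exists>N. \<forall>i\<ge>N. between d v (\<alpha> t) (A i)"
    using ray_exists[OF v A] by blast
  obtain \<beta> where \<beta>: "\<And>t. t \<ge> 0 \<Longrightarrow> \<beta> t \<in> T" "\<And>t. t \<ge> 0 \<Longrightarrow> d v (\<beta> t) = t"
    "\<And>t. t \<ge> 0 \<Longrightarrow> \<exists>N. \<forall>i\<ge>N. between d v (\<beta> t) (B i)"
    using ray_exists[OF v B] by blast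
  obtain NA where NA: "\<forall>i\<ge>NA. \<forall>j\<ge>NA. R + 1 \<le> gromov_product d v (A i) (A j)"
    using A(2) unfolding products_diverge_iff[OF v A(1) A(1)] by blast
  obtain NB where NB: "\<forall>i\<ge>NB. \<forall>j\<ge>NB. R + 1 \<le> gromov_product d v (B i) (B j)"
    using B(2) unfolding products_diverge_iff[OF v B(1) B(1)] by blast
  define N where "N = max N0 (max NA NB)"
  define s where "s = gromov_product d v (A N) (B N)"
  have s: "s \<ge> 0" unfolding s_def by (intro gromov_product_nonneg v AT BT)
  \<comment> \<open>A mixed product is at most \<open>R\<close>, while products within either
    sequence are at least \<open>R + 1\<close>. With \<delta> equal to 0, replacing indices
    therefore cannot change a mixed product.\<close>
  have sAB: "gromov_product d v (A i) (B j) = s" if ij: "i \<ge> N" "j \<ge> N" for i j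
  proof -
    have *: "gromov_product d v (A i) (B j) \<ge> gromov_product d v (A k) (B l)"
      if "i \<ge> N" "j \<ge> N" "k \<ge> N" "l \<ge> N" for i j k l
    proof -
      have "gromov_product d v (A k) (B l) \<le> R" "R + 1 \<le> gromov_product d v (A i) (A k)"
        "R + 1 \<le> gromov_product d v (B l) (B j)"
        using AB NA NB that by (auto simp: N_def)
      then show ?thesis
        using gromov_product_min[OF v AT[of i] AT[of k] BT[of j]] gromov_product_min[OF v AT[of k] BT[of l] BT[of j]]
        by (auto simp: min_def split: if_splits)
    qed
    show ?thesis using *[of i j N N] *[of N N i j] ij unfolding s_def by simp
  qed
  have same: "d (\<rho> x) (\<rho> y) = \<bar>x - y\<bar>"
    if \<rho>: "\<And>t. t \<ge> 0 \<Longrightarrow> \<rho> t \<in> T" "\<And>t. t \<ge> 0 \<Longrightarrow> d v (\<rho> t) = t" "\<And>i. E i \<in> T"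
      "\<And>t. t \<ge> 0 \<Longrightarrow> \<exists>N. \<forall>i\<ge>N. between d v (\<rho> t) (E i)" "x \<ge> 0" "y \<ge> 0" for \<rho> and E :: "nat \<Rightarrow> 't" and x y
  proof -
    obtain N1 where N1: "\<forall>i\<ge>N1. between d v (\<rho> x) (E i)" using \<rho>(4)[OF \<rho>(5)] by (elim exE)
    obtain N2 where N2: "\<forall>i\<ge>N2. between d v (\<rho> y) (E i)" using \<rho>(4)[OF \<rho>(6)] by (elim exE)
    from N1 N2 have "between d v (\<rho> x) (E (max N1 N2))" "between d v (\<rho> y) (E (max N1 N2))" by auto
    then show ?thesis using between_dist[OF v \<rho>(1)[OF \<rho>(5)] \<rho>(1)[OF \<rho>(6)] \<rho>(3)] \<rho>(2,5,6) by simp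
  qed
  have d\<alpha>: "d (\<alpha> x) (\<alpha> y) = \<bar>x - y\<bar>" if "x \<ge> 0" "y \<ge> 0" for x y
    using same[of \<alpha> A, OF \<alpha>(1,2) AT \<alpha>(3) that] .
  have d\<beta>: "d (\<beta> x) (\<beta> y) = \<bar>x - y\<bar>" if "x \<ge> 0" "y \<ge> 0" for x y
    using same[of \<beta> B, OF \<beta>(1,2) BT \<beta>(3) that] .
  have gp: "gromov_product d v (\<alpha> x) (\<beta> y) = s" if "x \<ge> s" "y \<ge> s" for x y
  proof -
    have x: "x \<ge> 0" "y \<ge> 0" using that s by auto
    obtain N1 N2 where N12: "\<forall>i\<ge>N1. between d v (\<alpha> x) (A i)" "\<forall>i\<ge>N2. between d v (\<beta> y) (B i)"
      using \<alpha>(3)[OF x(1)] \<beta>(3)[OF x(2)] by blast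
    define i where "i = max N (max N1 N2)"
    have bt: "between d v (\<alpha> x) (A i)" "between d v (\<beta> y) (B i)" and iN: "i \<ge> N"
      using N12 by (auto simp: i_def)
    note xT = \<alpha>(1)[OF x(1)] and yT = \<beta>(1)[OF x(2)]
    have 1: "gromov_product d v (\<alpha> x) (A i) = x" "gromov_product d v (\<beta> y) (B i) = y"
      using gromov_product_between[OF v xT AT bt(1)] gromov_product_between[OF v yT BT bt(2)] \<alpha>(2) \<beta>(2) x by auto
    have 2: "gromov_product d v (A i) (B i) = s" using sAB[OF iN iN] .
    have 3: "gromov_product d v (A i) (\<alpha> x) = x" "gromov_product d v (B i) (\<beta> y) = y"
      using 1 gromov_product_commute[OF xT AT] gromov_product_commute[OF yT BT] by auto
    have "s \<le> gromov_product d v (\<alpha> x) (\<beta> y)"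
      using gromov_product_min[OF v xT AT[of i] yT] gromov_product_min[OF v AT[of i] BT[of i] yT] 1 2 3 that by simp
    moreover have "gromov_product d v (\<alpha> x) (\<beta> y) \<le> s"
    \<comment> \<open>Strictly beyond \<open>s\<close>, a product of the rays above \<open>s\<close>
      would push the product of \<open>A i\<close> and \<open>B i\<close> above \<open>s\<close>. At
      \<open>s\<close> itself the product is at most the distance from \<open>v\<close>.\<close>
    proof (cases "x = s \<or> y = s")
      case True
      then show ?thesis
        using gromov_product_le1[OF v xT yT] gromov_product_le2[OF v xT yT] \<alpha>(2) \<beta>(2) x by auto
    next
      case False
      then show ?thesis
        using gromov_product_min[OF v AT[of i] xT BT[of i]] gromov_product_min[OF v xT yT BT[of i]] 1 2 3 that
        by (auto simp: min_def split: if_splits)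
    qed
    ultimately show ?thesis by simp
  qed
  have d\<alpha>\<beta>: "d (\<alpha> x) (\<beta> y) = x + y - 2 * s" if "x \<ge> s" "y \<ge> s" for x y
    using gp[OF that] \<alpha>(2)[of x] \<beta>(2)[of y] that s by (simp add: gromov_product_def)
  \<comment> \<open>Parameter 0 is the point where the rays separate; \<open>\<alpha> s\<close> and
    \<open>\<beta> s\<close> are at distance 0.\<close>
  define c where "c t = (if t \<le> 0 then \<alpha> (s - t) else \<beta> (s + t))" for t
  have cT: "c t \<in> T" for t using \<alpha>(1)[of "s - t"] \<beta>(1)[of "s + t"] s by (simp add: c_def)
  have dc: "d (c x) (c y) = \<bar>x - y\<bar>" for x y
  proof -
    have "d (c x) (c y) = \<bar>x - y\<bar>" if "x \<le> y" for x y
      using d\<alpha>[of "s - x" "s - y"] d\<beta>[of "s + x" "s + y"] d\<alpha>\<beta>[of "s - x" "s + y"] that s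
      by (auto simp: c_def)
    then show ?thesis by (metis abs_minus_commute commute linorder_linear)
  qed
  have div: "products_diverge T d E (\<lambda>n. \<rho> (s + real n))"
    if \<rho>: "\<And>t. t \<ge> 0 \<Longrightarrow> \<rho> t \<in> T" "\<And>t. t \<ge> 0 \<Longrightarrow> d v (\<rho> t) = t"
      "\<And>t. t \<ge> 0 \<Longrightarrow> \<exists>N. \<forall>i\<ge>N. between d v (\<rho> t) (E i)"
      and E: "range E \<subseteq> T" "products_diverge T d E E" for \<rho> and E :: "nat \<Rightarrow> 't"
  proof -
    have ET: "E i \<in> T" for i using E(1) by blast
    have "range (\<lambda>n. \<rho> (s + real n)) \<subseteq> T" using \<rho>(1) s by auto
    then show ?thesis
      unfolding products_diverge_iff[OF v E(1) \<open>range (\<lambda>n. \<rho> (s + real n)) \<subseteq> T\<close>]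
    proof (intro allI)
      fix Q
      obtain M where M: "\<forall>i\<ge>M. \<forall>j\<ge>M. Q \<le> gromov_product d v (E i) (E j)"
        using E(2) unfolding products_diverge_iff[OF v E(1) E(1)] by blast
      have "Q \<le> gromov_product d v (E i) (\<rho> (s + real n))" if "i \<ge> max M (nat \<lceil>Q\<rceil>)" "n \<ge> max M (nat \<lceil>Q\<rceil>)" for i n
      proof -
        have sn: "s + real n \<ge> 0" "s + real n \<ge> Q"
        proof -
          have "nat \<lceil>Q\<rceil> \<le> n" using that by simp
          then show "s + real n \<ge> 0" "s + real n \<ge> Q" using s by linarith+
        qed
        obtain N1 where "\<forall>i\<ge>N1. between d v (\<rho> (s + real n)) (E i)" using \<rho>(3)[OF sn(1)] by blast
        then have b: "between d v (\<rho> (s + real n)) (E (max M N1))" by simp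
        have "Q \<le> gromov_product d v (E i) (E (max M N1))" using M that by simp
        moreover have "gromov_product d v (E (max M N1)) (\<rho> (s + real n)) = s + real n"
          using gromov_product_between[OF v \<rho>(1)[OF sn(1)] ET b] gromov_product_commute[OF \<rho>(1)[OF sn(1)] ET] \<rho>(2)[OF sn(1)] by simp
        ultimately show ?thesis
          using gromov_product_min[OF v ET[of i] ET[of "max M N1"] \<rho>(1)[OF sn(1)]] sn by simp
      qed
      then show "\<exists>N. \<forall>i\<ge>N. \<forall>j\<ge>N. Q \<le> gromov_product d v (E i) (\<rho> (s + real j))" by blast
    qed
  qed
  have "c (- real n) = \<alpha> (s + real n)" for n by (simp add: c_def)
  then have "products_diverge T d A (\<lambda>n. c (- real n))" using div[OF \<alpha> A] by simp
  moreover have "c (real n) = \<beta> (s + real n)" for n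
  proof (cases "n = 0")
    case True
    have "d (\<alpha> s) (\<beta> s) = 0" using d\<alpha>\<beta>[of s s] by simp
    then show ?thesis using True \<alpha>(1)[OF s] \<beta>(1)[OF s] by (simp add: c_def)
  qed (simp add: c_def)
  then have "products_diverge T d B (\<lambda>n. c (real n))" using div[OF \<beta> B] by simp
  ultimately show ?thesis using cT dc by blast
qed

end

text \<open>Failure of divergence only provides some late pairs with small product. As each sequence
  diverges with itself, a large product of one late pair would make the products of all late pairs
  large.\<close>

lemma (in gromov_space) bounded_if_not_divergent:
  assumes w: "w \<in> M" and x: "range x \<subseteq> M" "products_diverge M d x x"
    and y: "range y \<subseteq> M" "products_diverge M d y y" and ndiv: "\<not> products_diverge M d x y"
  shows "\<exists>R N. \<forall>i\<ge>N. \<forall>j\<ge>N. gromov_product d w (x i) (y j) \<le> R"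
proof -
  have xM: "x i \<in> M" and yM: "y i \<in> M" for i using x y by auto
  obtain R where R: "\<And>N. \<exists>i\<ge>N. \<exists>j\<ge>N. gromov_product d w (x i) (y j) < R"
    using ndiv unfolding products_diverge_iff[OF w x(1) y(1)] by (meson not_le)
  obtain N1 where N1: "\<forall>i\<ge>N1. \<forall>j\<ge>N1. R + 2 * \<bar>\<delta>\<bar> \<le> gromov_product d w (x i) (x j)"
    using x(2) unfolding products_diverge_iff[OF w x(1) x(1)] by blast
  obtain N2 where N2: "\<forall>i\<ge>N2. \<forall>j\<ge>N2. R + 2 * \<bar>\<delta>\<bar> \<le> gromov_product d w (y i) (y j)"
    using y(2) unfolding products_diverge_iff[OF w y(1) y(1)] by blast
  define N where "N = max N1 N2"
  obtain k l where kl: "k \<ge> N" "l \<ge> N" "gromov_product d w (x k) (y l) < R" using R by blast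
  have "gromov_product d w (x i) (y j) \<le> R + 2 * \<bar>\<delta>\<bar>" if "i \<ge> N" "j \<ge> N" for i j
  proof -
    have "R + 2 * \<bar>\<delta>\<bar> \<le> gromov_product d w (x k) (x i)" "R + 2 * \<bar>\<delta>\<bar> \<le> gromov_product d w (y j) (y l)"
      using N1 N2 that kl by (auto simp: N_def)
    then show ?thesis
      using gromov_product_min[OF w xM[of k] xM[of i] yM[of l]] gromov_product_min[OF w xM[of i] yM[of j] yM[of l]] kl(3)
      by (auto simp: min_def split: if_splits)
  qed
  then show ?thesis by blast
qed

context outer_space_tree
begin

lemma orbit_products_diverge:
  assumes g: "range g \<subseteq> F" and h: "range h \<subseteq> F" and div: "products_diverge F prefix_dist g h"
  shows "products_diverge T d (\<lambda>n. \<phi> (g n) v) (\<lambda>n. \<phi> (h n) v)"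
proof -
  interpret W: gromov_space F prefix_dist 0 by (rule gromov_space_prefix_dist)
  have nil: "[] \<in> F" by (simp add: carrier_free_group reduced_def)
  have gF: "g n \<in> F" and hF: "h n \<in> F" for n using g h by auto
  have r: "range (\<lambda>n. \<phi> (g n) v) \<subseteq> T" "range (\<lambda>n. \<phi> (h n) v) \<subseteq> T"
    using gF hF act_closed base by auto
  obtain \<kappa> C where \<kappa>: "\<kappa> > 0" "\<And>g h. g \<in> F \<Longrightarrow> h \<in> F \<Longrightarrow>
    \<kappa> * real (common_prefix g h) - C \<le> gromov_product d v (\<phi> g v) (\<phi> h v)"
    using gromov_product_ge_common_prefix by blast
  show ?thesis
    unfolding products_diverge_iff[OF base r]
  proof
    fix R
    obtain N where N: "\<forall>i\<ge>N. \<forall>j\<ge>N. (R + C) / \<kappa> \<le> gromov_product prefix_dist [] (g i) (h j)"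
      using div unfolding W.products_diverge_iff[OF nil g h] by blast
    have "R \<le> gromov_product d v (\<phi> (g i) v) (\<phi> (h j) v)" if "i \<ge> N" "j \<ge> N" for i j
    proof -
      have "(R + C) / \<kappa> \<le> real (common_prefix (g i) (h j))"
        using N that by (simp add: gromov_product_prefix_dist)
      then have "R + C \<le> \<kappa> * real (common_prefix (g i) (h j))" using \<kappa>(1) by (simp add: field_simps)
      then show ?thesis using \<kappa>(2)[OF gF[of i] hF[of j]] by linarith
    qed
    then show "\<exists>N. \<forall>i\<ge>N. \<forall>j\<ge>N. R \<le> gromov_product d v (\<phi> (g i) v) (\<phi> (h j) v)" by blast
  qed
qed

lemma boundary_ident_memI:
  assumes g: "g \<in> p" and gF: "range g \<subseteq> F" and div: "products_diverge F prefix_dist g g"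
    and c: "range c \<subseteq> T" "products_diverge T d (\<lambda>n. \<phi> (g n) v) c"
  shows "c \<in> boundary_ident T d \<phi> p"
proof -
  let ?A = "\<lambda>n. \<phi> (g n) v"
  have AT: "range ?A \<subseteq> T" using gF act_closed base by auto
  have "products_diverge T d c c"
    using products_diverge_trans[OF c(1) AT c(1) products_diverge_sym[OF AT c] c(2)] .
  then have "(?A, c) \<in> gromov_rel T d"
    using c AT orbit_products_diverge[OF gF gF div]
    by (simp add: gromov_rel_def converges_to_infinity_def)
  moreover have "?A \<in> {(\<lambda>n. \<phi> (g n) x) | g x. g \<in> p \<and> x \<in> T}" using g base by blast
  ultimately show ?thesis unfolding boundary_ident_def by blast
qed

text \<open>Distinct boundary points have representatives whose common prefixes stay bounded;
  \<open>common_prefix_lower_bound\<close> carries this over to the tree, where the line is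
  constructed.\<close>

lemma geodesic_exists:
  assumes p: "p \<in> free_boundary r" and q: "q \<in> free_boundary r" and pq: "p \<noteq> q"
  shows "\<exists>c. geodesic_from_to T d \<phi> p q c"
proof -
  interpret W: gromov_space F prefix_dist 0 by (rule gromov_space_prefix_dist)
  have nil: "[] \<in> F" by (simp add: carrier_free_group reduced_def)
  obtain g where g: "converges_to_infinity F prefix_dist g" "p = gromov_rel F prefix_dist `` {g}"
    using p unfolding free_boundary_eq gromov_boundary_def quotient_def by blast
  obtain h where h: "converges_to_infinity F prefix_dist h" "q = gromov_rel F prefix_dist `` {h}"
    using q unfolding free_boundary_eq gromov_boundary_def quotient_def by blast
  have gp: "g \<in> p" "h \<in> q" using g h equiv_class_self[OF W.equiv_gromov_rel] by simp_all
  have gF: "range g \<subseteq> F" "products_diverge F prefix_dist g g" and hF: "range h \<subseteq> F" "products_diverge F prefix_dist h h"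
    using g h by (auto simp: converges_to_infinity_def)
  have "(g, h) \<notin> gromov_rel F prefix_dist"
    using pq g h equiv_class_eq[OF W.equiv_gromov_rel] by blast
  then have "\<not> products_diverge F prefix_dist g h" using g h by (simp add: gromov_rel_def)
  then obtain R N where R: "\<forall>i\<ge>N. \<forall>j\<ge>N. gromov_product prefix_dist [] (g i) (h j) \<le> R"
    using W.bounded_if_not_divergent[OF nil gF hF] by blast
  obtain \<kappa> C where \<kappa>: "\<kappa> > 0" "\<And>g h. g \<in> F \<Longrightarrow> h \<in> F \<Longrightarrow>
    \<kappa> * gromov_product d v (\<phi> g v) (\<phi> h v) - C \<le> real (common_prefix g h)"
    using common_prefix_lower_bound by blast
  let ?A = "\<lambda>n. \<phi> (g n) v" and ?B = "\<lambda>n. \<phi> (h n) v"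
  have AB: "range ?A \<subseteq> T" "range ?B \<subseteq> T" using gF hF act_closed base by auto
  have "\<forall>i\<ge>N. \<forall>j\<ge>N. gromov_product d v (?A i) (?B j) \<le> (R + C) / \<kappa>"
  proof (intro allI impI)
    fix i j assume "i \<ge> N" "j \<ge> N"
    then have "real (common_prefix (g i) (h j)) \<le> R" using R by (simp add: gromov_product_prefix_dist)
    moreover have "g i \<in> F" "h j \<in> F" using gF hF by auto
    ultimately have "\<kappa> * gromov_product d v (?A i) (?B j) \<le> R + C" using \<kappa>(2)[of "g i" "h j"] by linarith
    then show "gromov_product d v (?A i) (?B j) \<le> (R + C) / \<kappa>" using \<kappa>(1) by (simp add: field_simps)
  qed
  then obtain c where c: "range c \<subseteq> T" "\<forall>s t. d (c s) (c t) = \<bar>s - t\<bar>"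
    "products_diverge T d ?A (\<lambda>n. c (- real n))" "products_diverge T d ?B (\<lambda>n. c (real n))"
    using line_exists[OF base AB(1) orbit_products_diverge[OF gF(1,1,2)] AB(2) orbit_products_diverge[OF hF(1,1,2)]] by blast
  have "(\<lambda>n. c (- real n)) \<in> boundary_ident T d \<phi> p"
    by (rule boundary_ident_memI[OF gp(1) gF _ c(3)]) (use c(1) in auto)
  moreover have "(\<lambda>n. c (real n)) \<in> boundary_ident T d \<phi> q"
    by (rule boundary_ident_memI[OF gp(2) hF _ c(4)]) (use c(1) in auto)
  ultimately show ?thesis using c(1,2) unfolding geodesic_from_to_def by blast
qed

end


section \<open>Sets covered by subexponentially many small sets\<close>

lemma infsum_ennreal_le:
  fixes f :: "'a \<Rightarrow> ennreal"
  assumes "\<And>F. finite F \<Longrightarrow> F \<subseteq> A \<Longrightarrow> sum f F \<le> c"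
  shows "infsum f A \<le> c"
proof -
  have "infsum f A = (SUP F\<in>{F. finite F \<and> F \<subseteq> A}. sum f F)"
    by (rule nonneg_infsum_complete) simp
  also have "\<dots> \<le> c" using assms by (intro SUP_least) auto
  finally show ?thesis .
qed

lemma sum_UN_le_ennreal:
  fixes f :: "'a \<Rightarrow> ennreal"
  assumes "\<And>k. finite (A k)"
  shows "sum f (\<Union>k<m. A k) \<le> (\<Sum>k<m::nat. sum f (A k))"
proof (induction m)
  case (Suc m)
  have "sum f (\<Union>k<Suc m. A k) \<le> sum f (\<Union>k<Suc m. A k) + sum f ((\<Union>k<m. A k) \<inter> A m)" by simp
  also have "\<dots> = sum f (\<Union>k<m. A k) + sum f (A m)"
    using assms by (subst sum.union_inter[symmetric]) (auto simp: lessThan_Suc Un_commute)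
  also have "\<dots> \<le> (\<Sum>k<Suc m. sum f (A k))" using Suc by (simp add: add_right_mono)
  finally show ?case .
qed simp

lemma ediam_le: "(\<And>x y. x \<in> U \<Longrightarrow> y \<in> U \<Longrightarrow> d x y \<le> c) \<Longrightarrow> ediam d U \<le> ennreal c"
  by (auto simp: ediam_def intro!: SUP_least ennreal_leI)

lemma diam_power_le:
  assumes s: "s > 0" and c: "c \<ge> 0" and U: "ediam d U \<le> ennreal c"
  shows "diam_power d s U \<le> ennreal (c powr s)"
proof (cases "U = {}")
  case False
  have "ediam d U \<noteq> \<infinity>" using U by (auto simp: top_unique)
  moreover have "enn2real (ediam d U) \<le> c" using U c by (rule enn2real_leI[rotated])
  ultimately show ?thesis using False s by (auto simp: diam_power_def intro!: ennreal_leI powr_mono2)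
qed (simp add: diam_power_def)

text \<open>A form of upper box dimension zero: the number of sets needed at scale
  \<open>\<rho> ^ n\<close> is subexponential in \<open>n\<close>. All data may depend on
  \<open>S\<close>. The sets are kept inside \<open>S\<close>, so they also lie in any ambient space
  containing it.\<close>

definition subexponentially_covered :: "('a \<Rightarrow> 'a \<Rightarrow> real) \<Rightarrow> 'a set \<Rightarrow> bool" where
  "subexponentially_covered d S \<longleftrightarrow> (\<exists>C>0. \<exists>\<rho>>0. \<rho> < 1 \<and> (\<exists>(f :: nat \<Rightarrow> nat) n0.
     (\<forall>b>1. (\<lambda>n. real (f n) / b ^ n) \<longlonglongrightarrow> 0) \<and>
     (\<forall>n\<ge>n0. \<exists>\<U>. finite \<U> \<and> card \<U> \<le> f n \<and> S \<subseteq> \<Union>\<U> \<and>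
        (\<forall>U\<in>\<U>. U \<subseteq> S \<and> (\<forall>x\<in>U. \<forall>y\<in>U. d x y \<le> C * \<rho> ^ n)))))"

lemma subexponentially_coveredE:
  assumes "subexponentially_covered d S"
  obtains C \<rho> f n0 where "C > 0" "\<rho> > 0" "\<rho> < 1"
    "\<And>b. b > 1 \<Longrightarrow> (\<lambda>n. real (f n) / b ^ n) \<longlonglongrightarrow> 0"
    "\<And>n. n \<ge> n0 \<Longrightarrow> \<exists>\<U>. finite \<U> \<and> card \<U> \<le> (f n :: nat) \<and> S \<subseteq> \<Union>\<U> \<and>
        (\<forall>U\<in>\<U>. U \<subseteq> S \<and> (\<forall>x\<in>U. \<forall>y\<in>U. d x y \<le> C * \<rho> ^ n))"
proof -
  obtain C \<rho> f n0 where *: "C > 0" "\<rho> > 0" "\<rho> < 1"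
    "\<forall>b>1. (\<lambda>n. real (f n) / b ^ n) \<longlonglongrightarrow> 0"
    "\<forall>n\<ge>n0. \<exists>\<U>. finite \<U> \<and> card \<U> \<le> (f n :: nat) \<and> S \<subseteq> \<Union>\<U> \<and>
        (\<forall>U\<in>\<U>. U \<subseteq> S \<and> (\<forall>x\<in>U. \<forall>y\<in>U. d x y \<le> C * \<rho> ^ n))"
    using assms unfolding subexponentially_covered_def by (elim exE conjE) (rule that)
  show thesis by (rule that[OF *(1-3) *(4)[rule_format] *(5)[rule_format]])
qed

lemma subexponentially_covered_empty: "subexponentially_covered d {}"
  unfolding subexponentially_covered_def
  by (intro exI[of _ 1] exI[of _ "1/2"] conjI exI[of _ "\<lambda>_. 0"] exI[of _ 0] allI impI
      exI[of _ "{}"]) auto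

lemma powr_power_commute: "\<rho> > 0 \<Longrightarrow> (\<rho> ^ n) powr s = (\<rho> powr s) ^ n" for \<rho> s :: real
  by (induction n) (simp_all add: powr_mult)

text \<open>The sum at level \<open>n\<close> is at most a constant times
  \<open>f n / b ^ n\<close>, where \<open>b = 1 / (\<rho> powr s)\<close> exceeds 1, and this tends
  to 0.\<close>

lemma cover_small_sum:
  assumes S: "subexponentially_covered d S" and s: "s > 0" and \<delta>: "\<delta> > 0" and \<epsilon>: "\<epsilon> > 0"
  shows "\<exists>\<U>. finite \<U> \<and> S \<subseteq> \<Union>\<U> \<and> (\<forall>U\<in>\<U>. U \<subseteq> S \<and> ediam d U \<le> ennreal \<delta>)
    \<and> sum (diam_power d s) \<U> \<le> ennreal \<epsilon>"
proof -
  obtain C \<rho> f n0 where C: "C > 0" and \<rho>: "\<rho> > 0" "\<rho> < 1"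
    and f: "\<And>b. b > 1 \<Longrightarrow> (\<lambda>n. real (f n) / b ^ n) \<longlonglongrightarrow> 0"
    and cov: "\<And>n. n \<ge> n0 \<Longrightarrow> \<exists>\<U>. finite \<U> \<and> card \<U> \<le> (f n :: nat) \<and> S \<subseteq> \<Union>\<U> \<and>
        (\<forall>U\<in>\<U>. U \<subseteq> S \<and> (\<forall>x\<in>U. \<forall>y\<in>U. d x y \<le> C * \<rho> ^ n))"
    by (rule subexponentially_coveredE[OF S]) (rule that; assumption)
  define b where "b = 1 / (\<rho> powr s)"
  have "\<rho> powr s < 1" using \<rho> s powr_less_mono2[of s \<rho> 1] by simp
  then have b: "b > 1" using \<rho> by (simp add: b_def)
  have "(\<lambda>n. C powr s * (real (f n) / b ^ n)) \<longlonglongrightarrow> C powr s * 0"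
    by (intro tendsto_mult f b tendsto_const)
  then have "(\<lambda>n. C powr s * (real (f n) / b ^ n)) \<longlonglongrightarrow> 0" by simp
  then have "\<forall>\<^sub>F n in sequentially. C powr s * (real (f n) / b ^ n) < \<epsilon>"
    using \<epsilon> by (simp add: order_tendstoD)
  moreover have "(\<lambda>n. C * \<rho> ^ n) \<longlonglongrightarrow> C * 0"
    using \<rho> by (intro tendsto_mult tendsto_const LIMSEQ_realpow_zero) auto
  then have "(\<lambda>n. C * \<rho> ^ n) \<longlonglongrightarrow> 0" by simp
  then have "\<forall>\<^sub>F n in sequentially. C * \<rho> ^ n < \<delta>"
    using \<delta> by (simp add: order_tendstoD)
  moreover note eventually_ge_at_top[of n0]
  ultimately have "\<forall>\<^sub>F n in sequentially. C powr s * (real (f n) / b ^ n) < \<epsilon> \<and> C * \<rho> ^ n < \<delta> \<and> n \<ge> n0"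
    by eventually_elim auto
  then obtain n where n: "C powr s * (real (f n) / b ^ n) < \<epsilon>" "C * \<rho> ^ n < \<delta>" "n \<ge> n0"
    unfolding eventually_sequentially by blast
  obtain \<U> where U: "finite \<U>" "card \<U> \<le> f n" "S \<subseteq> \<Union>\<U>" and
    U': "\<forall>U\<in>\<U>. U \<subseteq> S \<and> (\<forall>x\<in>U. \<forall>y\<in>U. d x y \<le> C * \<rho> ^ n)"
    using cov[OF n(3)] by (elim exE conjE) (rule that)
  have ed: "ediam d U \<le> ennreal (C * \<rho> ^ n)" if "U \<in> \<U>" for U
    using U' that by (intro ediam_le) auto
  have "(C * \<rho> ^ n) powr s = C powr s * (1 / b ^ n)"
    using C \<rho> by (simp add: powr_mult powr_power_commute b_def power_divide)
  then have "sum (diam_power d s) \<U> \<le> (\<Sum>U\<in>\<U>. ennreal (C powr s * (1 / b ^ n)))"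
    using ed diam_power_le[OF s _ ed] C \<rho> by (intro sum_mono) (simp add: less_imp_le)
  also have "\<dots> = ennreal (real (card \<U>) * (C powr s * (1 / b ^ n)))"
    using b by (simp add: ennreal_of_nat_eq_real_of_nat ennreal_mult[symmetric])
  also have "\<dots> \<le> ennreal (real (f n) * (C powr s * (1 / b ^ n)))"
    using U(2) b by (intro ennreal_leI mult_right_mono) auto
  also have "\<dots> \<le> ennreal \<epsilon>" using n(1) by (intro ennreal_leI) (simp add: mult.commute)
  finally have "sum (diam_power d s) \<U> \<le> ennreal \<epsilon>" .
  moreover have "ediam d U \<le> ennreal \<delta>" if "U \<in> \<U>" for U
    using ed[OF that] n(2) by (meson ennreal_leI less_imp_le order_trans)
  ultimately show ?thesis using U U' by (intro exI[of _ \<U>]) simp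
qed

text \<open>Countable subadditivity, proved directly: the \<open>k\<close>-th piece is covered with
  error \<open>\<epsilon> / 2 ^ (k + 1)\<close>, and the sum over the union of the covers is
  controlled through its finite subsets.\<close>

lemma hausdorff_measure_eq_0:
  assumes "countable \<S>" and cov: "\<And>S'. S' \<in> \<S> \<Longrightarrow> subexponentially_covered d S'"
    and S: "S \<subseteq> \<Union>\<S>" and M: "\<Union>\<S> \<subseteq> M" and s: "s > 0"
  shows "hausdorff_measure M d s S = 0"
proof -
  \<comment> \<open>The empty set is added so that the enumeration exists even when there are no
    pieces.\<close>
  define A where "A = from_nat_into (insert {} \<S>)"
  have range: "range A = insert {} \<S>"
    unfolding A_def using assms(1) by (intro range_from_nat_into) auto
  have A: "subexponentially_covered d (A k)" "A k \<subseteq> M" for k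
  proof -
    have "A k \<in> insert {} \<S>" using range by blast
    then show "subexponentially_covered d (A k)" "A k \<subseteq> M"
      using cov M subexponentially_covered_empty by auto
  qed
  have "hausdorff_premeasure M d s \<delta> S \<le> 0" if \<delta>: "\<delta> > 0" for \<delta>
  proof (rule ennreal_le_epsilon)
    fix \<epsilon> :: real assume \<epsilon>: "\<epsilon> > 0"
    have "\<forall>k. \<exists>\<U>. finite \<U> \<and> A k \<subseteq> \<Union>\<U> \<and> (\<forall>U\<in>\<U>. U \<subseteq> A k \<and> ediam d U \<le> ennreal \<delta>)
      \<and> sum (diam_power d s) \<U> \<le> ennreal (\<epsilon> * (1/2) ^ Suc k)"
      using cover_small_sum[OF A(1) s \<delta>] \<epsilon> by simp
    then obtain \<U> where U: "\<And>k. finite (\<U> k)" "\<And>k. A k \<subseteq> \<Union>(\<U> k)"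
      "\<And>k U. U \<in> \<U> k \<Longrightarrow> U \<subseteq> A k" "\<And>k U. U \<in> \<U> k \<Longrightarrow> ediam d U \<le> ennreal \<delta>"
      "\<And>k. sum (diam_power d s) (\<U> k) \<le> ennreal (\<epsilon> * (1/2) ^ Suc k)" by metis
    let ?U = "\<Union>k. \<U> k"
    have fin: "sum (diam_power d s) F \<le> ennreal \<epsilon>" if F: "finite F" "F \<subseteq> ?U" for F
    proof -
      have "\<exists>m. F \<subseteq> (\<Union>k<m. \<U> k)"
        using F
      proof (induction F rule: finite_induct)
        case (insert x F)
        then obtain m k where "F \<subseteq> (\<Union>k<m. \<U> k)" "x \<in> \<U> k" by auto
        then have "insert x F \<subseteq> (\<Union>k<max m (Suc k). \<U> k)" by fastforce
        then show ?case by blast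
      qed simp
      then obtain m where m: "F \<subseteq> (\<Union>k<m. \<U> k)" by blast
      have "sum (diam_power d s) F \<le> sum (diam_power d s) (\<Union>k<m. \<U> k)"
        using m U(1) by (intro sum_mono2) auto
      also have "\<dots> \<le> (\<Sum>k<m. sum (diam_power d s) (\<U> k))" by (rule sum_UN_le_ennreal[OF U(1)])
      also have "\<dots> \<le> (\<Sum>k<m. ennreal (\<epsilon> * (1/2) ^ Suc k))" by (intro sum_mono U)
      also have "\<dots> = ennreal (\<Sum>k<m. \<epsilon> * (1/2) ^ Suc k)" using \<epsilon> by (intro sum_ennreal) auto
      also have "(\<Sum>k<m. \<epsilon> * (1/2) ^ Suc k) = \<epsilon> * (1 - (1/2) ^ m)"
        by (induction m) (auto simp: field_simps)
      also have "ennreal \<dots> \<le> ennreal \<epsilon>" using \<epsilon> by (intro ennreal_leI) (auto simp: mult_le_cancel_left1)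
      finally show ?thesis .
    qed
    have "?U \<in> {\<U>. countable \<U> \<and> S \<subseteq> \<Union>\<U> \<and> (\<forall>U\<in>\<U>. U \<subseteq> M \<and> ediam d U \<le> ennreal \<delta>)}"
    proof -
      have "countable ?U" using U(1) by (intro countable_UN) (auto intro: countable_finite)
      moreover have "S \<subseteq> \<Union>?U"
      proof
        fix x assume "x \<in> S"
        then obtain S' where "S' \<in> \<S>" "x \<in> S'" using S by blast
        then obtain k where "x \<in> A k" using range by (metis UNIV_I imageE insertCI)
        then show "x \<in> \<Union>?U" using U(2)[of k] by blast
      qed
      moreover have "U \<subseteq> M \<and> ediam d U \<le> ennreal \<delta>" if "U \<in> ?U" for U
        using that U(3,4) A(2) by blast
      ultimately show ?thesis by blast
    qed
    then have "hausdorff_premeasure M d s \<delta> S \<le> infsum (diam_power d s) ?U"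
      unfolding hausdorff_premeasure_def by (rule INF_lower)
    also have "\<dots> \<le> ennreal \<epsilon>" by (rule infsum_ennreal_le) (use fin in blast)
    finally show "hausdorff_premeasure M d s \<delta> S \<le> 0 + ennreal \<epsilon>" by simp
  qed
  then have "hausdorff_measure M d s S \<le> 0"
    unfolding hausdorff_measure_def by (intro SUP_least) auto
  then show ?thesis by simp
qed

text \<open>Balls of a packing that have diameter greater than \<open>2 C \<rho>\<^sup>n\<close> have centres more than
  \<open>C \<rho>\<^sup>n\<close> apart, so there are at most as many of them as sets in a cover of mesh \<open>C \<rho>\<^sup>n\<close>.
  Note that the diameter of a ball may be much smaller than its radius.\<close>

lemma (in Metric_space) card_packing_le:
  assumes S: "S \<subseteq> M" and cov: "finite \<U>" "S \<subseteq> \<Union>\<U>" "\<And>U x y. U \<in> \<U> \<Longrightarrow> x \<in> U \<Longrightarrow> y \<in> U \<Longrightarrow> d x y \<le> c"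
    and F: "disjoint F" "\<And>B. B \<in> F \<Longrightarrow> \<exists>x\<in>S. \<exists>\<rho>>0. B = mcball x \<rho>"
    and big: "\<And>B. B \<in> F \<Longrightarrow> ediam d B > ennreal (2 * c)"
  shows "card F \<le> card \<U>"
proof -
  obtain x \<rho> where x: "\<And>B. B \<in> F \<Longrightarrow> x B \<in> S" "\<And>B. B \<in> F \<Longrightarrow> \<rho> B > 0"
    "\<And>B. B \<in> F \<Longrightarrow> B = mcball (x B) (\<rho> B)" using F(2) by metis
  have "\<exists>U. U \<in> \<U> \<and> x B \<in> U" if "B \<in> F" for B using cov(2) x(1)[OF that] by blast
  then obtain u where u: "\<And>B. B \<in> F \<Longrightarrow> u B \<in> \<U>" "\<And>B. B \<in> F \<Longrightarrow> x B \<in> u B" by metis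
  have xM: "x B \<in> M" if "B \<in> F" for B using x(1)[OF that] S by blast
  have "inj_on u F"
  proof (rule inj_onI, rule ccontr)
    fix B B' assume B: "B \<in> F" "B' \<in> F" "u B = u B'" "B \<noteq> B'"
    have "x B' \<in> mcball (x B') (\<rho> B')" using xM B x(2)[OF B(2)] by simp
    then have "x B' \<in> B'" using x(3)[OF B(2)] by simp
    then have "x B' \<notin> B" using F(1) B by (auto simp: disjoint_def)
    then have "x B' \<notin> mcball (x B) (\<rho> B)" using x(3)[OF B(1)] by simp
    then have le1: "d (x B) (x B') > \<rho> B" using xM B by (auto simp: not_le)
    have le2: "d (x B) (x B') \<le> c"
      using cov(3)[OF u(1)[OF B(1)] u(2)[OF B(1)]] u(2)[OF B(2)] B(3) by simp
    have "ediam d B \<le> ennreal (2 * \<rho> B)"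
    proof (rule ediam_le)
      fix y z assume "y \<in> B" "z \<in> B"
      then have "y \<in> mcball (x B) (\<rho> B)" "z \<in> mcball (x B) (\<rho> B)" using x(3)[OF B(1)] by auto
      then show "d y z \<le> 2 * \<rho> B" using triangle[of y "x B" z] by (auto simp: commute)
    qed
    with big[OF B(1)] have "ennreal (2 * c) < ennreal (2 * \<rho> B)" by (rule less_le_trans)
    then have "\<not> ennreal (2 * \<rho> B) \<le> ennreal (2 * c)" by simp
    moreover have "ennreal (2 * \<rho> B) \<le> ennreal (2 * c)" if "\<rho> B \<le> c"
      using that by (intro ennreal_leI) simp
    ultimately have "c < \<rho> B" by (metis not_le)
    then show False using le1 le2 by linarith
  qed
  moreover have "u ` F \<subseteq> \<U>" using u by blast
  ultimately show ?thesis using cov(1) by (metis card_inj_on_le)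
qed

text \<open>The balls are sorted by scale, the least \<open>n\<close> with
  \<open>2 * C * \<rho> ^ n\<close> below the diameter. By \<open>card_packing_le\<close> at most
  \<open>f n\<close> of them have scale \<open>n\<close>, so the sum is dominated by a convergent
  series, and small \<delta> leaves only its tail.\<close>

lemma (in Metric_space) packing_sum_small:
  assumes cov: "subexponentially_covered d S" and S: "S \<subseteq> M" and s: "s > 0" and \<epsilon>: "\<epsilon> > 0"
  shows "\<exists>\<delta>0>0. \<forall>\<delta>. \<delta> \<le> \<delta>0 \<longrightarrow> (\<forall>\<B>\<in>packings M d \<delta> S. infsum (diam_power d s) \<B> \<le> ennreal \<epsilon>)"
proof -
  obtain C \<rho> f n0 where C: "C > 0" and \<rho>: "\<rho> > 0" "\<rho> < 1"
    and f: "\<And>b. b > 1 \<Longrightarrow> (\<lambda>n. real (f n) / b ^ n) \<longlonglongrightarrow> 0"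
    and cov: "\<And>n. n \<ge> n0 \<Longrightarrow> \<exists>\<U>. finite \<U> \<and> card \<U> \<le> (f n :: nat) \<and> S \<subseteq> \<Union>\<U> \<and>
        (\<forall>U\<in>\<U>. U \<subseteq> S \<and> (\<forall>x\<in>U. \<forall>y\<in>U. d x y \<le> C * \<rho> ^ n))"
    by (rule subexponentially_coveredE[OF cov]) (rule that; assumption)
  \<comment> \<open>Half of the exponential decay absorbs \<open>f n\<close>; the other half leaves
    a geometric series.\<close>
  define \<sigma> where "\<sigma> = \<rho> powr (s / 2)"
  have \<sigma>: "\<sigma> > 0" "\<sigma> < 1" using \<rho> s powr_less_mono2[of "s / 2" \<rho> 1] by (auto simp: \<sigma>_def)
  have \<sigma>2: "\<rho> powr s = \<sigma> * \<sigma>" using \<rho> by (simp add: \<sigma>_def powr_add[symmetric])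
  \<comment> \<open>The exponent \<open>n - 1\<close> appears because minimality of the scale bounds
    the diameter at the preceding level.\<close>
  define u where "u n = real (f n) * (2 * C * \<rho> ^ (n - 1)) powr s" for n
  have u_nonneg: "u n \<ge> 0" for n by (simp add: u_def)
  define K where "K = (2 * C) powr s / (\<rho> powr s)"
  have K: "K \<ge> 0" by (simp add: K_def)
  have u_eq: "u n = K * (real (f n) * \<sigma> ^ n) * \<sigma> ^ n" if n1: "n \<ge> 1" for n
  proof -
    obtain m where n: "n = Suc m" using n1 by (cases n) auto
    have "(2 * C * \<rho> ^ m) powr s = (2 * C) powr s * (\<sigma> * \<sigma>) ^ m"
      using C \<rho> by (simp add: powr_mult powr_power_commute \<sigma>2)
    then have "u n = real (f n) * ((2 * C) powr s * (\<sigma> * \<sigma>) ^ m)" by (simp add: u_def n)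
    also have "\<dots> = K * (real (f n) * \<sigma> ^ n) * \<sigma> ^ n"
      using \<sigma> by (simp add: n K_def \<sigma>2 power_mult_distrib)
    finally show ?thesis .
  qed
  have "(\<lambda>n. real (f n) / (1 / \<sigma>) ^ n) \<longlonglongrightarrow> 0" using \<sigma> by (intro f) auto
  then have "\<forall>\<^sub>F n in sequentially. real (f n) / (1 / \<sigma>) ^ n < 1"
    by (simp add: order_tendstoD)
  moreover note eventually_ge_at_top[of 1]
  ultimately have "\<forall>\<^sub>F n in sequentially. norm (u n) \<le> K * \<sigma> ^ n"
  proof eventually_elim
    case (elim n)
    have "K * (real (f n) * \<sigma> ^ n) * \<sigma> ^ n \<le> K * 1 * \<sigma> ^ n"
      using elim K \<sigma> by (intro mult_right_mono mult_left_mono) (auto simp: power_divide field_simps)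
    then show ?case using u_eq[of n] elim u_nonneg[of n] by simp
  qed
  moreover have "summable (\<lambda>n. K * \<sigma> ^ n)" using \<sigma> by (intro summable_mult summable_geometric) auto
  ultimately have "summable u" by (rule summable_comparison_test_ev)
  then obtain N0 where N0: "\<And>n. n \<ge> N0 \<Longrightarrow> norm (\<Sum>i. u (i + n)) < \<epsilon>"
    using suminf_exist_split[OF \<epsilon>] by blast
  define N where "N = max N0 n0"
  have tail: "sum u I \<le> \<epsilon>" if "finite I" "\<And>n. n \<in> I \<Longrightarrow> n \<ge> N" for I
  proof -
    have "sum u I = sum (\<lambda>i. u (i + N)) ((\<lambda>n. n - N) ` I)"
      using that by (subst sum.reindex) (auto intro!: inj_onI dest: eq_diff_iff[THEN iffD1, rotated 2])
    also have "\<dots> \<le> (\<Sum>i. u (i + N))"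
      using that \<open>summable u\<close> u_nonneg by (intro sum_le_suminf) (auto simp: summable_iff_shift)
    also have "\<dots> \<le> \<epsilon>" using N0[of N] by (simp add: N_def)
    finally show ?thesis .
  qed
  \<comment> \<open>This bound on \<delta> forces every scale to exceed \<open>N\<close>, so only
    the tail occurs and the covers exist.\<close>
  have "infsum (diam_power d s) \<B> \<le> ennreal \<epsilon>" if \<delta>: "\<delta> \<le> C * \<rho> ^ N" and B: "\<B> \<in> packings M d \<delta> S" for \<delta> \<B>
  proof (rule infsum_ennreal_le)
    fix F assume F: "finite F" "F \<subseteq> \<B>"
    have "disjoint \<B>" using B by (simp add: packings_def)
    then have dF: "disjoint F" using F(2) by (rule pairwise_subset)
    have ball: "\<exists>x\<in>S. \<exists>\<rho>>0. A = mcball x \<rho>" if "A \<in> F" for A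
      using F B that by (auto simp: packings_def)
    have small: "ediam d A \<le> ennreal (C * \<rho> ^ N)" if "A \<in> F" for A
    proof -
      have "ediam d A \<le> ennreal \<delta>" using F B that by (auto simp: packings_def)
      then show ?thesis using ennreal_leI[OF \<delta>] by (rule order_trans)
    qed
    \<comment> \<open>A ball of diameter 0 has no scale, but it contributes nothing as
      \<open>s\<close> is positive.\<close>
    define F' where "F' = {A\<in>F. ediam d A > 0}"
    have "\<exists>n. ennreal (2 * (C * \<rho> ^ n)) < ediam d A" if "A \<in> F'" for A
    proof -
      have "ediam d A \<noteq> top_class.top" "ediam d A > 0" using small[of A] that by (auto simp: F'_def top_unique)
      then have pos: "enn2real (ediam d A) / (2 * C) > 0"
        using C by (auto simp: enn2real_positive_iff less_top)
      then obtain n where "\<rho> ^ n < enn2real (ediam d A) / (2 * C)"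
        using real_arch_pow_inv[OF pos \<rho>(2)] by blast
      then have "2 * (C * \<rho> ^ n) < enn2real (ediam d A)" using C by (simp add: field_simps)
      then have "ennreal (2 * (C * \<rho> ^ n)) < ennreal (enn2real (ediam d A))"
        using C \<rho> by (simp only: ennreal_less_iff mult_nonneg_nonneg less_imp_le zero_le_power zero_le_numeral)
      also have "\<dots> = ediam d A" using \<open>ediam d A \<noteq> top_class.top\<close> by (simp add: less_top)
      finally show ?thesis by blast
    qed
    then have ex: "\<exists>n. ennreal (2 * (C * \<rho> ^ n)) < ediam d A" if "A \<in> F'" for A using that by blast
    define l where "l A = (LEAST n. ennreal (2 * (C * \<rho> ^ n)) < ediam d A)" for A
    have l: "ennreal (2 * (C * \<rho> ^ l A)) < ediam d A" if "A \<in> F'" for A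
      unfolding l_def by (rule LeastI_ex[OF ex[OF that]])
    have lN: "l A > N" if "A \<in> F'" for A
    proof (rule ccontr)
      assume "\<not> l A > N"
      then have "C * \<rho> ^ N \<le> C * \<rho> ^ l A" using \<rho> C by (intro mult_left_mono power_decreasing) auto
      also have "\<dots> \<le> 2 * (C * \<rho> ^ l A)" using \<rho> C by simp
      finally have "ediam d A \<le> ennreal (2 * (C * \<rho> ^ l A))"
        using small[of A] that by (auto simp: F'_def intro: order_trans ennreal_leI)
      then show False using l[OF that] by simp
    qed
    have upper: "ediam d A \<le> ennreal (2 * C * \<rho> ^ (l A - 1))" if "A \<in> F'" for A
    proof -
      have "l A - 1 < l A" using lN[OF that] by simp
      then have "\<not> ennreal (2 * (C * \<rho> ^ (l A - 1))) < ediam d A"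
        unfolding l_def by (rule not_less_Least)
      then show ?thesis by (simp add: mult.assoc)
    qed
    have card: "card {A\<in>F'. l A = n} \<le> f n" if n: "n > N" for n
    proof -
      have n0: "n \<ge> n0" using n by (simp add: N_def)
      obtain \<U> where U: "finite \<U>" "card \<U> \<le> f n" "S \<subseteq> \<Union>\<U>" and
        U': "\<forall>U\<in>\<U>. U \<subseteq> S \<and> (\<forall>x\<in>U. \<forall>y\<in>U. d x y \<le> C * \<rho> ^ n)"
        using cov[OF n0] by (elim exE conjE) (rule that)
      have "card {A\<in>F'. l A = n} \<le> card \<U>"
      proof (rule card_packing_le[OF S U(1,3), where c = "C * \<rho> ^ n"])
        show "d x y \<le> C * \<rho> ^ n" if "U \<in> \<U>" "x \<in> U" "y \<in> U" for U x y
          using U' that by simp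
        show "disjoint {A \<in> F'. l A = n}" using dF by (auto simp: disjoint_def F'_def)
      qed (use ball l in \<open>auto simp: F'_def\<close>)
      then show ?thesis using U by simp
    qed
    have finF': "finite F'" using F by (simp add: F'_def)
    have "sum (diam_power d s) F = sum (diam_power d s) F'"
    proof (rule sum.mono_neutral_right)
      show "\<forall>A\<in>F - F'. diam_power d s A = 0"
        using s by (auto simp: F'_def diam_power_def)
    qed (use F in \<open>auto simp: F'_def\<close>)
    also have "\<dots> \<le> (\<Sum>A\<in>F'. ennreal ((2 * C * \<rho> ^ (l A - 1)) powr s))"
      using C \<rho> by (intro sum_mono diam_power_le s upper) auto
    also have "\<dots> = (\<Sum>n\<in>l ` F'. \<Sum>A\<in>{A\<in>F'. l A = n}. ennreal ((2 * C * \<rho> ^ (l A - 1)) powr s))"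
      by (rule sum.image_gen[OF finF'])
    also have "\<dots> \<le> (\<Sum>n\<in>l ` F'. ennreal (u n))"
    proof (rule sum_mono)
      fix n assume "n \<in> l ` F'"
      then have n: "n > N" using lN by auto
      have "(\<Sum>A\<in>{A\<in>F'. l A = n}. ennreal ((2 * C * \<rho> ^ (l A - 1)) powr s))
          = of_nat (card {A\<in>F'. l A = n}) * ennreal ((2 * C * \<rho> ^ (n - 1)) powr s)" by simp
      also have "\<dots> = ennreal (real (card {A\<in>F'. l A = n}) * (2 * C * \<rho> ^ (n - 1)) powr s)"
        by (simp add: ennreal_of_nat_eq_real_of_nat ennreal_mult[symmetric])
      also have "\<dots> \<le> ennreal (u n)"
        unfolding u_def using card[OF n] by (intro ennreal_leI mult_right_mono) auto
      finally show "(\<Sum>A\<in>{A\<in>F'. l A = n}. ennreal ((2 * C * \<rho> ^ (l A - 1)) powr s)) \<le> ennreal (u n)" .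
    qed
    also have "\<dots> = ennreal (sum u (l ` F'))" using u_nonneg by (intro sum_ennreal)
    also have "\<dots> \<le> ennreal \<epsilon>" using finF' lN by (intro ennreal_leI tail) (auto simp: less_imp_le)
    finally show "sum (diam_power d s) F \<le> ennreal \<epsilon>" .
  qed
  moreover have "C * \<rho> ^ N > 0" using C \<rho> by simp
  ultimately show ?thesis by blast
qed

lemma (in Metric_space) packing_premeasure_eq_0:
  assumes cov: "subexponentially_covered d S" and S: "S \<subseteq> M" and s: "s > 0"
  shows "packing_premeasure M d s S = 0"
proof -
  let ?P = "\<lambda>\<delta>. SUP \<B>\<in>packings M d \<delta> S. infsum (diam_power d s) \<B>"
  \<comment> \<open>The premeasure is a \<open>Lim\<close>, so convergence has to be established
    before its value can be computed.\<close>
  have "(?P \<longlongrightarrow> 0) (at_right 0)"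
  proof (rule order_tendstoI)
    fix a :: ennreal assume "0 < a"
    obtain \<epsilon> where \<epsilon>: "\<epsilon> > 0" "ennreal \<epsilon> < a"
    proof (cases a)
      case (real q)
      then show thesis using \<open>0 < a\<close> that[of "q / 2"] by (simp add: ennreal_less_iff)
    qed (use that[of 1] in simp)
    obtain \<delta>0 where \<delta>0: "\<delta>0 > 0"
      "\<And>\<delta> \<B>. \<delta> \<le> \<delta>0 \<Longrightarrow> \<B> \<in> packings M d \<delta> S \<Longrightarrow> infsum (diam_power d s) \<B> \<le> ennreal \<epsilon>"
      using packing_sum_small[OF cov S s \<epsilon>(1)] by blast
    have "?P \<delta> < a" if "\<delta> < \<delta>0" for \<delta>
    proof -
      have "?P \<delta> \<le> ennreal \<epsilon>" using that by (intro SUP_least \<delta>0(2)) auto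
      then show ?thesis using \<epsilon>(2) by (rule le_less_trans)
    qed
    then show "\<forall>\<^sub>F \<delta> in at_right 0. ?P \<delta> < a"
      using \<delta>0(1) unfolding eventually_at_right_field by blast
  qed simp
  then show ?thesis
    unfolding packing_premeasure_def by (intro tendsto_Lim) auto
qed

lemma ennreal_Inf_pos_eq_0:
  assumes "\<And>s. s > 0 \<Longrightarrow> P s"
  shows "Inf (ennreal ` {s. 0 \<le> s \<and> P s}) = 0"
proof -
  have "Inf (ennreal ` {s. 0 \<le> s \<and> P s}) \<le> 0"
  proof (rule ennreal_le_epsilon)
    fix e :: real assume "0 < e"
    then have "ennreal e \<in> ennreal ` {s. 0 \<le> s \<and> P s}" using assms by auto
    then show "Inf (ennreal ` {s. 0 \<le> s \<and> P s}) \<le> 0 + ennreal e" by (simp add: Inf_lower)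
  qed
  then show ?thesis by simp
qed

text \<open>For packings the pieces themselves are the countable cover required by the definition,
  and each has premeasure 0.\<close>

lemma (in Metric_space) dimensions_eq_0:
  assumes "countable \<S>" and cov: "\<And>S'. S' \<in> \<S> \<Longrightarrow> subexponentially_covered d S'"
    and S: "S \<subseteq> \<Union>\<S>" and M: "\<Union>\<S> \<subseteq> M"
  shows "hausdorff_dim M d S = 0" "packing_dim M d S = 0"
proof -
  show "hausdorff_dim M d S = 0"
    unfolding hausdorff_dim_def
    using hausdorff_measure_eq_0[OF assms] by (rule ennreal_Inf_pos_eq_0)
  have "packing_measure M d s S = 0" if s: "s > 0" for s
  proof -
    have "packing_measure M d s S \<le> (\<Sum>\<^sub>\<infinity>S'\<in>\<S>. packing_premeasure M d s S')"
      unfolding packing_measure_def using assms by (intro INF_lower) auto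
    also have "\<dots> = (\<Sum>\<^sub>\<infinity>S'\<in>\<S>. 0)"
      using packing_premeasure_eq_0 cov M s by (intro infsum_cong) blast
    finally show ?thesis by simp
  qed
  then show "packing_dim M d S = 0"
    unfolding packing_dim_def by (rule ennreal_Inf_pos_eq_0)
qed


section \<open>The visual metric\<close>

text \<open>The covering sets are the fibres of \<open>key n\<close>.\<close>

lemma subexponentially_coveredI:
  fixes key :: "nat \<Rightarrow> 'a \<Rightarrow> 'k"
  assumes C: "C > 0" and \<rho>: "\<rho> > 0" "\<rho> < 1" and f: "\<And>b. b > 1 \<Longrightarrow> (\<lambda>n. real (f n) / b ^ n) \<longlonglongrightarrow> 0"
    and fin: "\<And>n. n \<ge> N \<Longrightarrow> finite (key n ` S)" and card: "\<And>n. n \<ge> N \<Longrightarrow> card (key n ` S) \<le> f n"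
    and small: "\<And>n x y. n \<ge> N \<Longrightarrow> x \<in> S \<Longrightarrow> y \<in> S \<Longrightarrow> key n x = key n y \<Longrightarrow> d x y \<le> C * \<rho> ^ n"
  shows "subexponentially_covered d S"
proof -
  have "\<exists>\<U>. finite \<U> \<and> card \<U> \<le> f n \<and> S \<subseteq> \<Union>\<U> \<and>
      (\<forall>U\<in>\<U>. U \<subseteq> S \<and> (\<forall>x\<in>U. \<forall>y\<in>U. d x y \<le> C * \<rho> ^ n))" if n: "n \<ge> N" for n
  proof -
    let ?U = "(\<lambda>k. {x \<in> S. key n x = k}) ` key n ` S"
    have "finite ?U" using fin[OF n] by simp
    moreover have "card ?U \<le> f n" using card_image_le[OF fin[OF n]] card[OF n] by (meson order_trans)
    moreover have "S \<subseteq> \<Union>?U" by auto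
    moreover have "\<forall>U\<in>?U. U \<subseteq> S \<and> (\<forall>x\<in>U. \<forall>y\<in>U. d x y \<le> C * \<rho> ^ n)" using small[OF n] by auto
    ultimately show ?thesis by (intro exI[of _ ?U] conjI)
  qed
  then show ?thesis
    unfolding subexponentially_covered_def using C \<rho> f
    by (intro exI[of _ C] exI[of _ \<rho>] conjI exI[of _ f] exI[of _ N]) simp_all
qed

lemma subexponentially_covered_image:
  assumes "subexponentially_covered d S" and le: "\<And>x y. x \<in> S \<Longrightarrow> y \<in> S \<Longrightarrow> d' (h x) (h y) \<le> d x y"
  shows "subexponentially_covered d' (h ` S)"
proof (rule subexponentially_coveredE[OF assms(1)])
  fix C \<rho> :: real and f :: "nat \<Rightarrow> nat" and n0
  assume *: "C > 0" "\<rho> > 0" "\<rho> < 1" "\<And>b. b > 1 \<Longrightarrow> (\<lambda>n. real (f n) / b ^ n) \<longlonglongrightarrow> 0"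
    and cov: "\<And>n. n \<ge> n0 \<Longrightarrow> \<exists>\<U>. finite \<U> \<and> card \<U> \<le> f n \<and> S \<subseteq> \<Union>\<U> \<and>
        (\<forall>U\<in>\<U>. U \<subseteq> S \<and> (\<forall>x\<in>U. \<forall>y\<in>U. d x y \<le> C * \<rho> ^ n))"
  have "\<exists>\<U>. finite \<U> \<and> card \<U> \<le> f n \<and> h ` S \<subseteq> \<Union>\<U> \<and>
      (\<forall>U\<in>\<U>. U \<subseteq> h ` S \<and> (\<forall>x\<in>U. \<forall>y\<in>U. d' x y \<le> C * \<rho> ^ n))" if n: "n \<ge> n0" for n
  proof -
    obtain \<U> where U: "finite \<U>" "card \<U> \<le> f n" "S \<subseteq> \<Union>\<U>" and
      U': "\<forall>U\<in>\<U>. U \<subseteq> S \<and> (\<forall>x\<in>U. \<forall>y\<in>U. d x y \<le> C * \<rho> ^ n)"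
      using cov[OF n] by (elim exE conjE) (rule that)
    have "card ((`) h ` \<U>) \<le> f n" using card_image_le[OF U(1), of "(`) h"] U(2) by simp
    moreover have "d' (h x) (h y) \<le> C * \<rho> ^ n" if "U \<in> \<U>" "x \<in> U" "y \<in> U" for U x y
      using le[of x y] U' that by (meson order_trans subsetD)
    moreover have "h ` S \<subseteq> \<Union>((`) h ` \<U>)" using U(3) by blast
    moreover have "\<forall>V\<in>(`) h ` \<U>. V \<subseteq> h ` S" using U' by blast
    ultimately show ?thesis using U(1) by (intro exI[of _ "(`) h ` \<U>"] conjI) auto
  qed
  then show ?thesis
    unfolding subexponentially_covered_def using *
    by (intro exI[of _ C] exI[of _ \<rho>] conjI exI[of _ f] exI[of _ n0]) simp_all
qed

lemma neg_power_le:
  assumes a: "a > 1" and t: "ereal m \<le> t"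
  shows "neg_power a t \<le> a powr (- m)"
  using assms by (cases t) (auto simp: neg_power_def)

lemma Metric_space_max_dist:
  assumes "Metric_space M d"
  shows "Metric_space (M \<times> M) (max_dist d)"
proof -
  interpret Metric_space M d by fact
  show ?thesis
  proof
    fix x y z :: "'a \<times> 'a"
    show "0 \<le> max_dist d x y" "max_dist d x y = max_dist d y x"
      by (auto simp: max_dist_def commute split: prod.splits) (simp add: le_max_iff_disj)
    assume xy: "x \<in> M \<times> M" "y \<in> M \<times> M"
    show "max_dist d x y = 0 \<longleftrightarrow> x = y"
    proof
      assume "max_dist d x y = 0"
      then have "d (fst x) (fst y) \<le> 0" "d (snd x) (snd y) \<le> 0"
        by (auto simp: max_dist_def max_def split: prod.splits if_splits)
      then have "d (fst x) (fst y) = 0" "d (snd x) (snd y) = 0"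
        using nonneg by (auto intro: antisym)
      then show "x = y" using xy by (simp add: mem_Times_iff prod_eq_iff)
    qed (use xy in \<open>auto simp: max_dist_def\<close>)
    assume z: "z \<in> M \<times> M"
    show "max_dist d x z \<le> max_dist d x y + max_dist d y z"
      using xy z triangle[of "fst x" "fst y" "fst z"] triangle[of "snd x" "snd y" "snd z"]
      by (auto simp: max_dist_def split: prod.splits)
  qed
qed

section \<open>From agreement of lines in the tree to closeness of their ends\<close>

context outer_space_tree
begin

lemma free_boundary_seq:
  assumes "q \<in> free_boundary r" "g \<in> q"
  shows "range g \<subseteq> F" "products_diverge F prefix_dist g g"
  using assms unfolding free_boundary_eq gromov_boundary_def quotient_def
  by (auto simp: gromov_rel_def converges_to_infinity_def)

text \<open>The identification of boundaries allows any point \<open>x\<close> of the tree; passing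
  to \<open>v\<close> moves each term by at most \<open>d x v\<close>.\<close>

lemma geodesic_end:
  assumes q: "q \<in> free_boundary r" and c: "geodesic_from_to T d \<phi> p q c"
  obtains g where "g \<in> q" "products_diverge T d (\<lambda>n. \<phi> (g n) v) (\<lambda>n. c (real n))"
proof -
  have "(\<lambda>n. c (real n)) \<in> boundary_ident T d \<phi> q" using c by (simp add: geodesic_from_to_def)
  then obtain g x where g: "g \<in> q" "x \<in> T" "((\<lambda>n. \<phi> (g n) x), (\<lambda>n. c (real n))) \<in> gromov_rel T d"
    unfolding boundary_ident_def by blast
  have gF: "g n \<in> F" for n using free_boundary_seq(1)[OF q g(1)] by blast
  have "range (\<lambda>n. \<phi> (g n) x) \<subseteq> T" "range (\<lambda>n. \<phi> (g n) v) \<subseteq> T" "range (\<lambda>n. c (real n)) \<subseteq> T"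
    using gF g(2) base act_closed c by (auto simp: geodesic_from_to_def)
  moreover have "d (\<phi> (g n) x) (\<phi> (g n) v) \<le> d x v" for n using gF g(2) base by (simp add: act_dist)
  moreover have "products_diverge T d (\<lambda>n. \<phi> (g n) x) (\<lambda>n. c (real n))" using g(3) by (simp add: gromov_rel_def)
  ultimately have "products_diverge T d (\<lambda>n. \<phi> (g n) v) (\<lambda>n. c (real n))"
    by (rule bounded_perturbation_diverge)
  then show thesis using that g(1) by blast
qed

text \<open>Seen from \<open>c t\<close>, three products are at least \<open>s\<close>: first orbit
  sequence with first line, line with line, second line with second orbit sequence. Moving the base
  point to \<open>v\<close> costs \<open>d v (c t)\<close>.\<close>

lemma ends_gromov_product:
  assumes q: "q \<in> free_boundary r" "q' \<in> free_boundary r"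
    and c: "geodesic_from_to T d \<phi> p q c" "geodesic_from_to T d \<phi> p' q' c'"
    and t: "c t = c' t'" and s: "s \<ge> 0" "c (t + s) = c' (t' + s)"
  obtains g g' N where "g \<in> q" "g' \<in> q'"
    "\<And>i j. i \<ge> N \<Longrightarrow> j \<ge> N \<Longrightarrow> s - d v (c t) \<le> gromov_product d v (\<phi> (g i) v) (\<phi> (g' j) v)"
proof -
  have line: "line c" "line c'" using c by (auto simp: geodesic_from_to_def line_def)
  obtain g where g: "g \<in> q" "products_diverge T d (\<lambda>n. \<phi> (g n) v) (\<lambda>n. c (real n))"
    using geodesic_end[OF q(1) c(1)] .
  obtain g' where g': "g' \<in> q'" "products_diverge T d (\<lambda>n. \<phi> (g' n) v) (\<lambda>n. c' (real n))"
    using geodesic_end[OF q(2) c(2)] .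
  have T: "\<phi> (g n) v \<in> T" "\<phi> (g' n) v \<in> T" for n
    using free_boundary_seq(1)[OF q(1) g(1)] free_boundary_seq(1)[OF q(2) g'(1)] act_closed base by auto
  note cT = lineD(1)[OF line(1)] and cT' = lineD(1)[OF line(2)]
  have rT: "range (\<lambda>n. \<phi> (g n) v) \<subseteq> T" "range (\<lambda>n. \<phi> (g' n) v) \<subseteq> T" "range (\<lambda>n. c (real n)) \<subseteq> T" "range (\<lambda>n. c' (real n)) \<subseteq> T"
    using T cT cT' by auto
  let ?b = "c t"
  obtain N1 where N1: "\<forall>i\<ge>N1. \<forall>j\<ge>N1. s \<le> gromov_product d ?b (\<phi> (g i) v) (c (real j))"
    using g(2) unfolding products_diverge_iff[OF cT[of t] rT(1,3)] by blast
  obtain N2 where N2: "\<forall>i\<ge>N2. \<forall>j\<ge>N2. s \<le> gromov_product d ?b (\<phi> (g' i) v) (c' (real j))"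
    using g'(2) unfolding products_diverge_iff[OF cT[of t] rT(2,4)] by blast
  \<comment> \<open>Parameter \<open>n\<close> must lie beyond the last common point on both lines,
    whose parameters may differ.\<close>
  define n where "n = max (max N1 N2) (max (nat \<lceil>t + s\<rceil>) (nat \<lceil>t' + s\<rceil>))"
  have n: "n \<ge> N1" "n \<ge> N2" "n \<ge> nat \<lceil>t + s\<rceil>" "n \<ge> nat \<lceil>t' + s\<rceil>"
    unfolding n_def by (simp_all only: le_max_iff_disj order_refl simp_thms)
  then have n': "real n \<ge> t + s" "real n \<ge> t' + s" by linarith+
  have "s - d v ?b \<le> gromov_product d v (\<phi> (g i) v) (\<phi> (g' j) v)" if "i \<ge> n" "j \<ge> n" for i j
  proof -
    have "s \<le> gromov_product d ?b (\<phi> (g i) v) (c (real n))" using N1 n that by simp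
    moreover have "s \<le> gromov_product d ?b (c (real n)) (c' (real n))"
      using line_gromov_product[OF line t s n'] .
    moreover have "s \<le> gromov_product d ?b (c' (real n)) (\<phi> (g' j) v)"
      using N2 n that gromov_product_commute[OF cT' T(2)] by simp
    ultimately have "s \<le> gromov_product d ?b (\<phi> (g i) v) (\<phi> (g' j) v)"
      using gromov_product_min[OF cT[of t] T(1)[of i] cT[of "real n"] T(2)[of j]]
        gromov_product_min[OF cT[of t] cT[of "real n"] cT'[of "real n"] T(2)[of j]] by simp
    then show ?thesis using gromov_product_base[OF cT[of t] base T(1)[of i] T(2)[of j]] by (simp add: commute)
  qed
  then show thesis using that g(1) g'(1) by blast
qed

end

text \<open>The actions \<phi> on \<open>T\<close> and \<psi> on \<open>X\<close> are related only
  through the group, that is, through their orbit maps.\<close>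

locale visual_boundary = outer_space_tree r T d \<phi> v
  for r and T :: "'t set" and d \<phi> v +
  fixes X :: "'x set" and dX \<psi> x0 a dB
  assumes proper: "proper_space X dX" and geodesic: "geodesic_space X dX"
    and hyperbolic: "gromov_hyperbolic X dX" and geometric: "geometric_action (free_group r) X dX \<psi>"
    and x0: "x0 \<in> X" and a: "a > 1" and visual: "visual_metric r X dX \<psi> x0 a dB"
begin

lemma actX: "isometric_action (free_group r) X dX \<psi>"
  using geometric by (simp add: geometric_action_def)

sublocale X: Metric_space X dX
  using actX by (simp add: isometric_action_def)

lemma actX_closed: "g \<in> F \<Longrightarrow> x \<in> X \<Longrightarrow> \<psi> g x \<in> X"
  using actX unfolding isometric_action_def by (auto intro: group_action.element_image)

lemma actX_dist_inv:
  assumes "g \<in> F" "h \<in> F"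
  shows "dX (\<psi> g x0) (\<psi> h x0) = dX x0 (\<psi> (inv_F g \<cdot> h) x0)"
proof -
  have gact: "group_action (free_group r) X \<psi>" using actX by (simp add: isometric_action_def)
  let ?k = "inv_F g \<cdot> h"
  have k: "?k \<in> F" using assms by simp
  have "g \<cdot> ?k = h" using assms by (simp add: free_group.m_assoc[symmetric])
  then have "\<psi> h x0 = \<psi> g (\<psi> ?k x0)"
    using group_action.composition_rule[OF gact x0 assms(1) k] by simp
  then show ?thesis using actX assms(1) x0 actX_closed[OF k x0] by (simp add: isometric_action_def)
qed

text \<open>\<open>norm_le_displacement\<close> on \<open>X\<close>, with displacement in
  \<open>T\<close> as the norm. Elements that nearly return a large ball to itself are finite in
  number because balls are compact and the action is properly discontinuous.\<close>

lemma tree_displacement_le: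
  "\<exists>\<Lambda>>0. \<forall>g\<in>F. d v (\<phi> g v) \<le> \<Lambda> * (dX x0 (\<psi> g x0) + 1)"
proof -
  obtain K where K: "compactin X.mtopology K" "X = (\<Union>g\<in>F. \<psi> g ` K)"
    using geometric unfolding geometric_action_def cocompact_action_def by blast
  have "X.mbounded K" using K(1) by (rule X.compactin_imp_mbounded)
  then obtain y b where yb: "K \<subseteq> X.mcball y b" by (auto simp: X.mbounded_def)
  define \<rho> where "\<rho> = max 0 (dX x0 y + b)"
  \<comment> \<open>The radius is increased by 1, the step size, to contain both ends of a
    step.\<close>
  let ?K = "X.mcball x0 \<rho>" and ?K1 = "X.mcball x0 (\<rho> + 1)"
  have KK: "K \<subseteq> ?K"
  proof
    fix k assume "k \<in> K"
    then have "k \<in> X" "y \<in> X" "dX y k \<le> b" using yb by auto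
    then show "k \<in> ?K" using X.triangle[OF x0 \<open>y \<in> X\<close> \<open>k \<in> X\<close>] x0 by (simp add: \<rho>_def)
  qed
  have "compactin X.mtopology ?K1" using proper x0 by (simp add: proper_space_def)
  then have fin: "finite {g \<in> F. \<psi> g ` ?K1 \<inter> ?K1 \<noteq> {}}"
    using geometric unfolding geometric_action_def properly_discontinuous_action_def by blast
  define B where "B = Max (insert 0 ((\<lambda>g. d v (\<phi> g v)) ` {g \<in> F. \<psi> g ` ?K1 \<inter> ?K1 \<noteq> {}}))"
  have B: "B \<ge> 0" unfolding B_def using fin by (intro Max_ge) auto
  have "d v (\<phi> g v) \<le> B * (dX x0 (\<psi> g x0) / 1 + 2)" if "g \<in> F" for g
  proof (rule norm_le_displacement[where N = "\<lambda>g. d v (\<phi> g v)" and K = ?K, OF actX geodesic _ _ _ _ B _ _ that])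
    show "X \<subseteq> (\<Union>g\<in>F. \<psi> g ` ?K)" using K(2) KK by blast
    show "x0 \<in> ?K" using x0 by (simp add: \<rho>_def)
    show "d v (\<phi> (g \<cdot> h) v) \<le> d v (\<phi> g v) + d v (\<phi> h v)" if "g \<in> F" "h \<in> F" for g h
    proof -
      have "d v (\<phi> g (\<phi> h v)) \<le> d v (\<phi> g v) + d (\<phi> g v) (\<phi> g (\<phi> h v))"
        using that base act_closed by (intro triangle) auto
      then show ?thesis using that base by (simp add: act_mult act_dist act_closed)
    qed
    show "d v (\<phi> g v) \<le> B" if g: "g \<in> F" and k: "k \<in> ?K" "k' \<in> ?K" "dX k (\<psi> g k') \<le> 1" for g k k'
    proof -
      have kX: "k \<in> X" "k' \<in> X" "\<psi> g k' \<in> X" "dX x0 k \<le> \<rho>" using k g actX_closed by auto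
      then have "\<psi> g k' \<in> ?K1" using X.triangle[OF x0 kX(1,3)] k(3) x0 by simp
      moreover have "k' \<in> ?K1" using k(2) by auto
      ultimately have "\<psi> g ` ?K1 \<inter> ?K1 \<noteq> {}" by blast
      then show ?thesis unfolding B_def using fin g by (intro Max_ge) auto
    qed
  qed auto
  then have "\<forall>g\<in>F. d v (\<phi> g v) \<le> (2 * B + 1) * (dX x0 (\<psi> g x0) + 1)"
  proof (intro ballI)
    fix g assume g: "g \<in> F" and *: "\<And>g. g \<in> F \<Longrightarrow> d v (\<phi> g v) \<le> B * (dX x0 (\<psi> g x0) / 1 + 2)"
    have "0 \<le> B * dX x0 (\<psi> g x0)" using B by simp
    then show "d v (\<phi> g v) \<le> (2 * B + 1) * (dX x0 (\<psi> g x0) + 1)"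
      using *[OF g] X.nonneg[of x0 "\<psi> g x0"] B by (simp only: distrib_left distrib_right)
  qed
  moreover have "2 * B + 1 > 0" using B by simp
  ultimately show ?thesis by blast
qed

lemma gromov_product_ge_tree:
  "\<exists>\<kappa>>0. \<exists>C. \<forall>g\<in>F. \<forall>h\<in>F.
    \<kappa> * gromov_product d v (\<phi> g v) (\<phi> h v) - C \<le> gromov_product dX x0 (\<psi> g x0) (\<psi> h x0)"
proof -
  obtain \<delta> where \<delta>: "delta_hyperbolic X dX \<delta>" using hyperbolic by (auto simp: gromov_hyperbolic_def)
  obtain \<Lambda> where \<Lambda>: "\<Lambda> > 0" "\<And>g. g \<in> F \<Longrightarrow> d v (\<phi> g v) \<le> \<Lambda> * (dX x0 (\<psi> g x0) + 1)"
    using tree_displacement_le by blast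
  obtain B where B: "\<forall>g\<in>F. \<forall>h\<in>F. d (\<phi> g v) (\<phi> h v) \<le> 2 * D + 1 \<longrightarrow> dX (\<psi> g x0) (\<psi> h x0) \<le> B"
    using bounded_on_close_pairs[of "\<lambda>g h. dX (\<psi> g x0) (\<psi> h x0)" "\<lambda>g. dX x0 (\<psi> g x0)" "2 * D + 1"] actX_dist_inv
    by blast
  show ?thesis
  proof (rule gromov_product_lower_bound[where D = D and B = B and \<Lambda> = \<Lambda>])
    show "gromov_space X dX \<delta>"
      using \<delta> X.Metric_space_axioms by (simp add: gromov_space_def gromov_space_axioms_def)
    show "(\<lambda>g. \<phi> g v) ` F \<subseteq> T" using act_closed base by blast
    show "(\<lambda>g. \<psi> g x0) ` F \<subseteq> X" using actX_closed x0 by blast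
    show "\<exists>g\<in>F. d x (\<phi> g v) \<le> D" if "x \<in> T" for x using orbit_dense[OF that] .
    show "dX (\<psi> g x0) (\<psi> h x0) \<le> B" if "g \<in> F" "h \<in> F" "d (\<phi> g v) (\<phi> h v) \<le> 2 * D + 1" for g h
      using B that by simp
  qed (use \<Lambda> base x0 in auto)
qed

text \<open>What has to be checked is that the orbit sequence converges to infinity in
  \<open>X\<close>: otherwise \<open>gromov_rel\<close> would not relate it to anything.\<close>

lemma boundary_ident_orbit:
  assumes q: "q \<in> free_boundary r" and g: "g \<in> q"
  shows "(\<lambda>n. \<psi> (g n) x0) \<in> boundary_ident X dX \<psi> q"
proof -
  obtain \<kappa> C where \<kappa>: "\<kappa> > 0" "\<And>g h. g \<in> F \<Longrightarrow> h \<in> F \<Longrightarrow>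
    \<kappa> * gromov_product d v (\<phi> g v) (\<phi> h v) - C \<le> gromov_product dX x0 (\<psi> g x0) (\<psi> h x0)"
    using gromov_product_ge_tree by blast
  note gF = free_boundary_seq[OF q g]
  have gF': "g n \<in> F" for n using gF(1) by blast
  let ?A = "\<lambda>n. \<psi> (g n) x0" and ?B = "\<lambda>n. \<phi> (g n) v"
  have A: "range ?A \<subseteq> X" and B: "range ?B \<subseteq> T" using gF' actX_closed act_closed x0 base by auto
  have "products_diverge X dX ?A ?A"
    unfolding X.products_diverge_iff[OF x0 A A]
  proof
    fix R
    obtain N where N: "\<forall>i\<ge>N. \<forall>j\<ge>N. (R + C) / \<kappa> \<le> gromov_product d v (?B i) (?B j)"
      using orbit_products_diverge[OF gF(1,1,2)] unfolding products_diverge_iff[OF base B B] by blast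
    have "R \<le> gromov_product dX x0 (?A i) (?A j)" if "i \<ge> N" "j \<ge> N" for i j
    proof -
      have "R + C \<le> \<kappa> * gromov_product d v (?B i) (?B j)" using N that \<kappa>(1) by (simp add: field_simps)
      then show ?thesis using \<kappa>(2)[OF gF'[of i] gF'[of j]] by linarith
    qed
    then show "\<exists>N. \<forall>i\<ge>N. \<forall>j\<ge>N. R \<le> gromov_product dX x0 (?A i) (?A j)" by blast
  qed
  then have "(?A, ?A) \<in> gromov_rel X dX" using A by (simp add: gromov_rel_def converges_to_infinity_def)
  moreover have "?A \<in> {(\<lambda>n. \<psi> (g n) x) | g x. g \<in> q \<and> x \<in> X}" using g x0 by blast
  ultimately show ?thesis unfolding boundary_ident_def by blast
qed

text \<open>The boundary product is a supremum over representatives, so one good pair bounds it from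
  below and hence the distance from above. The quantifiers make \<rho> independent of
  \<open>b\<close>, while \<open>C\<close> involves \<open>d v b\<close>.\<close>

lemma visual_dist_le:
  "\<exists>\<rho>>0. \<rho> < 1 \<and> (\<forall>b. \<exists>C>0. \<forall>q\<in>free_boundary r. \<forall>q'\<in>free_boundary r. \<forall>p p' c c' t t' s n.
    geodesic_from_to T d \<phi> p q c \<longrightarrow> geodesic_from_to T d \<phi> p' q' c' \<longrightarrow> c t = b \<longrightarrow> c' t' = b \<longrightarrow>
    s \<ge> 0 \<longrightarrow> s > real n - gap \<longrightarrow> c (t + s) = c' (t' + s) \<longrightarrow> dB q q' \<le> C * \<rho> ^ n)"
proof -
  obtain \<kappa> C1 where \<kappa>: "\<kappa> > 0" "\<And>g h. g \<in> F \<Longrightarrow> h \<in> F \<Longrightarrow>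
    \<kappa> * gromov_product d v (\<phi> g v) (\<phi> h v) - C1 \<le> gromov_product dX x0 (\<psi> g x0) (\<psi> h x0)"
    using gromov_product_ge_tree by blast
  obtain C2 where C2: "C2 \<ge> 1" "\<And>p q. p \<in> free_boundary r \<Longrightarrow> q \<in> free_boundary r \<Longrightarrow>
      dB p q \<le> C2 * neg_power a (boundary_product dX x0 (boundary_ident X dX \<psi> p) (boundary_ident X dX \<psi> q))"
    using visual unfolding visual_metric_def Let_def by blast
  define \<rho> where "\<rho> = a powr (- \<kappa>)"
  have \<rho>: "\<rho> > 0" "\<rho> < 1" using a \<kappa>(1) powr_less_cancel_iff[OF a, of "- \<kappa>" 0] by (auto simp: \<rho>_def)
  have "dB q q' \<le> (C2 * a powr (\<kappa> * (gap + d v b) + C1)) * \<rho> ^ n"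
    if q: "q \<in> free_boundary r" "q' \<in> free_boundary r"
      and c: "geodesic_from_to T d \<phi> p q c" "geodesic_from_to T d \<phi> p' q' c'"
      and t: "c t = b" "c' t' = b" and s: "s \<ge> 0" "s > real n - gap" "c (t + s) = c' (t' + s)"
    for b q q' p p' c c' t t' s n
  proof -
    have tt: "c t = c' t'" using t by simp
    obtain g g' N where g: "g \<in> q" "g' \<in> q'"
      and N: "\<And>i j. i \<ge> N \<Longrightarrow> j \<ge> N \<Longrightarrow> s - d v (c t) \<le> gromov_product d v (\<phi> (g i) v) (\<phi> (g' j) v)"
      using ends_gromov_product[OF q c tt s(1,3)] by blast
    \<comment> \<open>\<open>gap\<close> is lost by cutting at a branch point, \<open>d v b\<close>
      by moving the base point from \<open>b\<close> to \<open>v\<close>; \<kappa> and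
      \<open>C1\<close> come from the comparison with \<open>X\<close>.\<close>
    define m where "m = \<kappa> * (real n - gap - d v b) - C1"
    have gF: "g i \<in> F" "g' i \<in> F" for i
      using free_boundary_seq(1)[OF q(1) g(1)] free_boundary_seq(1)[OF q(2) g(2)] by auto
    have "m \<le> gromov_product dX x0 (\<psi> (g i) x0) (\<psi> (g' j) x0)" if "i \<ge> N" "j \<ge> N" for i j
    proof -
      have "real n - gap - d v b \<le> gromov_product d v (\<phi> (g i) v) (\<phi> (g' j) v)"
        using N[OF that] s(2) t by simp
      then have "\<kappa> * (real n - gap - d v b) \<le> \<kappa> * gromov_product d v (\<phi> (g i) v) (\<phi> (g' j) v)"
        using \<kappa>(1) by simp
      then show ?thesis using \<kappa>(2)[OF gF(1)[of i] gF(2)[of j]] by (simp add: m_def)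
    qed
    then have "\<forall>\<^sub>F x in sequentially \<times>\<^sub>F sequentially.
        ereal m \<le> (case x of (i, j) \<Rightarrow> ereal (gromov_product dX x0 (\<psi> (g i) x0) (\<psi> (g' j) x0)))"
      unfolding eventually_prod_sequentially by auto
    then have "ereal m \<le> Liminf (sequentially \<times>\<^sub>F sequentially)
        (\<lambda>(i, j). ereal (gromov_product dX x0 (\<psi> (g i) x0) (\<psi> (g' j) x0)))"
      by (rule Liminf_bounded)
    also have "\<dots> \<le> boundary_product dX x0 (boundary_ident X dX \<psi> q) (boundary_ident X dX \<psi> q')"
      unfolding boundary_product_def
      by (rule SUP_upper2[of "(\<lambda>n. \<psi> (g n) x0, \<lambda>n. \<psi> (g' n) x0)"])
        (use boundary_ident_orbit[OF q(1) g(1)] boundary_ident_orbit[OF q(2) g(2)] in auto)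
    finally have "neg_power a (boundary_product dX x0 (boundary_ident X dX \<psi> q) (boundary_ident X dX \<psi> q')) \<le> a powr (- m)"
      by (rule neg_power_le[OF a])
    then have "dB q q' \<le> C2 * a powr (- m)"
      using C2(2)[OF q] C2(1) by (meson mult_left_mono order_trans zero_le_one)
    also have "a powr (- m) = a powr (\<kappa> * (gap + d v b) + C1) * \<rho> ^ n"
    proof -
      have "\<rho> ^ n = a powr (- \<kappa> * real n)"
        using a by (simp add: \<rho>_def powr_realpow[symmetric] powr_powr)
      moreover have "- m = \<kappa> * (gap + d v b) + C1 + - \<kappa> * real n" by (simp add: m_def algebra_simps)
      ultimately show ?thesis by (simp only: powr_add)
    qed
    finally show ?thesis by (simp add: mult.assoc)
  qed
  moreover have "C2 * a powr (\<kappa> * (gap + d v b) + C1) > 0" for b using C2(1) a by simp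
  ultimately have "\<exists>C>0. \<forall>q\<in>free_boundary r. \<forall>q'\<in>free_boundary r. \<forall>p p' c c' t t' s n.
    geodesic_from_to T d \<phi> p q c \<longrightarrow> geodesic_from_to T d \<phi> p' q' c' \<longrightarrow> c t = b \<longrightarrow> c' t' = b \<longrightarrow>
    s \<ge> 0 \<longrightarrow> s > real n - gap \<longrightarrow> c (t + s) = c' (t' + s) \<longrightarrow> dB q q' \<le> C * \<rho> ^ n" for b
    by (intro exI[of _ "C2 * a powr (\<kappa> * (gap + d v b) + C1)"] conjI ballI allI impI)
  then show ?thesis using \<rho> by (intro exI[of _ \<rho>]) simp
qed

end


section \<open>Coding leaves by pairs of edge-paths\<close>

lemma geodesic_from_to_reverse:
  assumes "geodesic_from_to T d \<phi> p q c"
  shows "geodesic_from_to T d \<phi> q p (\<lambda>x. c (- x))"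
  using assms by (auto simp: geodesic_from_to_def)

lemma algebraic_laminationD:
  assumes "algebraic_lamination r L"
  shows "L \<subseteq> free_boundary2 r" "\<And>p q. (p, q) \<in> L \<Longrightarrow> (q, p) \<in> L"
proof -
  have "L \<subseteq> topspace (subtopology (prod_topology (free_boundary_topology r) (free_boundary_topology r))
       (free_boundary2 r))"
    using assms unfolding algebraic_lamination_def by (blast dest: closedin_subset)
  then show "L \<subseteq> free_boundary2 r" by (simp add: topspace_subtopology)
  show "\<And>p q. (p, q) \<in> L \<Longrightarrow> (q, p) \<in> L" using assms unfolding algebraic_lamination_def by blast
qed

text \<open>A leaf is coded by two words, one for each end, so the number of codes is bounded by a
  square; subexponentiality is applied to \<open>sqrt b\<close>.\<close>

lemma subexponential_square:
  assumes f: "subexponential f" and b: "b > (1 :: real)"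
  shows "(\<lambda>n. real ((f n)\<^sup>2) / b ^ n) \<longlonglongrightarrow> 0"
proof -
  have "sqrt b > 1" using b by simp
  then have "(\<lambda>n. real (f n) / sqrt b ^ n) \<longlonglongrightarrow> 0" using f by (simp add: subexponential_def)
  then have "(\<lambda>n. (real (f n) / sqrt b ^ n)\<^sup>2) \<longlonglongrightarrow> 0\<^sup>2" by (rule tendsto_power)
  moreover have "(real (f n) / sqrt b ^ n)\<^sup>2 = real ((f n)\<^sup>2) / b ^ n" for n
  proof -
    have "(sqrt b ^ n)\<^sup>2 = (sqrt b ^ 2) ^ n" by (simp only: power_mult[symmetric] mult.commute)
    then have "(sqrt b ^ n)\<^sup>2 = b ^ n" using b by simp
    then show ?thesis by (simp add: power_divide)
  qed
  ultimately show ?thesis by simp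
qed

context visual_boundary
begin

definition leaves_through where
  "leaves_through L b = {x \<in> L. \<exists>c t. geodesic_from_to T d \<phi> (fst x) (snd x) c \<and> c t = b}"

text \<open>The forward code controls the second end. The first end is the second end of the
  reversed line, which represents a leaf because \<open>L\<close> is symmetric, so the backward code
  controls it in the same way.\<close>

lemma leaves_through_covered:
  assumes L: "algebraic_lamination r L" and growth: "subexponential (lamination_growth r T d \<phi> L)"
    and b: "b \<in> branch_points T d"
  shows "subexponentially_covered (max_dist dB) (leaves_through L b)"
proof -
  let ?S = "leaves_through L b"
  have bdry: "p \<in> free_boundary r" "q \<in> free_boundary r" if "(p, q) \<in> L" for p q
    using that algebraic_laminationD(1)[OF L] by (auto simp: free_boundary2_def)
  obtain \<rho> where \<rho>: "\<rho> > 0" "\<rho> < 1" and *: "\<forall>b. \<exists>C>0. \<forall>q\<in>free_boundary r. \<forall>q'\<in>free_boundary r. \<forall>p p' c c' t t' s n.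
    geodesic_from_to T d \<phi> p q c \<longrightarrow> geodesic_from_to T d \<phi> p' q' c' \<longrightarrow> c t = b \<longrightarrow> c' t' = b \<longrightarrow>
    s \<ge> 0 \<longrightarrow> s > real n - gap \<longrightarrow> c (t + s) = c' (t' + s) \<longrightarrow> dB q q' \<le> C * \<rho> ^ n"
    using visual_dist_le by (elim exE conjE) (rule that)
  obtain C where C: "C > 0" and **: "\<forall>q\<in>free_boundary r. \<forall>q'\<in>free_boundary r. \<forall>p p' c c' t t' s n.
    geodesic_from_to T d \<phi> p q c \<longrightarrow> geodesic_from_to T d \<phi> p' q' c' \<longrightarrow> c t = b \<longrightarrow> c' t' = b \<longrightarrow>
    s \<ge> 0 \<longrightarrow> s > real n - gap \<longrightarrow> c (t + s) = c' (t' + s) \<longrightarrow> dB q q' \<le> C * \<rho> ^ n"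
    using spec[OF *, of b] by (elim exE conjE) (rule that)
  have close: "dB q q' \<le> C * \<rho> ^ n"
    if q: "(p, q) \<in> L" "(p', q') \<in> L"
      and c: "geodesic_from_to T d \<phi> p q c" "geodesic_from_to T d \<phi> p' q' c'"
      and t: "c t = b" "c' t' = b" and eq: "code c t (real n) = code c' t' (real n)"
    for p q p' q' c c' t t' n
  proof -
    have "line c" "line c'" using c by (auto simp: geodesic_from_to_def line_def)
    then obtain s where "s > real n - gap" "s \<ge> 0" "c (t + s) = c' (t' + s)"
      using code_eq[of c c' t t' "real n"] t b eq by auto
    then show ?thesis using **[rule_format, OF bdry(2)[OF q(1)] bdry(2)[OF q(2)] c t] by blast
  qed
  have "\<exists>c t. x \<in> ?S \<longrightarrow> geodesic_from_to T d \<phi> (fst x) (snd x) c \<and> c t = b" for x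
    by (auto simp: leaves_through_def)
  then obtain c t where ct: "\<And>x. x \<in> ?S \<Longrightarrow> geodesic_from_to T d \<phi> (fst x) (snd x) (c x)"
    "\<And>x. x \<in> ?S \<Longrightarrow> c x (t x) = b" by metis
  have SL: "(fst x, snd x) \<in> L" "(snd x, fst x) \<in> L" if "x \<in> ?S" for x
    using that algebraic_laminationD(2)[OF L] by (auto simp: leaves_through_def)
  define key where "key n x = (code (\<lambda>s. c x (- s)) (- t x) (real n), code (c x) (t x) (real n))" for n x
  \<comment> \<open>The growth function is set to 0 at 0, and codes are nonempty only once
    \<open>n\<close> reaches \<open>gap\<close>.\<close>
  define n0 where "n0 = max 1 (nat \<lceil>gap\<rceil>)"
  define \<Gamma> where "\<Gamma> n = {\<gamma> \<in> laminary_language r T d \<phi> L. path_length d \<gamma> \<le> real n}" for n :: nat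
  have fin\<Gamma>: "finite (\<Gamma> n)" for n unfolding \<Gamma>_def by (rule finite_short_language)
  have card\<Gamma>: "card (\<Gamma> n) = lamination_growth r T d \<phi> L n" if "n \<ge> n0" for n
    using that by (simp add: \<Gamma>_def lamination_growth_def n0_def)
  have key: "key n ` ?S \<subseteq> \<Gamma> n \<times> \<Gamma> n" if n: "n \<ge> n0" for n
  proof
    fix k assume "k \<in> key n ` ?S"
    then obtain x where x: "x \<in> ?S" "k = key n x" by blast
    have g: "real n \<ge> gap"
    proof -
      have "n \<ge> nat \<lceil>gap\<rceil>" using n by (simp add: n0_def)
      then show ?thesis by linarith
    qed
    have "code (c x) (t x) (real n) \<in> \<Gamma> n"
      unfolding \<Gamma>_def using ct[OF x(1)] b g by (intro code_in_language[OF _ SL(1)[OF x(1)]]) auto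
    moreover have "code (\<lambda>s. c x (- s)) (- t x) (real n) \<in> \<Gamma> n"
      unfolding \<Gamma>_def using ct(2)[OF x(1)] b g
      by (intro code_in_language[OF geodesic_from_to_reverse[OF ct(1)[OF x(1)]] SL(2)[OF x(1)]]) auto
    ultimately show "k \<in> \<Gamma> n \<times> \<Gamma> n" by (simp add: x key_def)
  qed
  show ?thesis
  proof (rule subexponentially_coveredI[where key = key and C = C and \<rho> = \<rho> and N = n0
        and f = "\<lambda>n. (lamination_growth r T d \<phi> L n)\<^sup>2"])
    show "C > 0" "\<rho> > 0" "\<rho> < 1" by fact+
    show "(\<lambda>n. real ((lamination_growth r T d \<phi> L n)\<^sup>2) / b ^ n) \<longlonglongrightarrow> 0" if "b > 1" for b
      using subexponential_square[OF growth that] .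
    fix n assume n: "n \<ge> n0"
    have fin: "finite (\<Gamma> n \<times> \<Gamma> n)" using fin\<Gamma> by simp
    show "finite (key n ` ?S)" using key[OF n] fin by (rule finite_subset)
    have "card (key n ` ?S) \<le> card (\<Gamma> n \<times> \<Gamma> n)" using fin key[OF n] by (rule card_mono)
    then show "card (key n ` ?S) \<le> (lamination_growth r T d \<phi> L n)\<^sup>2"
      using card\<Gamma>[OF n] by (simp add: card_cartesian_product power2_eq_square)
    fix x y assume x: "x \<in> ?S" and y: "y \<in> ?S" and eq: "key n x = key n y"
    have "dB (snd x) (snd y) \<le> C * \<rho> ^ n"
      using close[OF SL(1)[OF x] SL(1)[OF y] ct(1)[OF x] ct(1)[OF y] ct(2)[OF x] ct(2)[OF y]] eq
      by (simp add: key_def)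
    moreover have "dB (fst x) (fst y) \<le> C * \<rho> ^ n"
      using close[OF SL(2)[OF x] SL(2)[OF y] geodesic_from_to_reverse[OF ct(1)[OF x]]
          geodesic_from_to_reverse[OF ct(1)[OF y]], of "- t x" "- t y" n] ct(2)[OF x] ct(2)[OF y] eq
      by (simp add: key_def)
    ultimately show "max_dist dB x y \<le> C * \<rho> ^ n" by (cases x; cases y) (simp add: max_dist_def)
  qed
qed

text \<open>The set of ends is \<open>fst\<close> applied to \<open>L\<close>. Projection is
  1-Lipschitz for \<open>max_dist\<close>, so the pieces of \<open>L\<close> project to pieces that
  are covered in the same way.\<close>

lemma lamination_dimensions:
  assumes L: "algebraic_lamination r L" and growth: "subexponential (lamination_growth r T d \<phi> L)"
  shows "hausdorff_dim (free_boundary r) dB (Domain L) = 0 \<and> packing_dim (free_boundary r) dB (Domain L) = 0"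
    "hausdorff_dim (free_boundary r \<times> free_boundary r) (max_dist dB) L = 0
      \<and> packing_dim (free_boundary r \<times> free_boundary r) (max_dist dB) L = 0"
proof -
  have metric: "Metric_space (free_boundary r) dB" using visual by (simp add: visual_metric_def)
  let ?S = "leaves_through L ` branch_points T d"
  have LL: "L \<subseteq> free_boundary r \<times> free_boundary r"
    using algebraic_laminationD(1)[OF L] by (auto simp: free_boundary2_def)
  have sub: "leaves_through L b \<subseteq> L" for b by (auto simp: leaves_through_def)
  have cover: "L \<subseteq> \<Union>?S"
  proof
    fix x assume x: "x \<in> L"
    obtain p q where pq: "x = (p, q)" by (cases x)
    have "p \<in> free_boundary r" "q \<in> free_boundary r" "p \<noteq> q"
      using x algebraic_laminationD(1)[OF L] pq by (auto simp: free_boundary2_def)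
    then obtain c where c: "geodesic_from_to T d \<phi> p q c" using geodesic_exists by blast
    then have "line c" by (simp add: geodesic_from_to_def line_def)
    then obtain t where "c t \<in> branch_points T d" using line_branch_dense by blast
    moreover have "x \<in> leaves_through L (c t)" unfolding leaves_through_def using x c pq by auto
    ultimately show "x \<in> \<Union>?S" by blast
  qed
  have covered: "subexponentially_covered (max_dist dB) S" if "S \<in> ?S" for S
    using that leaves_through_covered[OF L growth] by blast
  have count: "countable ?S" using countable_branch_points by (rule countable_image)
  have "\<Union>?S \<subseteq> free_boundary r \<times> free_boundary r" using sub LL by blast
  from Metric_space.dimensions_eq_0[OF Metric_space_max_dist[OF metric] count covered cover this]
  show "hausdorff_dim (free_boundary r \<times> free_boundary r) (max_dist dB) L = 0
      \<and> packing_dim (free_boundary r \<times> free_boundary r) (max_dist dB) L = 0"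
    by (intro conjI)
  have covered1: "subexponentially_covered dB S" if S: "S \<in> (`) fst ` ?S" for S
  proof -
    obtain S' where S': "S = fst ` S'" "S' \<in> ?S" using S by (rule imageE)
    have "dB (fst x) (fst y) \<le> max_dist dB x y" for x y
      by (simp add: max_dist_def split: prod.splits)
    then show ?thesis using subexponentially_covered_image[OF covered[OF S'(2)], of dB fst] S'(1) by simp
  qed
  have "fst ` L \<subseteq> fst ` \<Union>?S" using cover by (rule image_mono)
  then have cover1: "Domain L \<subseteq> \<Union>((`) fst ` ?S)" by (simp only: Domain_fst image_Union)
  have "\<Union>((`) fst ` ?S) \<subseteq> free_boundary r" using sub LL by fastforce
  from Metric_space.dimensions_eq_0[OF metric countable_image[OF count] covered1 cover1 this]
  show "hausdorff_dim (free_boundary r) dB (Domain L) = 0 \<and> packing_dim (free_boundary r) dB (Domain L) = 0"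
    by (intro conjI)
qed

end

theorem theorem7p11:
  fixes r :: nat and a :: real
    and X :: "'x set" and dX :: "'x \<Rightarrow> 'x \<Rightarrow> real" and \<phi> :: "word \<Rightarrow> 'x \<Rightarrow> 'x" and x0 :: 'x
    and d :: "bdry \<Rightarrow> bdry \<Rightarrow> real" and L :: "(bdry \<times> bdry) set"
  assumes "r \<ge> 2" and "a > 1"
    and "proper_space X dX" and "geodesic_space X dX" and "gromov_hyperbolic X dX"
    and "geometric_action (free_group r) X dX \<phi>"
    and "x0 \<in> X" and "visual_metric r X dX \<phi> x0 a d"
    and "algebraic_lamination r L"
    and "subexponentially_growing TYPE('t) r L"
  shows "(hausdorff_dim (free_boundary r) d (Domain L) = 0
          \<and> packing_dim (free_boundary r) d (Domain L) = 0)
       \<and> (hausdorff_dim (free_boundary r \<times> free_boundary r) (max_dist d) L = 0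
          \<and> packing_dim (free_boundary r \<times> free_boundary r) (max_dist d) L = 0)"
proof -
  obtain T :: "'t set" and dT \<psi> where T: "cv r T dT \<psi>" and growth: "subexponential (lamination_growth r T dT \<psi> L)"
    using assms(10) unfolding subexponentially_growing_def by blast
  obtain v where v: "v \<in> T" using T by (auto simp: cv_def)
  interpret visual_boundary r T dT \<psi> v X dX \<phi> x0 a d
    by unfold_locales (use assms T v in auto)
  show ?thesis using lamination_dimensions[OF assms(9) growth] by blast
qed

end
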